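(* Let $n>1$ and let $(M',g',I',J',K')$ be a $4(n-1)$-dimensional hyper-Kähler manifold on which there are $1$-forms $\alpha_{I'},\alpha_{J'},\alpha_{K'}$ with $$\Omega_{I'}=d\alpha_{I'},\quad \Omega_{J'}=d\alpha_{J'},\quad \Omega_{K'}=d\alpha_{K'},$$ where $\Omega_{I'},\Omega_{J'},\Omega_{K'}$ are the Kähler forms. Let $(t,u,v,w)$ be the standard coordinates on $\mathbb H\cong\mathbb R^4$ ($q=t+ui+vj+wk$), let $M=\{q\in\mathbb H: t>0\}\times M'$, let $\pi:M\to M'$ be the projection, and let $\nu<0$ be a constant. Define an almost hypercomplex structure $(I,J,K)$ on $M$ by $$I\,dt=-du+\nu\pi^*\alpha_{I'},\quad J\,dt=-dv+\nu\pi^*\alpha_{J'},\quad K\,dt=-dw+\nu\pi^*\alpha_{K'},$$ $$I\pi^*\beta=\pi^*I'\beta,\quad J\pi^*\beta=\pi^*J'\beta,\quad K\pi^*\beta=\pi^*K'\beta,\qquad \beta\in T^*M',$$ and a Riemannian metric $$g=-\frac{1}{\nu t^2}(\mathbf 1+\mathbf L)\,dt\otimes dt+\frac1t\,\pi^*g'.$$ Then $(M,g,I,J,K)$ is a hHqK manifold with reduced scalar curvature $\nu$ and Lee form $\varphi=-d\ln t$, which satisfies $|\varphi|^2+\nu=0$.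
   Context: An almost hypercomplex structure is a triple $(I,J,K)$ of almost complex structures with $I^2=J^2=K^2=-\mathbf 1=IJK$; it is hypercomplex if $I,J,K$ are integrable. Each acts on $1$-forms by $I\psi=-\psi\circ I$ (so the quaternionic relations also hold for the action on $1$-forms, and the given formulas determine $I,J,K$ on $M$). For an orthogonal $I$, the Kähler form is $\Omega_I(X,Y)=g(IX,Y)$. $\mathbf L=I\otimes I+J\otimes J+K\otimes K$ acts on bilinear forms by $(\mathbf LB)(X,Y)=B(IX,IY)+B(JX,JY)+B(KX,KY)$, so $(\mathbf 1+\mathbf L)\,dt\otimes dt=dt\otimes dt+I dt\otimes I dt+Jdt\otimes Jdt+Kdt\otimes Kdt$. A hyper-Kähler manifold is a Riemannian manifold with an almost hypercomplex structure $(I',J',K')$ consisting of orthogonal parallel almost complex structures. A quaternionic Kähler manifold of dimension $4n$, $n>1$, is a Riemannian manifold $(M,g)$ with a parallel (for the Levi-Civita connection $\nabla$) rank-$3$ subbundle $S^2H\subset\mathrm{End}(TM)$ locally trivialized by triples of orthogonal almost complex structures satisfying the quaternionic identities above. It is Einstein; its reduced scalar curvature is $\nu=\frac{s}{4n(n+2)}$, $s$ the scalar curvature. A hyper-Hermitian quaternionic Kähler (hHqK) manifold is a quaternionic Kähler manifold with $s\neq0$ together with a global trivialization of $S^2H$ by a hypercomplex structure $(I,J,K)$. The Lee form of $(g,I)$ is $\varphi(X)=\frac12\,\mathrm{trace}\{Z\mapsto I(\nabla_ZI)X\}$; for a hypercomplex structure orthogonal with respect to $g$ the Lee forms of $I,J,K$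 coincide, and this common form is the Lee form of the hHqK manifold. *)

theory Defs
  imports "HOL-Analysis.Analysis"
begin

section \<open>Smooth functions on open subsets of a Euclidean space\<close>

abbreviation D :: "('e::euclidean_space \<Rightarrow> 'f::real_normed_vector) \<Rightarrow> 'e \<Rightarrow> 'e \<Rightarrow> 'f" where
  "D f x v \<equiv> frechet_derivative f (at x) v"

primrec C_k_on :: "nat \<Rightarrow> 'e::euclidean_space set \<Rightarrow> ('e \<Rightarrow> 'f::real_normed_vector) \<Rightarrow> bool" where
  "C_k_on 0 S f \<longleftrightarrow> continuous_on S f"
| "C_k_on (Suc k) S f \<longleftrightarrow>
     (\<forall>x\<in>S. f differentiable (at x)) \<and> (\<forall>v. C_k_on k S (\<lambda>x. D f x v))"

definition smooth_on :: "'e::euclidean_space set \<Rightarrow> ('e \<Rightarrow> 'f::real_normed_vector) \<Rightarrow> bool" where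
  "smooth_on S f \<longleftrightarrow> (\<forall>k. C_k_on k S f)"


section \<open>Smooth manifolds\<close>

text \<open>A smooth manifold modelled on the Euclidean space \<open>'e\<close> is given by a topology and a (not
  necessarily maximal) smooth atlas. Neither connectedness nor non-emptiness is required.\<close>

type_synonym ('a, 'e) chart = "'a set \<times> ('a \<Rightarrow> 'e)"

record ('a, 'e) mfd =
  mtop :: "'a topology"
  atlas :: "('a, 'e) chart set"

abbreviation cdom :: "('a, 'e) chart \<Rightarrow> 'a set" where "cdom c \<equiv> fst c"
abbreviation cmap :: "('a, 'e) chart \<Rightarrow> 'a \<Rightarrow> 'e" where "cmap c \<equiv> snd c"

definition cimg :: "('a, 'e) chart \<Rightarrow> 'e set" where
  "cimg c = cmap c ` cdom c"

definition cinv :: "('a, 'e) chart \<Rightarrow> 'e \<Rightarrow> 'a" where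
  "cinv c = inv_into (cdom c) (cmap c)"

definition transition :: "('a, 'e) chart \<Rightarrow> ('a, 'e) chart \<Rightarrow> 'e \<Rightarrow> 'e" where
  "transition c c' = cmap c' \<circ> cinv c"

definition smooth_manifold :: "('a, 'e::euclidean_space) mfd \<Rightarrow> bool" where
  "smooth_manifold M \<longleftrightarrow>
     Hausdorff_space (mtop M) \<and> second_countable (mtop M) \<and>
     (\<Union>c\<in>atlas M. cdom c) = topspace (mtop M) \<and>
     (\<forall>c\<in>atlas M. openin (mtop M) (cdom c) \<and> open (cimg c) \<and>
        homeomorphic_map (subtopology (mtop M) (cdom c)) (top_of_set (cimg c)) (cmap c)) \<and>
     (\<forall>c\<in>atlas M. \<forall>c'\<in>atlas M. smooth_on (cmap c ` (cdom c \<inter> cdom c')) (transition c c'))"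

definition prod_mfd :: "('a, 'e) mfd \<Rightarrow> ('b, 'f) mfd \<Rightarrow> ('a \<times> 'b, 'e \<times> 'f) mfd" where
  "prod_mfd M N =
     \<lparr> mtop = prod_topology (mtop M) (mtop N),
       atlas = {(cdom c \<times> cdom c', map_prod (cmap c) (cmap c')) | c c'.
                  c \<in> atlas M \<and> c' \<in> atlas N} \<rparr>"

definition open_submanifold :: "'e::euclidean_space set \<Rightarrow> ('e, 'e) mfd" where
  "open_submanifold S = \<lparr> mtop = top_of_set S, atlas = {(S, id)} \<rparr>"


section \<open>Tensor fields\<close>

text \<open>A tensor field is the family of its coordinate representations: \<open>T c x\<close>, for a chart \<open>c\<close> and
  a point \<open>x\<close> of its image, is a tensor on the model space \<open>'e\<close>, and representations in
  overlapping charts are related by the derivative of the transition map. Values off the chart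
  images carry no information.\<close>

type_synonym ('a, 'e) form1 = "('a, 'e) chart \<Rightarrow> 'e \<Rightarrow> 'e \<Rightarrow> real"
type_synonym ('a, 'e) bilin = "('a, 'e) chart \<Rightarrow> 'e \<Rightarrow> 'e \<Rightarrow> 'e \<Rightarrow> real"
type_synonym ('a, 'e) endo = "('a, 'e) chart \<Rightarrow> 'e \<Rightarrow> 'e \<Rightarrow> 'e"

text \<open>Pointwise choices of covectors, not required to depend smoothly on the point.\<close>
definition covector_field :: "('a, 'e::euclidean_space) mfd \<Rightarrow> ('a, 'e) form1 \<Rightarrow> bool" where
  "covector_field M \<beta> \<longleftrightarrow>
     (\<forall>c\<in>atlas M. \<forall>x\<in>cimg c. linear (\<beta> c x)) \<and>
     (\<forall>c\<in>atlas M. \<forall>c'\<in>atlas M. \<forall>p\<in>cdom c \<inter> cdom c'. \<forall>v.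
        \<beta> c (cmap c p) v = \<beta> c' (cmap c' p) (D (transition c c') (cmap c p) v))"

definition one_form :: "('a, 'e::euclidean_space) mfd \<Rightarrow> ('a, 'e) form1 \<Rightarrow> bool" where
  "one_form M \<beta> \<longleftrightarrow>
     covector_field M \<beta> \<and> (\<forall>c\<in>atlas M. \<forall>v. smooth_on (cimg c) (\<lambda>x. \<beta> c x v))"

definition bilinear_form :: "('a, 'e::euclidean_space) mfd \<Rightarrow> ('a, 'e) bilin \<Rightarrow> bool" where
  "bilinear_form M B \<longleftrightarrow>
     (\<forall>c\<in>atlas M. \<forall>x\<in>cimg c. bilinear (B c x)) \<and>
     (\<forall>c\<in>atlas M. \<forall>c'\<in>atlas M. \<forall>p\<in>cdom c \<inter> cdom c'. \<forall>v w.
        B c (cmap c p) v w =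
        B c' (cmap c' p) (D (transition c c') (cmap c p) v) (D (transition c c') (cmap c p) w)) \<and>
     (\<forall>c\<in>atlas M. \<forall>v w. smooth_on (cimg c) (\<lambda>x. B c x v w))"

definition endo_field :: "('a, 'e::euclidean_space) mfd \<Rightarrow> ('a, 'e) endo \<Rightarrow> bool" where
  "endo_field M A \<longleftrightarrow>
     (\<forall>c\<in>atlas M. \<forall>x\<in>cimg c. linear (A c x)) \<and>
     (\<forall>c\<in>atlas M. \<forall>c'\<in>atlas M. \<forall>p\<in>cdom c \<inter> cdom c'. \<forall>v.
        D (transition c c') (cmap c p) (A c (cmap c p) v) =
        A c' (cmap c' p) (D (transition c c') (cmap c p) v)) \<and>
     (\<forall>c\<in>atlas M. \<forall>v. smooth_on (cimg c) (\<lambda>x. A c x v))"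

text \<open>Equality of fields of 1-forms (or, with another value type, of bilinear forms).\<close>
definition field_eq ::
    "('a, 'e) mfd \<Rightarrow> (('a, 'e) chart \<Rightarrow> 'e \<Rightarrow> 'f) \<Rightarrow> (('a, 'e) chart \<Rightarrow> 'e \<Rightarrow> 'f) \<Rightarrow> bool" where
  "field_eq M S T \<longleftrightarrow> (\<forall>c\<in>atlas M. \<forall>x\<in>cimg c. S c x = T c x)"

definition differential :: "('a \<Rightarrow> real) \<Rightarrow> ('a, 'e::euclidean_space) form1" where
  "differential f c x v = D (f \<circ> cinv c) x v"

text \<open>Normalised so that \<open>d\<alpha>(X,Y) = X \<alpha>(Y) - Y \<alpha>(X) - \<alpha>([X,Y])\<close>.\<close>
definition ext_deriv :: "('a, 'e::euclidean_space) form1 \<Rightarrow> ('a, 'e) bilin" where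
  "ext_deriv \<alpha> c x v w = D (\<lambda>y. \<alpha> c y w) x v - D (\<lambda>y. \<alpha> c y v) x w"

definition tensor :: "('a, 'e) form1 \<Rightarrow> ('a, 'e) form1 \<Rightarrow> ('a, 'e) bilin" where
  "tensor \<alpha> \<beta> c x v w = \<alpha> c x v * \<beta> c x w"

text \<open>Pull-back along \<open>F : M \<rightarrow> N\<close>; by the transformation law it does not depend on the
  chart chosen around the image point.\<close>

definition chart_at :: "('b, 'f) mfd \<Rightarrow> 'b \<Rightarrow> ('b, 'f) chart" where
  "chart_at N q = (SOME c. c \<in> atlas N \<and> q \<in> cdom c)"

definition pullback1 :: "('b, 'f::euclidean_space) mfd \<Rightarrow> ('a \<Rightarrow> 'b) \<Rightarrow> ('b, 'f) form1
    \<Rightarrow> ('a, 'e::euclidean_space) form1" where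
  "pullback1 N F \<beta> c x v =
     (let q = F (cinv c x); c' = chart_at N q in
      \<beta> c' (cmap c' q) (D (cmap c' \<circ> F \<circ> cinv c) x v))"

definition pullback2 :: "('b, 'f::euclidean_space) mfd \<Rightarrow> ('a \<Rightarrow> 'b) \<Rightarrow> ('b, 'f) bilin
    \<Rightarrow> ('a, 'e::euclidean_space) bilin" where
  "pullback2 N F B c x v w =
     (let q = F (cinv c x); c' = chart_at N q in
      B c' (cmap c' q) (D (cmap c' \<circ> F \<circ> cinv c) x v) (D (cmap c' \<circ> F \<circ> cinv c) x w))"


section \<open>Riemannian geometry\<close>

definition riemannian_metric :: "('a, 'e::euclidean_space) mfd \<Rightarrow> ('a, 'e) bilin \<Rightarrow> bool" where
  "riemannian_metric M g \<longleftrightarrow>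
     bilinear_form M g \<and>
     (\<forall>c\<in>atlas M. \<forall>x\<in>cimg c. (\<forall>v w. g c x v w = g c x w v) \<and> (\<forall>v. v \<noteq> 0 \<longrightarrow> 0 < g c x v v))"

text \<open>The Levi-Civita connection in a chart: \<open>\<nabla>\<^sub>v Y = D Y v + G v Y\<close>, where \<open>G\<close> (the
  Christoffel symbols at the point) is the unique bilinear map for which \<open>\<nabla>\<close> is torsion-free and
  \<open>g\<close> is parallel.\<close>
definition levi_civita :: "('a, 'e::euclidean_space) bilin \<Rightarrow> ('a, 'e) chart \<Rightarrow> 'e \<Rightarrow> 'e \<Rightarrow> 'e \<Rightarrow> 'e"
  where
  "levi_civita g c x =
     (THE G. bilinear G \<and> (\<forall>v w. G v w = G w v) \<and>
        (\<forall>z v w. D (\<lambda>y. g c y v w) x z = g c x (G z v) w + g c x v (G z w)))"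

text \<open>\<open>(\<nabla>\<^sub>z A) w\<close> in the chart \<open>c\<close>, for a field of endomorphisms \<open>A\<close> defined near \<open>x\<close>.\<close>
definition nabla_endo :: "('a, 'e::euclidean_space) bilin \<Rightarrow> ('a, 'e) chart \<Rightarrow> ('e \<Rightarrow> 'e \<Rightarrow> 'e)
    \<Rightarrow> 'e \<Rightarrow> 'e \<Rightarrow> 'e \<Rightarrow> 'e" where
  "nabla_endo g c A x z w =
     D (\<lambda>y. A y w) x z + levi_civita g c x z (A x w) - A x (levi_civita g c x z w)"

definition endo_trace :: "('e::euclidean_space \<Rightarrow> 'e) \<Rightarrow> real" where
  "endo_trace f = (\<Sum>b\<in>Basis. f b \<bullet> b)"

text \<open>\<open>R(v,w)z\<close>, with \<open>R(X,Y) = \<nabla>\<^sub>X \<nabla>\<^sub>Y - \<nabla>\<^sub>Y \<nabla>\<^sub>X - \<nabla>\<^sub>[\<^sub>X\<^sub>,\<^sub>Y\<^sub>]\<close>.\<close>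
definition riemann :: "('a, 'e::euclidean_space) bilin \<Rightarrow> ('a, 'e) chart \<Rightarrow> 'e
    \<Rightarrow> 'e \<Rightarrow> 'e \<Rightarrow> 'e \<Rightarrow> 'e" where
  "riemann g c x v w z =
     D (\<lambda>y. levi_civita g c y w z) x v - D (\<lambda>y. levi_civita g c y v z) x w
     + levi_civita g c x v (levi_civita g c x w z)
     - levi_civita g c x w (levi_civita g c x v z)"

definition ricci :: "('a, 'e::euclidean_space) bilin \<Rightarrow> ('a, 'e) bilin" where
  "ricci g c x w z = endo_trace (\<lambda>v. riemann g c x v w z)"

text \<open>The vector metrically dual to a covector.\<close>
definition sharp :: "('a, 'e::euclidean_space) bilin \<Rightarrow> ('a, 'e) chart \<Rightarrow> 'e \<Rightarrow> ('e \<Rightarrow> real) \<Rightarrow> 'e"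
  where
  "sharp g c x \<phi> = (THE u. \<forall>w. g c x u w = \<phi> w)"

definition scalar_curvature :: "('a, 'e::euclidean_space) bilin \<Rightarrow> ('a, 'e) chart \<Rightarrow> 'e \<Rightarrow> real" where
  "scalar_curvature g c x = endo_trace (\<lambda>v. sharp g c x (ricci g c x v))"

definition norm_sq :: "('a, 'e::euclidean_space) bilin \<Rightarrow> ('a, 'e) form1 \<Rightarrow> ('a, 'e) chart \<Rightarrow> 'e \<Rightarrow> real"
  where
  "norm_sq g \<phi> c x = \<phi> c x (sharp g c x (\<phi> c x))"


section \<open>Almost hypercomplex, hypercomplex and hyper-Kaehler structures\<close>

definition quaternionic_triple :: "('e \<Rightarrow> 'e) \<Rightarrow> ('e \<Rightarrow> 'e) \<Rightarrow> ('e \<Rightarrow> 'e::real_vector) \<Rightarrow> bool" where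
  "quaternionic_triple I J K \<longleftrightarrow>
     (\<forall>v. I (I v) = - v \<and> J (J v) = - v \<and> K (K v) = - v \<and> I (J (K v)) = - v)"

definition almost_hypercomplex :: "('a, 'e::euclidean_space) mfd
    \<Rightarrow> ('a, 'e) endo \<Rightarrow> ('a, 'e) endo \<Rightarrow> ('a, 'e) endo \<Rightarrow> bool" where
  "almost_hypercomplex M I J K \<longleftrightarrow>
     endo_field M I \<and> endo_field M J \<and> endo_field M K \<and>
     (\<forall>c\<in>atlas M. \<forall>x\<in>cimg c. quaternionic_triple (I c x) (J c x) (K c x))"

definition lie_bracket :: "('e::euclidean_space \<Rightarrow> 'e) \<Rightarrow> ('e \<Rightarrow> 'e) \<Rightarrow> 'e \<Rightarrow> 'e" where
  "lie_bracket X Y x = D Y x (X x) - D X x (Y x)"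

text \<open>Integrability of an almost complex structure: its Nijenhuis tensor vanishes, i.e.
  \<open>[IX,IY] - I[IX,Y] - I[X,IY] - [X,Y] = 0\<close> for all local vector fields \<open>X\<close>, \<open>Y\<close>.\<close>
definition integrable :: "('a, 'e::euclidean_space) mfd \<Rightarrow> ('a, 'e) endo \<Rightarrow> bool" where
  "integrable M I \<longleftrightarrow>
     (\<forall>c\<in>atlas M. \<forall>V X Y. open V \<and> V \<subseteq> cimg c \<and> smooth_on V X \<and> smooth_on V Y \<longrightarrow>
       (let IX = (\<lambda>y. I c y (X y)); IY = (\<lambda>y. I c y (Y y)) in
        \<forall>x\<in>V. lie_bracket IX IY x - I c x (lie_bracket IX Y x) - I c x (lie_bracket X IY x)
               - lie_bracket X Y x = 0))"

definition hypercomplex :: "('a, 'e::euclidean_space) mfd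
    \<Rightarrow> ('a, 'e) endo \<Rightarrow> ('a, 'e) endo \<Rightarrow> ('a, 'e) endo \<Rightarrow> bool" where
  "hypercomplex M I J K \<longleftrightarrow>
     almost_hypercomplex M I J K \<and> integrable M I \<and> integrable M J \<and> integrable M K"

definition orthogonal_endo :: "('a, 'e) mfd \<Rightarrow> ('a, 'e) bilin \<Rightarrow> ('a, 'e) endo \<Rightarrow> bool" where
  "orthogonal_endo M g I \<longleftrightarrow>
     (\<forall>c\<in>atlas M. \<forall>x\<in>cimg c. \<forall>v w. g c x (I c x v) (I c x w) = g c x v w)"

definition parallel_endo :: "('a, 'e::euclidean_space) mfd \<Rightarrow> ('a, 'e) bilin \<Rightarrow> ('a, 'e) endo \<Rightarrow> bool"
  where
  "parallel_endo M g I \<longleftrightarrow>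
     (\<forall>c\<in>atlas M. \<forall>x\<in>cimg c. \<forall>z w. nabla_endo g c (I c) x z w = 0)"

definition hyper_kaehler :: "('a, 'e::euclidean_space) mfd \<Rightarrow> ('a, 'e) bilin
    \<Rightarrow> ('a, 'e) endo \<Rightarrow> ('a, 'e) endo \<Rightarrow> ('a, 'e) endo \<Rightarrow> bool" where
  "hyper_kaehler M g I J K \<longleftrightarrow>
     smooth_manifold M \<and> riemannian_metric M g \<and> almost_hypercomplex M I J K \<and>
     (\<forall>A\<in>{I, J, K}. orthogonal_endo M g A \<and> parallel_endo M g A)"

definition kaehler_form :: "('a, 'e) bilin \<Rightarrow> ('a, 'e) endo \<Rightarrow> ('a, 'e) bilin" where
  "kaehler_form g I c x v w = g c x (I c x v) w"

definition act :: "('a, 'e) endo \<Rightarrow> ('a, 'e) form1 \<Rightarrow> ('a, 'e) form1" where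
  "act I \<psi> c x v = - \<psi> c x (I c x v)"

definition L_op :: "('a, 'e) endo \<Rightarrow> ('a, 'e) endo \<Rightarrow> ('a, 'e) endo \<Rightarrow> ('a, 'e) bilin \<Rightarrow> ('a, 'e) bilin"
  where
  "L_op I J K B c x v w =
     B c x (I c x v) (I c x w) + B c x (J c x v) (J c x w) + B c x (K c x v) (K c x w)"


section \<open>Quaternionic Kaehler and hHqK manifolds\<close>

text \<open>A family of sets of endomorphisms, one at each point; a subbundle of \<open>End(TM)\<close> when subject to
  the conditions below.\<close>
type_synonym ('a, 'e) endo_subbundle = "('a, 'e) chart \<Rightarrow> 'e \<Rightarrow> ('e \<Rightarrow> 'e) set"

definition span3 :: "('e \<Rightarrow> 'e) \<Rightarrow> ('e \<Rightarrow> 'e) \<Rightarrow> ('e \<Rightarrow> 'e::real_vector) \<Rightarrow> ('e \<Rightarrow> 'e) set" where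
  "span3 I J K = {\<lambda>v. a *\<^sub>R I v + b *\<^sub>R J v + c *\<^sub>R K v | a b c. True}"

definition smooth_endo_on :: "'e::euclidean_space set \<Rightarrow> ('e \<Rightarrow> 'e \<Rightarrow> 'e) \<Rightarrow> bool" where
  "smooth_endo_on V A \<longleftrightarrow> (\<forall>y\<in>V. linear (A y)) \<and> (\<forall>v. smooth_on V (\<lambda>y. A y v))"

text \<open>A triple of endomorphisms satisfying the quaternionic identities is linearly independent, so
  the rank is automatically 3.\<close>
definition quaternionic_subbundle ::
    "('a, 'e::euclidean_space) mfd \<Rightarrow> ('a, 'e) bilin \<Rightarrow> ('a, 'e) endo_subbundle \<Rightarrow> bool" where
  "quaternionic_subbundle M g S \<longleftrightarrow>
     (\<forall>c\<in>atlas M. \<forall>c'\<in>atlas M. \<forall>p\<in>cdom c \<inter> cdom c'.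
        let T = D (transition c c') (cmap c p) in
        S c' (cmap c' p) = (\<lambda>A. T \<circ> A \<circ> inv T) ` S c (cmap c p)) \<and>
     (\<forall>c\<in>atlas M. \<forall>x\<in>cimg c. \<exists>V I J K. open V \<and> x \<in> V \<and> V \<subseteq> cimg c \<and>
        smooth_endo_on V I \<and> smooth_endo_on V J \<and> smooth_endo_on V K \<and>
        (\<forall>y\<in>V. quaternionic_triple (I y) (J y) (K y) \<and>
           (\<forall>A\<in>{I, J, K}. \<forall>v w. g c y (A y v) (A y w) = g c y v w) \<and>
           S c y = span3 (I y) (J y) (K y)))"

text \<open>The covariant derivatives of local sections are again sections.\<close>
definition parallel_subbundle ::
    "('a, 'e::euclidean_space) mfd \<Rightarrow> ('a, 'e) bilin \<Rightarrow> ('a, 'e) endo_subbundle \<Rightarrow> bool" where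
  "parallel_subbundle M g S \<longleftrightarrow>
     (\<forall>c\<in>atlas M. \<forall>V A. open V \<and> V \<subseteq> cimg c \<and> smooth_endo_on V A \<and> (\<forall>y\<in>V. A y \<in> S c y) \<longrightarrow>
        (\<forall>x\<in>V. \<forall>z. nabla_endo g c A x z \<in> S c x))"

definition quaternionic_kaehler :: "nat \<Rightarrow> ('a, 'e::euclidean_space) mfd \<Rightarrow> ('a, 'e) bilin
    \<Rightarrow> ('a, 'e) endo_subbundle \<Rightarrow> bool" where
  "quaternionic_kaehler n M g S \<longleftrightarrow>
     n > 1 \<and> DIM('e) = 4 * n \<and> smooth_manifold M \<and> riemannian_metric M g \<and>
     quaternionic_subbundle M g S \<and> parallel_subbundle M g S"

definition has_reduced_scalar_curvature ::
    "nat \<Rightarrow> ('a, 'e::euclidean_space) mfd \<Rightarrow> ('a, 'e) bilin \<Rightarrow> real \<Rightarrow> bool" where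
  "has_reduced_scalar_curvature n M g \<nu> \<longleftrightarrow>
     (\<forall>c\<in>atlas M. \<forall>x\<in>cimg c. scalar_curvature g c x / (4 * real n * (real n + 2)) = \<nu>)"

definition hHqK :: "nat \<Rightarrow> ('a, 'e::euclidean_space) mfd \<Rightarrow> ('a, 'e) bilin
    \<Rightarrow> ('a, 'e) endo \<Rightarrow> ('a, 'e) endo \<Rightarrow> ('a, 'e) endo \<Rightarrow> bool" where
  "hHqK n M g I J K \<longleftrightarrow>
     (\<exists>S. quaternionic_kaehler n M g S \<and>
        (\<forall>c\<in>atlas M. \<forall>x\<in>cimg c. S c x = span3 (I c x) (J c x) (K c x))) \<and>
     (\<forall>c\<in>atlas M. \<forall>x\<in>cimg c. scalar_curvature g c x \<noteq> 0) \<and>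
     hypercomplex M I J K"

definition lee_form :: "('a, 'e::euclidean_space) bilin \<Rightarrow> ('a, 'e) endo \<Rightarrow> ('a, 'e) form1" where
  "lee_form g I c x v = (1/2) * endo_trace (\<lambda>z. I c x (nabla_endo g c (I c) x z v))"

text \<open>\<open>\<phi>\<close> is the common Lee form of \<open>I\<close>, \<open>J\<close>, \<open>K\<close>.\<close>
definition has_lee_form :: "('a, 'e::euclidean_space) mfd \<Rightarrow> ('a, 'e) bilin
    \<Rightarrow> ('a, 'e) endo \<Rightarrow> ('a, 'e) endo \<Rightarrow> ('a, 'e) endo \<Rightarrow> ('a, 'e) form1 \<Rightarrow> bool" where
  "has_lee_form M g I J K \<phi> \<longleftrightarrow> (\<forall>A\<in>{I, J, K}. field_eq M (lee_form g A) \<phi>)"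


section \<open>The manifold \<open>{t > 0} \<times> M'\<close>\<close>

text \<open>\<open>q = t + ui + vj + wk\<close> is represented by \<open>(t, u, v, w)\<close>.\<close>
type_synonym quat = "real \<times> real \<times> real \<times> real"

definition half_space_prod :: "('a, 'e) mfd \<Rightarrow> (quat \<times> 'a, quat \<times> 'e) mfd" where
  "half_space_prod M' = prod_mfd (open_submanifold {q. fst q > 0}) M'"

definition t_coord :: "quat \<times> 'a \<Rightarrow> real" where "t_coord = (\<lambda>((t, u, v, w), m). t)"
definition u_coord :: "quat \<times> 'a \<Rightarrow> real" where "u_coord = (\<lambda>((t, u, v, w), m). u)"
definition v_coord :: "quat \<times> 'a \<Rightarrow> real" where "v_coord = (\<lambda>((t, u, v, w), m). v)"
definition w_coord :: "quat \<times> 'a \<Rightarrow> real" where "w_coord = (\<lambda>((t, u, v, w), m). w)"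

text \<open>\<open>(I, J, K)\<close> is an almost hypercomplex structure on \<open>M\<close> whose action on 1-forms satisfies the
  given formulas. The clause for pulled-back covectors \<open>\<beta>\<close> is quantified over arbitrary (possibly
  non-smooth) covector fields, so that \<open>\<beta>\<close> takes every value at every point of \<open>M'\<close>.\<close>
definition lifted_structure :: "real \<Rightarrow> ('a, 'e::euclidean_space) mfd
    \<Rightarrow> ('a, 'e) endo \<Rightarrow> ('a, 'e) endo \<Rightarrow> ('a, 'e) endo
    \<Rightarrow> ('a, 'e) form1 \<Rightarrow> ('a, 'e) form1 \<Rightarrow> ('a, 'e) form1
    \<Rightarrow> (quat \<times> 'a, quat \<times> 'e) endo \<Rightarrow> (quat \<times> 'a, quat \<times> 'e) endo \<Rightarrow> (quat \<times> 'a, quat \<times> 'e) endo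
    \<Rightarrow> bool" where
  "lifted_structure \<nu> M' I' J' K' \<alpha>I \<alpha>J \<alpha>K I J K \<longleftrightarrow>
     (let M = half_space_prod M';
          dt = differential t_coord; du = differential u_coord;
          dv = differential v_coord; dw = differential w_coord;
          pull = pullback1 M' snd
      in almost_hypercomplex M I J K \<and>
         field_eq M (act I dt) (\<lambda>c x h. - du c x h + \<nu> * pull \<alpha>I c x h) \<and>
         field_eq M (act J dt) (\<lambda>c x h. - dv c x h + \<nu> * pull \<alpha>J c x h) \<and>
         field_eq M (act K dt) (\<lambda>c x h. - dw c x h + \<nu> * pull \<alpha>K c x h) \<and>
         (\<forall>\<beta>. covector_field M' \<beta> \<longrightarrow>
            field_eq M (act I (pull \<beta>)) (pull (act I' \<beta>)) \<and>
            field_eq M (act J (pull \<beta>)) (pull (act J' \<beta>)) \<and>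
            field_eq M (act K (pull \<beta>)) (pull (act K' \<beta>))))"

text \<open>\<open>g = -1/(\<nu> t\<^sup>2) (1 + L) (dt \<otimes> dt) + 1/t \<pi>\<^sup>*g'\<close>\<close>
definition lifted_metric :: "real \<Rightarrow> ('a, 'e::euclidean_space) mfd \<Rightarrow> ('a, 'e) bilin
    \<Rightarrow> (quat \<times> 'a, quat \<times> 'e) endo \<Rightarrow> (quat \<times> 'a, quat \<times> 'e) endo \<Rightarrow> (quat \<times> 'a, quat \<times> 'e) endo
    \<Rightarrow> (quat \<times> 'a, quat \<times> 'e) bilin" where
  "lifted_metric \<nu> M' g' I J K c x h k =
     (let t = t_coord (cinv c x); dt2 = tensor (differential t_coord) (differential t_coord) in
      - (1 / (\<nu> * t\<^sup>2)) * (dt2 c x h k + L_op I J K dt2 c x h k)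
      + (1 / t) * pullback2 M' snd g' c x h k)"

end

theory Submission
  imports Defs
begin

text \<open>
  Write \<open>\<theta>0, \<theta>1, \<theta>2, \<theta>3\<close> for the forms \<open>dt, I dt, J dt, K dt\<close>. Together with the projection to the base
  they form a coframe in which \<open>I\<close>, \<open>J\<close>, \<open>K\<close> act as left multiplication by the quaternion units on
  \<open>(\<theta>0, \<theta>1, \<theta>2, \<theta>3)\<close> and as \<open>I'\<close>, \<open>J'\<close>, \<open>K'\<close> on the base. The prescribed formulas determine the structure
  (\<open>lifted_structure_iff\<close>), and the coframe also constructs one (\<open>lifted_structure_exists\<close>).

  Because the potentials have the Kaehler forms as differentials, \<open>d\<theta>1\<close>, \<open>d\<theta>2\<close>, \<open>d\<theta>3\<close> are \<open>\<nu>\<close> times the pulled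
  back Kaehler forms, and Koszul's formula gives the Levi-Civita connection of the lifted metric in this
  coframe explicitly (\<open>christoffel\<close>, \<open>levi_civita_total\<close>). Since \<open>I'\<close>, \<open>J'\<close>, \<open>K'\<close> are parallel, it follows that
  \<open>\<nabla>I = \<gamma> J - \<beta> K\<close>, and cyclically, with the connection forms
  \<open>\<alpha> = - \<theta>1 / t\<close>, \<open>\<beta> = - \<theta>2 / t\<close>, \<open>\<gamma> = - \<theta>3 / t\<close> (\<open>nabla_I\<close>). Everything else is read off from these
  formulas. The span of \<open>I\<close>, \<open>J\<close>, \<open>K\<close> is parallel (\<open>nabla_in_span\<close>). The structures are integrable because
  \<open>\<beta> + i\<gamma>\<close> is of type \<open>(1,0)\<close> for \<open>I\<close> (\<open>nijenhuis_zero\<close>). The Lee form is the trace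
  \<open>(\<gamma> \<circ> K + \<beta> \<circ> J) / 2 = - dt / t\<close> (\<open>lee_form_eq\<close>), and its norm is that of \<open>dt\<close> divided by \<open>t\<close>.

  For the scalar curvature the Riemann tensor itself is never computed. The curvature forms
  \<open>d\<alpha> + \<beta> \<and> \<gamma>\<close>, and cyclically, of the connection on the span are \<open>- \<nu>\<close> times the Kaehler forms
  (\<open>curvature_form_I\<close>). By the Ricci identity they are the coefficients of the commutators of the Riemann
  tensor with \<open>I\<close>, \<open>J\<close>, \<open>K\<close> (\<open>curvature_commutator\<close>). Tracing the first Bianchi identity against \<open>I\<close>, \<open>J\<close>, \<open>K\<close>
  then determines the Ricci tensor (\<open>ricci_twisted\<close>, \<open>einstein_of_quaternionic_curvature\<close>): the metric is
  Einstein with constant \<open>(n + 2) \<nu>\<close>, so the scalar curvature is \<open>4 n (n + 2) \<nu>\<close>.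

  The analytic prerequisites are the symmetry of second derivatives (\<open>second_derivative_symmetric\<close>), which
  enters through the Ricci identity and the skewness of the curvature, and the differentiability of the
  Christoffel symbols (\<open>differentiable_raise\<close>).
\<close>

section \<open>Calculus of the Frechet derivative\<close>

lemma D_cong:
  assumes "open S" "x \<in> S" "\<And>y. y \<in> S \<Longrightarrow> f y = g y"
  shows "frechet_derivative f (at x) = frechet_derivative g (at x)"
proof -
  have "(f has_derivative F) (at x) \<longleftrightarrow> (g has_derivative F) (at x)" for F
    using assms by (metis has_derivative_transform_within_open)
  then show ?thesis by (simp add: frechet_derivative_def)
qed

lemma differentiable_cong:
  assumes "open S" "x \<in> S" "\<And>y. y \<in> S \<Longrightarrow> f y = g y"
  shows "f differentiable (at x) \<longleftrightarrow> g differentiable (at x)"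
  unfolding differentiable_def using assms by (metis has_derivative_transform_within_open)

lemma D_eqI: "(f has_derivative F) (at x) \<Longrightarrow> D f x v = F v"
  by (metis frechet_derivative_at)

lemma has_derivative_D: "f differentiable (at x) \<Longrightarrow> (f has_derivative D f x) (at x)"
  using frechet_derivative_works by auto

lemma linear_D: "f differentiable (at x) \<Longrightarrow> linear (D f x)"
  by (rule linear_frechet_derivative)

lemma linear_expansion:
  assumes "linear f" shows "f v = (\<Sum>b\<in>Basis. (v \<bullet> b) *\<^sub>R f b)"
proof -
  have "f v = f (\<Sum>b\<in>Basis. (v \<bullet> b) *\<^sub>R b)" by (simp add: euclidean_representation)
  then show ?thesis using assms by (simp add: linear_sum linear_scale)
qed

text \<open>The product rule for a field of linear maps acting on a vector field; in a basis it is the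
  product rule for finitely many scalar products.\<close>
lemma has_derivative_apply:
  fixes A :: "'m::euclidean_space \<Rightarrow> 'e::euclidean_space \<Rightarrow> 'f::real_normed_vector"
  assumes S: "open S" "x \<in> S" and lin: "\<And>y. y \<in> S \<Longrightarrow> linear (A y)"
    and dA: "\<And>v. (\<lambda>y. A y v) differentiable (at x)" and dX: "X differentiable (at x)"
  shows "((\<lambda>y. A y (X y)) has_derivative (\<lambda>h. D (\<lambda>y. A y (X x)) x h + A x (D X x h))) (at x)"
proof -
  have exp: "A y v = (\<Sum>b\<in>Basis. (v \<bullet> b) *\<^sub>R A y b)" if "y \<in> S" for y v
    by (rule linear_expansion[OF lin[OF that]])
  have dA': "((\<lambda>y. A y v) has_derivative D (\<lambda>y. A y v) x) (at x)" for v
    using dA has_derivative_D by blast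
  have dX': "(X has_derivative D X x) (at x)"
    using dX has_derivative_D by blast
  have sub: "D (\<lambda>y. A y v) x h = (\<Sum>b\<in>Basis. (v \<bullet> b) *\<^sub>R D (\<lambda>y. A y b) x h)" for v h
  proof -
    have "((\<lambda>y. \<Sum>b\<in>Basis. (v \<bullet> b) *\<^sub>R A y b) has_derivative
        (\<lambda>h. \<Sum>b\<in>Basis. (v \<bullet> b) *\<^sub>R D (\<lambda>y. A y b) x h)) (at x)"
      by (intro has_derivative_sum has_derivative_scaleR_right dA')
    then have "((\<lambda>y. A y v) has_derivative
        (\<lambda>h. \<Sum>b\<in>Basis. (v \<bullet> b) *\<^sub>R D (\<lambda>y. A y b) x h)) (at x)"
      using S by (rule has_derivative_transform_within_open) (simp add: exp)
    then show ?thesis by (rule D_eqI)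
  qed
  have "((\<lambda>y. \<Sum>b\<in>Basis. (X y \<bullet> b) *\<^sub>R A y b) has_derivative
      (\<lambda>h. \<Sum>b\<in>Basis. (X x \<bullet> b) *\<^sub>R D (\<lambda>y. A y b) x h + (D X x h \<bullet> b) *\<^sub>R A x b)) (at x)"
    by (intro has_derivative_sum has_derivative_scaleR has_derivative_inner_left dA' dX')
  then have "((\<lambda>y. A y (X y)) has_derivative
      (\<lambda>h. \<Sum>b\<in>Basis. (X x \<bullet> b) *\<^sub>R D (\<lambda>y. A y b) x h + (D X x h \<bullet> b) *\<^sub>R A x b)) (at x)"
    using S by (rule has_derivative_transform_within_open) (simp add: exp)
  moreover have "(\<Sum>b\<in>Basis. (X x \<bullet> b) *\<^sub>R D (\<lambda>y. A y b) x h + (D X x h \<bullet> b) *\<^sub>R A x b)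
      = D (\<lambda>y. A y (X x)) x h + A x (D X x h)" for h
    by (simp add: sum.distrib sub[of "X x"] exp[OF S(2), of "D X x h"])
  ultimately show ?thesis by simp
qed

lemma D_apply:
  fixes A :: "'m::euclidean_space \<Rightarrow> 'e::euclidean_space \<Rightarrow> 'f::real_normed_vector"
  assumes "open S" "x \<in> S" "\<And>y. y \<in> S \<Longrightarrow> linear (A y)"
    and "\<And>v. (\<lambda>y. A y v) differentiable (at x)" "X differentiable (at x)"
  shows "D (\<lambda>y. A y (X y)) x h = D (\<lambda>y. A y (X x)) x h + A x (D X x h)"
  by (rule D_eqI[OF has_derivative_apply[OF assms]])

lemma differentiable_apply:
  fixes A :: "'m::euclidean_space \<Rightarrow> 'e::euclidean_space \<Rightarrow> 'f::real_normed_vector"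
  assumes "open S" "x \<in> S" "\<And>y. y \<in> S \<Longrightarrow> linear (A y)"
    and "\<And>v. (\<lambda>y. A y v) differentiable (at x)" "X differentiable (at x)"
  shows "(\<lambda>y. A y (X y)) differentiable (at x)"
  using has_derivative_apply[OF assms] differentiable_def by blast

lemma linear_D_arg:
  assumes S: "open S" "x \<in> S" and lin: "\<And>y. y \<in> S \<Longrightarrow> linear (A y)"
    and dA: "\<And>v. (\<lambda>y. A y v) differentiable (at x)"
  shows "linear (\<lambda>v. D (\<lambda>y. A y v) x h)"
proof
  have dA': "((\<lambda>y. A y v) has_derivative D (\<lambda>y. A y v) x) (at x)" for v
    using dA has_derivative_D by blast
  fix v w r
  have "((\<lambda>y. A y v + A y w) has_derivative (\<lambda>h. D (\<lambda>y. A y v) x h + D (\<lambda>y. A y w) x h)) (at x)"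
    by (intro derivative_intros dA')
  then have "((\<lambda>y. A y (v + w)) has_derivative
      (\<lambda>h. D (\<lambda>y. A y v) x h + D (\<lambda>y. A y w) x h)) (at x)"
    using S by (rule has_derivative_transform_within_open) (simp add: lin linear_add)
  then show "D (\<lambda>y. A y (v + w)) x h = D (\<lambda>y. A y v) x h + D (\<lambda>y. A y w) x h"
    by (rule D_eqI)
  have "((\<lambda>y. r *\<^sub>R A y v) has_derivative (\<lambda>h. r *\<^sub>R D (\<lambda>y. A y v) x h)) (at x)"
    by (intro has_derivative_scaleR_right dA')
  then have "((\<lambda>y. A y (r *\<^sub>R v)) has_derivative (\<lambda>h. r *\<^sub>R D (\<lambda>y. A y v) x h)) (at x)"
    using S by (rule has_derivative_transform_within_open) (simp add: lin linear_scale)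
  then show "D (\<lambda>y. A y (r *\<^sub>R v)) x h = r *\<^sub>R D (\<lambda>y. A y v) x h"
    by (rule D_eqI)
qed

text \<open>Both mixed derivatives are the limit of the same symmetric second difference quotient
  \<open>(f(x+sv+sw) - f(x+sv) - f(x+sw) + f(x)) / s\<^sup>2\<close>, by the mean value theorem along \<open>v\<close>.\<close>

lemma second_difference_limit:
  fixes f :: "'e::euclidean_space \<Rightarrow> real"
  assumes S: "open S" "x \<in> S" and df: "\<And>y. y \<in> S \<Longrightarrow> f differentiable (at y)"
    and d2: "(\<lambda>y. D f y v) differentiable (at x)"
  shows "((\<lambda>s. (f (x + s *\<^sub>R v + s *\<^sub>R w) - f (x + s *\<^sub>R v) - f (x + s *\<^sub>R w) + f x) / s\<^sup>2)
      \<longlongrightarrow> D (\<lambda>y. D f y v) x w) (at_right 0)"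
proof -
  define F where "F = (\<lambda>y. D f y v)"
  define L where "L = D F x"
  have L: "(F has_derivative L) (at x)" unfolding L_def using d2 F_def has_derivative_D by blast
  then have linL: "linear L" using has_derivative_linear by blast
  obtain \<delta> where \<delta>: "\<delta> > 0" "ball x \<delta> \<subseteq> S" using S openE by blast
  define M where "M = norm v + norm w + 1"
  have M: "M > 0" by (simp add: M_def add_nonneg_pos)
  show ?thesis
  proof (rule tendstoI)
    fix e :: real assume e: "e > 0"
    define e' where "e' = e / (4 * M)"
    have e': "e' > 0" using e M by (simp add: e'_def)
    obtain d where d: "d > 0" "\<And>y. norm (y - x) < d \<Longrightarrow> norm (F y - F x - L (y - x)) \<le> e' * norm (y - x)"
      using L e' unfolding has_derivative_at_alt by blast
    define r where "r = min \<delta> d / M"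
    have r: "r > 0" using \<delta> d M by (simp add: r_def)
    have main: "dist ((f (x + s *\<^sub>R v + s *\<^sub>R w) - f (x + s *\<^sub>R v) - f (x + s *\<^sub>R w) + f x) / s\<^sup>2) (L w) < e"
      if s: "0 < s" "s < r" for s
    proof -
      have small: "norm (a *\<^sub>R v + b *\<^sub>R w) \<le> s * M" "norm (a *\<^sub>R v + b *\<^sub>R w) < min \<delta> d" 
        if "0 \<le> a" "a \<le> s" "0 \<le> b" "b \<le> s" for a b
      proof -
        have "norm (a *\<^sub>R v + b *\<^sub>R w) \<le> a * norm v + b * norm w"
          using norm_triangle_ineq[of "a *\<^sub>R v" "b *\<^sub>R w"] that by simp
        also have "\<dots> \<le> s * norm v + s * norm w"
          using that by (intro add_mono mult_right_mono) auto
        also have "\<dots> \<le> s * M" using s by (simp add: M_def algebra_simps)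
        finally show 1: "norm (a *\<^sub>R v + b *\<^sub>R w) \<le> s * M" .
        have "s * M < min \<delta> d" using s M by (simp add: r_def pos_less_divide_eq)
        with 1 show "norm (a *\<^sub>R v + b *\<^sub>R w) < min \<delta> d" by linarith
      qed
      have inS: "x + a *\<^sub>R v + b *\<^sub>R w \<in> S" if "0 \<le> a" "a \<le> s" "0 \<le> b" "b \<le> s" for a b
      proof -
        have "dist (x + (a *\<^sub>R v + b *\<^sub>R w)) x < \<delta>" using small(2)[OF that] by (simp add: dist_norm)
        then show ?thesis using \<delta>(2) by (metis add.assoc dist_commute mem_ball subsetD)
      qed
      define h where "h = (\<lambda>a. f (x + a *\<^sub>R v + s *\<^sub>R w) - f (x + a *\<^sub>R v + 0 *\<^sub>R w))"
      have dh: "(h has_derivative (\<lambda>u. u * (F (x + a *\<^sub>R v + s *\<^sub>R w) - F (x + a *\<^sub>R v + 0 *\<^sub>R w)))) (at a within {0..s})"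
        if a: "0 \<le> a" "a \<le> s" for a
      proof -
        have fb: "((\<lambda>a. f (x + a *\<^sub>R v + b *\<^sub>R w)) has_derivative (\<lambda>u. u * F (x + a *\<^sub>R v + b *\<^sub>R w))) (at a within {0..s})"
          if b: "0 \<le> b" "b \<le> s" for b
        proof -
          have p: "((\<lambda>a. x + a *\<^sub>R v + b *\<^sub>R w) has_derivative (\<lambda>u. u *\<^sub>R v)) (at a within {0..s})"
            by (auto intro!: derivative_eq_intros)
          have q: "(f has_derivative D f (x + a *\<^sub>R v + b *\<^sub>R w)) (at (x + a *\<^sub>R v + b *\<^sub>R w))"
            using df inS[OF a b] has_derivative_D by blast
          have "((\<lambda>a. f (x + a *\<^sub>R v + b *\<^sub>R w)) has_derivative (\<lambda>u. D f (x + a *\<^sub>R v + b *\<^sub>R w) (u *\<^sub>R v))) (at a within {0..s})"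
            using has_derivative_compose[OF p q] .
          then show ?thesis
            using has_derivative_linear[OF q] by (simp add: linear_scale F_def)
        qed
        have "(h has_derivative (\<lambda>u. u * F (x + a *\<^sub>R v + s *\<^sub>R w) - u * F (x + a *\<^sub>R v + 0 *\<^sub>R w))) (at a within {0..s})"
          unfolding h_def using s by (intro has_derivative_diff fb) auto
        then show ?thesis by (simp add: right_diff_distrib)
      qed
      obtain a where a: "0 < a" "a < s"
        and mv: "h s - h 0 = (s - 0) * (F (x + a *\<^sub>R v + s *\<^sub>R w) - F (x + a *\<^sub>R v + 0 *\<^sub>R w))"
        using mvt_simple[OF s(1), of h "\<lambda>a u. u * (F (x + a *\<^sub>R v + s *\<^sub>R w) - F (x + a *\<^sub>R v + 0 *\<^sub>R w))"] dh
        by auto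
      have E: "norm (F (x + (a *\<^sub>R v + b *\<^sub>R w)) - F x - L (a *\<^sub>R v + b *\<^sub>R w)) \<le> e' * (s * M)" if "0 \<le> b" "b \<le> s" for b
      proof -
        have "norm (F (x + (a *\<^sub>R v + b *\<^sub>R w)) - F x - L (a *\<^sub>R v + b *\<^sub>R w)) \<le> e' * norm (a *\<^sub>R v + b *\<^sub>R w)"
          using d(2)[of "x + (a *\<^sub>R v + b *\<^sub>R w)"] small(2)[of a b] a that by simp
        also have "\<dots> \<le> e' * (s * M)" using small(1)[of a b] a that e' by (intro mult_left_mono) auto
        finally show ?thesis .
      qed
      have "L (a *\<^sub>R v + s *\<^sub>R w) - L (a *\<^sub>R v + 0 *\<^sub>R w) = s * L w"
        using linL by (simp add: linear_add linear_scale)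
      then have "\<bar>F (x + (a *\<^sub>R v + s *\<^sub>R w)) - F (x + (a *\<^sub>R v + 0 *\<^sub>R w)) - s * L w\<bar> \<le> 2 * (e' * (s * M))"
        using E[of s] E[of 0] s unfolding real_norm_def by linarith
      also have "2 * (e' * (s * M)) = s * (e / 2)" using M by (simp add: e'_def)
      finally have 1: "\<bar>F (x + a *\<^sub>R v + s *\<^sub>R w) - F (x + a *\<^sub>R v + 0 *\<^sub>R w) - s * L w\<bar> \<le> s * (e / 2)"
        by (simp add: add.assoc)
      have "f (x + s *\<^sub>R v + s *\<^sub>R w) - f (x + s *\<^sub>R v) - f (x + s *\<^sub>R w) + f x
          = s * (F (x + a *\<^sub>R v + s *\<^sub>R w) - F (x + a *\<^sub>R v + 0 *\<^sub>R w))"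
        using mv by (simp add: h_def)
      moreover have "s * d / s\<^sup>2 - L w = (d - s * L w) / s" for d
        using s by (simp add: power2_eq_square field_simps)
      ultimately have "(f (x + s *\<^sub>R v + s *\<^sub>R w) - f (x + s *\<^sub>R v) - f (x + s *\<^sub>R w) + f x) / s\<^sup>2 - L w
          = (F (x + a *\<^sub>R v + s *\<^sub>R w) - F (x + a *\<^sub>R v + 0 *\<^sub>R w) - s * L w) / s"
        by simp
      also have "\<bar>\<dots>\<bar> \<le> e / 2" using 1 s by (simp add: abs_divide pos_divide_le_eq mult.commute)
      finally show ?thesis using e by (simp add: dist_real_def)
    qed
    show "\<forall>\<^sub>F s in at_right 0. dist ((f (x + s *\<^sub>R v + s *\<^sub>R w) - f (x + s *\<^sub>R v) - f (x + s *\<^sub>R w) + f x) / s\<^sup>2) (D (\<lambda>y. D f y v) x w) < e"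
      using main r unfolding eventually_at_right_field L_def F_def by blast
  qed
qed

lemma second_derivative_symmetric_real:
  fixes f :: "'e::euclidean_space \<Rightarrow> real"
  assumes S: "open S" "x \<in> S" and df: "\<And>y. y \<in> S \<Longrightarrow> f differentiable (at y)"
    and d2: "\<And>v. (\<lambda>y. D f y v) differentiable (at x)"
  shows "D (\<lambda>y. D f y v) x w = D (\<lambda>y. D f y w) x v"
proof -
  note l = second_difference_limit[OF S df d2]
  have "(\<lambda>s. (f (x + s *\<^sub>R w + s *\<^sub>R v) - f (x + s *\<^sub>R w) - f (x + s *\<^sub>R v) + f x) / s\<^sup>2)
      = (\<lambda>s. (f (x + s *\<^sub>R v + s *\<^sub>R w) - f (x + s *\<^sub>R v) - f (x + s *\<^sub>R w) + f x) / s\<^sup>2)"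
    by (simp add: algebra_simps)
  then show ?thesis using l[of v w] l[of w v]
    by (metis (no_types, lifting) tendsto_unique trivial_limit_at_right_real)
qed

lemma second_derivative_symmetric:
  fixes f :: "'e::euclidean_space \<Rightarrow> 'f::euclidean_space"
  assumes S: "open S" "x \<in> S" and df: "\<And>y. y \<in> S \<Longrightarrow> f differentiable (at y)"
    and d2: "\<And>v. (\<lambda>y. D f y v) differentiable (at x)"
  shows "D (\<lambda>y. D f y v) x w = D (\<lambda>y. D f y w) x v"
proof (rule euclidean_eqI)
  fix b :: 'f
  have i: "D (\<lambda>y. h y \<bullet> b) y u = D h y u \<bullet> b" if "h differentiable (at y)" for h :: "'e \<Rightarrow> 'f" and y u
    by (rule D_eqI) (intro has_derivative_inner_left has_derivative_D that)
  have i': "(\<lambda>y. h y \<bullet> b) differentiable (at y)" if "h differentiable (at y)" for h :: "'e \<Rightarrow> 'f" and y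
    using that by simp
  have "D (\<lambda>y. D (\<lambda>y. f y \<bullet> b) y v) x w = D (\<lambda>y. D (\<lambda>y. f y \<bullet> b) y w) x v"
  proof (rule second_derivative_symmetric_real[OF S])
    show "(\<lambda>y. D (\<lambda>y. f y \<bullet> b) y v) differentiable at x" for v
      using differentiable_cong[OF S, of "\<lambda>y. D (\<lambda>y. f y \<bullet> b) y v" "\<lambda>y. D f y v \<bullet> b"] i df i'[OF d2]
      by auto
  qed (simp add: df i')
  moreover have "D (\<lambda>y. D (\<lambda>y. f y \<bullet> b) y v) x w = D (\<lambda>y. D f y v) x w \<bullet> b" for v w
    using D_cong[OF S, of "\<lambda>y. D (\<lambda>y. f y \<bullet> b) y v" "\<lambda>y. D f y v \<bullet> b"] i df i[OF d2] by auto
  ultimately show "D (\<lambda>y. D f y v) x w \<bullet> b = D (\<lambda>y. D f y w) x v \<bullet> b" by simp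
qed

section \<open>Smooth functions\<close>

text \<open>The inductive definition differentiates with respect to the whole space, so that closure
  properties hold on open sets only; each follows by induction from the formula for one derivative.\<close>
lemma C_k_on_cong:
  assumes "open S" "\<And>x. x \<in> S \<Longrightarrow> f x = g x"
  shows "C_k_on k S f \<longleftrightarrow> C_k_on k S g"
  using assms(2)
proof (induction k arbitrary: f g)
  case 0 then show ?case by (simp cong: continuous_on_cong)
next
  case (Suc k)
  have "D f x v = D g x v" if "x \<in> S" for x v
    using D_cong[OF assms(1) that, of f g] Suc.prems by simp
  then have "C_k_on k S (\<lambda>x. D f x v) = C_k_on k S (\<lambda>x. D g x v)" for v by (rule Suc.IH)
  moreover have "f differentiable (at x) \<longleftrightarrow> g differentiable (at x)" if "x \<in> S" for x
    using differentiable_cong[OF assms(1) that, of f g] Suc.prems by simp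
  ultimately show ?case by simp
qed

lemma C_k_on_SucD: "C_k_on (Suc k) S f \<Longrightarrow> C_k_on k S f"
proof (induction k arbitrary: f)
  case 0 then show ?case
    by (simp add: continuous_at_imp_continuous_on differentiable_imp_continuous_within)
next
  case (Suc k) then show ?case by simp
qed

lemma C_k_on_SucI:
  assumes "open S" "\<And>x. x \<in> S \<Longrightarrow> (f has_derivative f' x) (at x)" "\<And>v. C_k_on k S (\<lambda>x. f' x v)"
  shows "C_k_on (Suc k) S f"
proof -
  have "C_k_on k S (\<lambda>x. D f x v)" for v
    using C_k_on_cong[OF assms(1), of "\<lambda>x. D f x v" "\<lambda>x. f' x v" k] assms D_eqI by blast
  then show ?thesis using assms(2) by (auto simp: differentiable_def)
qed

lemma C_k_on_const: "C_k_on k S (\<lambda>x. c)"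
  by (induction k arbitrary: c) auto

lemma C_k_on_add:
  assumes "open S" shows "C_k_on k S f \<Longrightarrow> C_k_on k S g \<Longrightarrow> C_k_on k S (\<lambda>x. f x + g x)"
proof (induction k arbitrary: f g)
  case 0 then show ?case by (auto intro: continuous_intros)
next
  case (Suc k)
  show ?case
  proof (rule C_k_on_SucI[OF assms, where f' = "\<lambda>x v. D f x v + D g x v"])
    show "((\<lambda>x. f x + g x) has_derivative (\<lambda>v. D f x v + D g x v)) (at x)" if "x \<in> S" for x
      using that Suc.prems by (auto intro!: has_derivative_add has_derivative_D)
  qed (use Suc in auto)
qed

lemma C_k_on_bounded_linear:
  assumes "open S" "bounded_linear L" shows "C_k_on k S f \<Longrightarrow> C_k_on k S (\<lambda>x. L (f x))"
proof (induction k arbitrary: f)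
  case 0 then show ?case using bounded_linear.continuous_on[OF assms(2)] by auto
next
  case (Suc k)
  show ?case
  proof (rule C_k_on_SucI[OF assms(1), where f' = "\<lambda>x v. L (D f x v)"])
    show "((\<lambda>x. L (f x)) has_derivative (\<lambda>v. L (D f x v))) (at x)" if "x \<in> S" for x
      using that Suc.prems by (intro bounded_linear.has_derivative[OF assms(2)] has_derivative_D) auto
  qed (use Suc in auto)
qed

lemma C_k_on_scaleR:
  assumes "open S"
  shows "C_k_on k S f \<Longrightarrow> C_k_on k S g \<Longrightarrow> C_k_on k S (\<lambda>x. f x *\<^sub>R g x)"
proof (induction k arbitrary: f g)
  case 0 then show ?case by (auto intro: continuous_intros)
next
  case (Suc k)
  note low = C_k_on_SucD[OF Suc.prems(1)] C_k_on_SucD[OF Suc.prems(2)]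
  show ?case
  proof (rule C_k_on_SucI[OF assms, where f' = "\<lambda>x v. f x *\<^sub>R D g x v + D f x v *\<^sub>R g x"])
    show "((\<lambda>x. f x *\<^sub>R g x) has_derivative (\<lambda>v. f x *\<^sub>R D g x v + D f x v *\<^sub>R g x)) (at x)" if "x \<in> S" for x
      using that Suc.prems by (auto intro!: has_derivative_scaleR has_derivative_D)
    show "C_k_on k S (\<lambda>x. f x *\<^sub>R D g x v + D f x v *\<^sub>R g x)" for v
      using Suc low by (intro C_k_on_add[OF assms] Suc.IH) auto
  qed
qed

lemma C_k_on_compose_linear:
  assumes "open T" "bounded_linear L" "L ` T \<subseteq> S"
  shows "C_k_on k S f \<Longrightarrow> C_k_on k T (\<lambda>x. f (L x))"
proof (induction k arbitrary: f)
  case 0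
  then have "continuous_on (L ` T) f" using assms(3) continuous_on_subset by auto
  then show ?case
    using continuous_on_compose2[OF _ bounded_linear.continuous_on[OF assms(2) continuous_on_id]] by auto
next
  case (Suc k)
  show ?case
  proof (rule C_k_on_SucI[OF assms(1), where f' = "\<lambda>x v. D f (L x) (L v)"])
    show "((\<lambda>x. f (L x)) has_derivative (\<lambda>v. D f (L x) (L v))) (at x)" if "x \<in> T" for x
      using that Suc.prems assms(3)
      by (intro has_derivative_compose[OF bounded_linear_imp_has_derivative[OF assms(2)]] has_derivative_D) auto
    show "C_k_on k T (\<lambda>x. D f (L x) (L v))" for v
      using Suc.IH[of "\<lambda>x. D f x (L v)"] Suc.prems by auto
  qed
qed

lemma C_k_on_inverse:
  fixes f :: "'e::euclidean_space \<Rightarrow> real"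
  assumes "open S" "\<And>x. x \<in> S \<Longrightarrow> f x \<noteq> 0"
  shows "C_k_on k S f \<Longrightarrow> C_k_on k S (\<lambda>x. inverse (f x))"
proof (induction k)
  case 0 then show ?case using assms by (auto intro: continuous_intros)
next
  case (Suc k)
  note low = Suc.IH[OF C_k_on_SucD[OF Suc.prems]]
  show ?case
  proof (rule C_k_on_SucI[OF assms(1), where f' = "\<lambda>x v. inverse (f x) *\<^sub>R (inverse (f x) *\<^sub>R - D f x v)"])
    show "((\<lambda>x. inverse (f x)) has_derivative (\<lambda>v. inverse (f x) *\<^sub>R (inverse (f x) *\<^sub>R - D f x v))) (at x)"
      if "x \<in> S" for x
    proof -
      have "(f has_derivative D f x) (at x)" using that Suc.prems has_derivative_D by auto
      from Deriv.has_derivative_inverse[OF assms(2)[OF that] this]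
      show ?thesis by (simp add: mult_ac)
    qed
    have "C_k_on k S (\<lambda>x. - D f x v)" for v
      using Suc.prems
      by (intro C_k_on_bounded_linear[OF assms(1) bounded_linear_minus[OF bounded_linear_ident]]) auto
    then show "C_k_on k S (\<lambda>x. inverse (f x) *\<^sub>R (inverse (f x) *\<^sub>R - D f x v))" for v
      by (intro C_k_on_scaleR[OF assms(1)] low)
  qed
qed

lemma smooth_on_cong:
  assumes "open S" "\<And>x. x \<in> S \<Longrightarrow> f x = g x"
  shows "smooth_on S f \<longleftrightarrow> smooth_on S g"
  using C_k_on_cong[OF assms] by (simp add: smooth_on_def)

lemma smooth_on_differentiable: "smooth_on S f \<Longrightarrow> x \<in> S \<Longrightarrow> f differentiable (at x)"
  by (metis C_k_on.simps(2) smooth_on_def)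

lemma smooth_on_D: "smooth_on S f \<Longrightarrow> smooth_on S (\<lambda>x. D f x v)"
  unfolding smooth_on_def by (metis C_k_on.simps(2))

lemma smooth_on_const: "smooth_on S (\<lambda>x. c)"
  by (simp add: smooth_on_def C_k_on_const)

lemma smooth_on_add: "open S \<Longrightarrow> smooth_on S f \<Longrightarrow> smooth_on S g \<Longrightarrow> smooth_on S (\<lambda>x. f x + g x)"
  by (simp add: smooth_on_def C_k_on_add)

lemma smooth_on_bounded_linear:
  "open S \<Longrightarrow> bounded_linear L \<Longrightarrow> smooth_on S f \<Longrightarrow> smooth_on S (\<lambda>x. L (f x))"
  by (simp add: smooth_on_def C_k_on_bounded_linear)

lemma smooth_on_scaleR:
  "open S \<Longrightarrow> smooth_on S f \<Longrightarrow> smooth_on S g \<Longrightarrow> smooth_on S (\<lambda>x. f x *\<^sub>R g x)"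
  by (simp add: smooth_on_def C_k_on_scaleR)

lemma smooth_on_mult:
  fixes f g :: "'e::euclidean_space \<Rightarrow> real"
  shows "open S \<Longrightarrow> smooth_on S f \<Longrightarrow> smooth_on S g \<Longrightarrow> smooth_on S (\<lambda>x. f x * g x)"
  using smooth_on_scaleR[of S f g] by simp

lemma smooth_on_compose_linear:
  "open T \<Longrightarrow> bounded_linear L \<Longrightarrow> L ` T \<subseteq> S \<Longrightarrow> smooth_on S f \<Longrightarrow> smooth_on T (\<lambda>x. f (L x))"
  by (simp add: smooth_on_def C_k_on_compose_linear)

lemma smooth_on_linear: "open S \<Longrightarrow> bounded_linear L \<Longrightarrow> smooth_on S L"
  unfolding smooth_on_def
proof
  fix k assume "open S" "bounded_linear L"
  then show "C_k_on k S L"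
  proof (cases k)
    case 0 then show ?thesis
      using \<open>bounded_linear L\<close> by (simp add: linear_continuous_on)
  next
    case (Suc m) then show ?thesis
      using C_k_on_SucI[OF \<open>open S\<close>, of L "\<lambda>x. L" m] C_k_on_const
        bounded_linear_imp_has_derivative[OF \<open>bounded_linear L\<close>] by blast
  qed
qed

lemma smooth_on_inverse:
  fixes f :: "'e::euclidean_space \<Rightarrow> real"
  shows "open S \<Longrightarrow> (\<And>x. x \<in> S \<Longrightarrow> f x \<noteq> 0) \<Longrightarrow> smooth_on S f \<Longrightarrow> smooth_on S (\<lambda>x. inverse (f x))"
  by (simp add: smooth_on_def C_k_on_inverse)

lemma smooth_on_sum:
  assumes "open S" "\<And>i. i \<in> I \<Longrightarrow> smooth_on S (f i)"
  shows "smooth_on S (\<lambda>x. \<Sum>i\<in>I. f i x)"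
  using assms(2)
  by (induction I rule: infinite_finite_induct) (auto intro: smooth_on_const smooth_on_add[OF assms(1)])

lemma smooth_on_apply:
  assumes S: "open S" and lin: "\<And>y. y \<in> S \<Longrightarrow> linear (A y)"
    and "\<And>v. smooth_on S (\<lambda>y. A y v)" and "smooth_on S X"
  shows "smooth_on S (\<lambda>y. A y (X y :: 'e::euclidean_space))"
proof -
  have exp: "A y v = (\<Sum>b\<in>Basis. (v \<bullet> b) *\<^sub>R A y b)" if "y \<in> S" for y v
    by (rule linear_expansion[OF lin[OF that]])
  have "smooth_on S (\<lambda>y. \<Sum>b\<in>Basis. (X y \<bullet> b) *\<^sub>R A y b)"
    using assms by (intro smooth_on_sum[OF S] smooth_on_scaleR[OF S]
        smooth_on_bounded_linear[OF S bounded_linear_inner_left]) auto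
  then show ?thesis by (subst smooth_on_cong[OF S]) (auto simp: exp)
qed

section \<open>Traces\<close>

lemma endo_trace_add: "endo_trace (\<lambda>v. A v + B v) = endo_trace A + endo_trace B"
  by (simp add: endo_trace_def inner_add_left sum.distrib)

lemma endo_trace_diff: "endo_trace (\<lambda>v. A v - B v) = endo_trace A - endo_trace B"
  by (simp add: endo_trace_def inner_diff_left sum_subtractf)

lemma endo_trace_minus: "endo_trace (\<lambda>v. - A v) = - endo_trace A"
  by (simp add: endo_trace_def sum_negf)

lemma endo_trace_scaleR: "endo_trace (\<lambda>v. r *\<^sub>R A v) = r * endo_trace A"
  by (simp add: endo_trace_def sum_distrib_left)

lemma endo_trace_ident: "endo_trace (\<lambda>v::'e::euclidean_space. v) = DIM('e)"
  by (simp add: endo_trace_def)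

lemma endo_trace_rank_one:
  assumes "linear f" shows "endo_trace (\<lambda>v. f v *\<^sub>R u) = f u"
  using linear_expansion[OF assms, of u] by (simp add: endo_trace_def mult.commute)

lemma endo_trace_commute:
  fixes A B :: "'e::euclidean_space \<Rightarrow> 'e"
  assumes "linear A" "linear B"
  shows "endo_trace (\<lambda>v. A (B v)) = endo_trace (\<lambda>v. B (A v))"
proof -
  have *: "endo_trace (\<lambda>v. A (B v)) = (\<Sum>b\<in>Basis. \<Sum>c\<in>Basis. (B b \<bullet> c) * (A c \<bullet> b))"
    if "linear A" for A B :: "'e \<Rightarrow> 'e"
  proof -
    have "A (B b) = (\<Sum>c\<in>Basis. (B b \<bullet> c) *\<^sub>R A c)" for b
      by (rule linear_expansion[OF that])
    then show ?thesis by (simp add: endo_trace_def inner_sum_left)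
  qed
  show ?thesis unfolding *[OF assms(1)] *[OF assms(2)]
    by (subst sum.swap) (simp add: mult.commute)
qed

section \<open>The Levi-Civita connection in a chart\<close>

text \<open>The remainder term in the differentiation of an implicitly given vector field: a factor that
  merely tends to zero, times a factor of first order.\<close>
lemma has_derivative_zero_product:
  fixes f :: "'m::real_normed_vector \<Rightarrow> real" and h :: "'m \<Rightarrow> 'f::real_normed_vector"
  assumes f: "isCont f x" "f x = 0" and h: "h differentiable (at x)" "h x = 0"
  shows "((\<lambda>y. f y *\<^sub>R h y) has_derivative (\<lambda>_. 0)) (at x)"
proof -
  obtain h' where h': "(h has_derivative h') (at x)" using h differentiable_def by blast
  obtain B where B: "B > 0" "\<And>v. norm (h' v) \<le> norm v * B"
    using bounded_linear.pos_bounded has_derivative_bounded_linear[OF h'] by blast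
  obtain d where d: "d > 0" "\<And>y. norm (y - x) < d \<Longrightarrow> norm (h y - h x - h' (y - x)) \<le> 1 * norm (y - x)"
    using h' zero_less_one unfolding has_derivative_at_alt by blast
  have hb: "norm (h y) \<le> (B + 1) * norm (y - x)" if "norm (y - x) < d" for y
  proof -
    have "norm (h y) \<le> norm (h y - h' (y - x)) + norm (h' (y - x))"
      using norm_triangle_ineq[of "h y - h' (y - x)" "h' (y - x)"] by simp
    then show ?thesis using d(2)[OF that] B(2)[of "y - x"] h(2) by (simp add: algebra_simps)
  qed
  show ?thesis unfolding has_derivative_at_alt
  proof (intro conjI allI impI)
    fix e :: real assume "e > 0"
    then have "e / (B + 1) > 0" using B by simp
    then obtain d' where d': "d' > 0" "\<And>y. dist y x < d' \<Longrightarrow> dist (f y) (f x) < e / (B + 1)"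
      using f(1) unfolding continuous_at_eps_delta by blast
    have "norm (f y *\<^sub>R h y - f x *\<^sub>R h x - 0) \<le> e * norm (y - x)" if y: "norm (y - x) < min d d'" for y
    proof -
      have "\<bar>f y\<bar> \<le> e / (B + 1)" using d'(2)[of y] y f(2) by (simp add: dist_norm)
      then have "\<bar>f y\<bar> * norm (h y) \<le> e / (B + 1) * ((B + 1) * norm (y - x))"
        using hb[of y] y B by (intro mult_mono) auto
      then show ?thesis using B f(2) by simp
    qed
    then show "\<exists>d>0. \<forall>y. norm (y - x) < d \<longrightarrow> norm (f y *\<^sub>R h y - f x *\<^sub>R h x - 0) \<le> e * norm (y - x)"
      using d(1) d'(1) by (intro exI[of _ "min d d'"]) simp
  qed simp
qed

locale chart_metric =
  fixes g :: "('a, 'e::euclidean_space) bilin" and c :: "('a, 'e) chart" and U :: "'e set"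
  assumes open_U: "open U"
    and bilin: "x \<in> U \<Longrightarrow> bilinear (g c x)"
    and sym: "x \<in> U \<Longrightarrow> g c x v w = g c x w v"
    and pos: "x \<in> U \<Longrightarrow> v \<noteq> 0 \<Longrightarrow> 0 < g c x v v"
    and smooth: "smooth_on U (\<lambda>x. g c x v w)"
begin

lemma linear_left: "x \<in> U \<Longrightarrow> linear (\<lambda>v. g c x v w)"
  and linear_right: "x \<in> U \<Longrightarrow> linear (g c x v)"
  using bilin unfolding bilinear_def by auto

lemmas metric_simps =
  linear_add[OF linear_left] linear_scale[OF linear_left] linear_diff[OF linear_left]
  linear_neg[OF linear_left] linear_0[OF linear_left]
  linear_add[OF linear_right] linear_scale[OF linear_right] linear_diff[OF linear_right]
  linear_neg[OF linear_right] linear_0[OF linear_right]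

lemma differentiable: "x \<in> U \<Longrightarrow> (\<lambda>y. g c y v w) differentiable (at x)"
  using smooth smooth_on_differentiable by blast

lemma nondegenerate:
  assumes "x \<in> U" "\<And>w. g c x u w = g c x v w" shows "u = v"
proof (rule ccontr)
  assume "u \<noteq> v"
  then have "0 < g c x (u - v) (u - v)" using pos assms by simp
  then show False using assms by (simp add: metric_simps)
qed

text \<open>The musical isomorphism of \<open>g\<close> at a point and its inverse, relative to the Euclidean inner product
  of the model space.\<close>
lemma flat_map:
  assumes x: "x \<in> U"
  obtains P Q where "linear P" "linear Q" "\<And>v w. P v \<bullet> w = g c x v w" "\<And>v. Q (P v) = v" "\<And>v. P (Q v) = v"
proof -
  define P where "P = (\<lambda>v. \<Sum>b\<in>Basis. g c x v b *\<^sub>R b)"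
  have lP: "linear P"
    unfolding P_def
    by (rule linearI)
      (simp_all add: metric_simps[OF x] scaleR_add_left sum.distrib scaleR_sum_right)
  have P: "P v \<bullet> w = g c x v w" for v w
  proof -
    have "g c x v w = (\<Sum>b\<in>Basis. (w \<bullet> b) * g c x v b)"
      by (subst linear_expansion[OF linear_right[OF x]]) simp
    also have "\<dots> = P v \<bullet> w"
      by (simp add: P_def inner_sum_right inner_commute[of _ w] mult.commute)
    finally show ?thesis ..
  qed
  have "inj P"
    by (rule injI, rule nondegenerate[OF x]) (simp flip: P)
  then obtain Q where Q: "linear Q" "\<And>v. Q (P v) = v" "\<And>v. P (Q v) = v"
    using linear_injective_isomorphism[OF lP] by blast
  show ?thesis using that[OF lP Q(1) P Q(2,3)] .
qed

lemma riesz: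
  assumes x: "x \<in> U" and l: "linear l"
  shows "\<exists>u. \<forall>w. g c x u w = l w"
proof -
  obtain P Q where P: "\<And>v w. P v \<bullet> w = g c x v w" and Q: "\<And>v. P (Q v) = v"
    using flat_map[OF x] by metis
  have "g c x (Q (\<Sum>b\<in>Basis. l b *\<^sub>R b)) w = l w" for w
  proof -
    have "l w = (\<Sum>b\<in>Basis. (w \<bullet> b) * l b)"
      by (subst linear_expansion[OF l]) simp
    then show ?thesis
      by (simp add: Q inner_sum_left inner_sum_right inner_commute[of _ w] mult.commute flip: P)
  qed
  then show ?thesis by blast
qed

lemma sharp_eqI:
  assumes "x \<in> U" "\<And>w. g c x u w = \<phi> w" shows "sharp g c x \<phi> = u"
  unfolding sharp_def by (rule the_equality) (auto simp: assms intro: nondegenerate[OF assms(1)])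

text \<open>With \<open>P\<close> the musical isomorphism, skewness reads \<open>P A = - A\<^sup>* P\<close>, so \<open>A\<close> is conjugate to \<open>- A\<^sup>*\<close>, whose
  trace is the negative of that of \<open>A\<close>.\<close>
lemma trace_skew:
  assumes x: "x \<in> U" and A: "linear A" "\<And>v w. g c x (A v) w + g c x v (A w) = 0"
  shows "endo_trace A = 0"
proof -
  obtain P Q where PQ: "linear P" "linear Q" "\<And>v w. P v \<bullet> w = g c x v w"
    "\<And>v. Q (P v) = v" "\<And>v. P (Q v) = v"
    using flat_map[OF x] by metis
  note adj = adjoint_works[OF A(1)]
  have "P (A v) = - adjoint A (P v)" for v
  proof (rule euclidean_eqI)
    fix b
    have "P (A v) \<bullet> b = - (P v \<bullet> A b)" using A(2)[of v b] by (simp add: PQ(3) eq_neg_iff_add_eq_0)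
    then show "P (A v) \<bullet> b = - adjoint A (P v) \<bullet> b" by (simp add: adj inner_commute)
  qed
  then have "A = (\<lambda>v. Q (- adjoint A (P v)))" by (metis PQ(4))
  then have "endo_trace A = endo_trace (\<lambda>v. Q (- adjoint A (P v)))" by (rule arg_cong)
  also have "\<dots> = endo_trace (\<lambda>v. - adjoint A (P (Q v)))"
    using PQ(1,2) A(1) adjoint_linear
    by (intro endo_trace_commute linear_compose_neg linear_compose[unfolded o_def, of P "adjoint A"]) auto
  also have "\<dots> = - endo_trace A"
    using adj by (simp add: PQ(5) endo_trace_minus) (simp add: endo_trace_def inner_commute)
  finally show ?thesis by simp
qed

lemma linear_D_metric_left: "x \<in> U \<Longrightarrow> linear (\<lambda>v. D (\<lambda>y. g c y v w) x z)"
  by (rule linear_D_arg[OF open_U _ linear_left]) (auto intro: differentiable)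

lemma linear_D_metric_right: "x \<in> U \<Longrightarrow> linear (\<lambda>w. D (\<lambda>y. g c y v w) x z)"
  by (rule linear_D_arg[OF open_U _ linear_right]) (auto intro: differentiable)

lemma linear_D_metric: "x \<in> U \<Longrightarrow> linear (D (\<lambda>y. g c y v w) x)"
  by (rule linear_D[OF differentiable])

lemma D_metric_sym: "x \<in> U \<Longrightarrow> D (\<lambda>y. g c y v w) x z = D (\<lambda>y. g c y w v) x z"
  using D_cong[OF open_U, of x "\<lambda>y. g c y v w" "\<lambda>y. g c y w v"] sym by simp

definition christoffel_lowered :: "'e \<Rightarrow> 'e \<Rightarrow> 'e \<Rightarrow> 'e \<Rightarrow> real" where
  "christoffel_lowered x z v w =
    (D (\<lambda>y. g c y v w) x z + D (\<lambda>y. g c y z w) x v - D (\<lambda>y. g c y z v) x w) / 2"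

abbreviation is_levi_civita :: "'e \<Rightarrow> ('e \<Rightarrow> 'e \<Rightarrow> 'e) \<Rightarrow> bool" where
  "is_levi_civita x G \<equiv> bilinear G \<and> (\<forall>v w. G v w = G w v) \<and>
     (\<forall>z v w. D (\<lambda>y. g c y v w) x z = g c x (G z v) w + g c x v (G z w))"

text \<open>Koszul's formula: the cyclic combination of the three compatibility equations isolates \<open>G\<close>.\<close>
lemma koszul:
  assumes x: "x \<in> U" and G: "is_levi_civita x G"
  shows "g c x (G z v) w = christoffel_lowered x z v w"
proof -
  have s: "G a b = G b a" for a b using G by blast
  have d: "D (\<lambda>y. g c y a b) x r = g c x (G r a) b + g c x a (G r b)" for a b r using G by blast
  show ?thesis unfolding christoffel_lowered_def d
    using sym[OF x, of v "G z w"] sym[OF x, of z "G v w"] sym[OF x, of z "G w v"]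
    by (simp add: s[of v z] s[of w z] s[of w v])
qed

lemma levi_civita_unique:
  assumes "x \<in> U" "is_levi_civita x G" "is_levi_civita x H" shows "G = H"
  by (intro ext nondegenerate[OF assms(1)]) (simp only: koszul[OF assms(1,2)] koszul[OF assms(1,3)])

lemma levi_civita_exists:
  assumes x: "x \<in> U" shows "\<exists>G. is_levi_civita x G"
proof -
  note lins = linear_D_metric[OF x] linear_D_metric_left[OF x] linear_D_metric_right[OF x]
  note s = linear_add[OF lins(1)] linear_add[OF lins(2)] linear_add[OF lins(3)]
    linear_scale[OF lins(1)] linear_scale[OF lins(2)] linear_scale[OF lins(3)]
  have "\<exists>u. \<forall>w. g c x u w = christoffel_lowered x z v w" for z v
    by (rule riesz[OF x], rule linearI) (simp_all add: christoffel_lowered_def s field_simps)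
  then obtain G where G: "\<And>z v w. g c x (G z v) w = christoffel_lowered x z v w" by metis
  have "linear (\<lambda>v. G v w)" "linear (G v)" for v w
    by (auto intro!: linearI nondegenerate[OF x]
        simp: G metric_simps[OF x] christoffel_lowered_def s field_simps)
  moreover have "G v w = G w v" for v w
    by (rule nondegenerate[OF x]) (simp add: G christoffel_lowered_def D_metric_sym[OF x, of v w])
  moreover have "D (\<lambda>y. g c y v w) x z = g c x (G z v) w + g c x v (G z w)" for z v w
    by (simp add: sym[OF x, of v] G christoffel_lowered_def D_metric_sym[OF x, of w v] field_simps)
  ultimately show ?thesis by (intro exI[of _ G]) (auto simp: bilinear_def)
qed

lemma levi_civita_eqI:
  assumes "x \<in> U" "is_levi_civita x H" shows "levi_civita g c x = H"
  unfolding levi_civita_def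
  using assms(2) levi_civita_unique[OF assms(1) _ assms(2)] by (rule the_equality)

lemma levi_civita:
  assumes "x \<in> U" shows "is_levi_civita x (levi_civita g c x)"
proof -
  obtain H where H: "is_levi_civita x H" using levi_civita_exists[OF assms] ..
  show ?thesis unfolding levi_civita_eqI[OF assms H] by (rule H)
qed

abbreviation G :: "'e \<Rightarrow> 'e \<Rightarrow> 'e \<Rightarrow> 'e" where "G \<equiv> levi_civita g c"

lemma linear_G_left: "x \<in> U \<Longrightarrow> linear (\<lambda>v. G x v w)"
  and linear_G_right: "x \<in> U \<Longrightarrow> linear (G x v)"
  using levi_civita unfolding bilinear_def by auto

lemma G_sym: "x \<in> U \<Longrightarrow> G x v w = G x w v"
  by (drule levi_civita) (elim conjE allE, assumption)

lemma G_metric: "x \<in> U \<Longrightarrow> D (\<lambda>y. g c y v w) x z = g c x (G x z v) w + g c x v (G x z w)"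
  by (drule levi_civita) (elim conjE allE, assumption)

lemmas G_simps =
  linear_add[OF linear_G_left] linear_scale[OF linear_G_left] linear_diff[OF linear_G_left]
  linear_neg[OF linear_G_left]
  linear_add[OF linear_G_right] linear_scale[OF linear_G_right] linear_diff[OF linear_G_right]
  linear_neg[OF linear_G_right]

text \<open>A vector field whose metric products with constant fields are differentiable is itself
  differentiable. Relative to the inverse of the metric at \<open>x\<close> the system reads \<open>u = k - N u\<close> with
  \<open>N\<close> vanishing at \<open>x\<close>; this bounds \<open>u\<close>, then gives continuity, then the derivative.\<close>
lemma differentiable_raise:
  assumes x: "x \<in> U" and diff: "\<And>w. (\<lambda>y. g c y (u y) w) differentiable (at x)"
  shows "u differentiable (at x)"
proof -
  obtain P Q where PQ: "linear P" "linear Q" "\<And>v w. P v \<bullet> w = g c x v w"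
    "\<And>v. Q (P v) = v" "\<And>v. P (Q v) = v"
    using flat_map[OF x] by metis
  have blQ: "bounded_linear Q" using PQ(2) linear_conv_bounded_linear by blast
  define p where "p = (\<lambda>y v. \<Sum>b\<in>Basis. g c y v b *\<^sub>R b)"
  define N where "N = (\<lambda>y v. Q (p y v) - v)"
  define k where "k = (\<lambda>y. Q (p y (u y)))"
  have px: "p x v = P v" for v
    unfolding p_def by (simp add: euclidean_representation flip: PQ(3))
  have Nx: "N x v = 0" for v by (simp add: N_def px PQ(4))
  have linN: "linear (N y)" if "y \<in> U" for y
  proof -
    have "linear (p y)" unfolding p_def
      by (rule linearI) (simp_all add: metric_simps[OF that] scaleR_add_left sum.distrib scaleR_sum_right)
    then show ?thesis unfolding N_def
      using linear_compose[OF _ PQ(2), of "p y"] by (intro linear_compose_sub) (auto simp: o_def linear_id[unfolded id_def])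
  qed
  have dQ: "(\<lambda>y. Q (f y)) differentiable (at x)" if "f differentiable (at x)" for f :: "'e \<Rightarrow> 'e"
    using bounded_linear.has_derivative[OF blQ] that unfolding differentiable_def by blast
  have dp: "(\<lambda>y. p y (f y)) differentiable (at x)" if "\<And>w. (\<lambda>y. g c y (f y) w) differentiable (at x)" for f
    unfolding p_def using that by (intro differentiable_sum differentiable_scaleR) auto
  have dN: "(\<lambda>y. N y v) differentiable (at x)" for v
    unfolding N_def using differentiable[OF x] by (intro differentiable_diff dQ dp) auto
  have dk: "k differentiable (at x)"
    unfolding k_def using diff by (intro dQ dp) auto
  have u: "u y = k y - N y (u y)" for y by (simp add: k_def N_def)
  have Nexp: "N y v = (\<Sum>b\<in>Basis. (v \<bullet> b) *\<^sub>R N y b)" if "y \<in> U" for y v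
    by (rule linear_expansion[OF linN[OF that]])
  define \<epsilon> where "\<epsilon> = (\<lambda>y. \<Sum>b\<in>Basis. norm (N y b))"
  have \<epsilon>: "norm (N y v) \<le> norm v * \<epsilon> y" if "y \<in> U" for y v
  proof -
    have "norm (N y v) \<le> (\<Sum>b\<in>Basis. norm ((v \<bullet> b) *\<^sub>R N y b))"
      unfolding Nexp[OF that, of v] by (rule norm_sum)
    also have "\<dots> \<le> (\<Sum>b\<in>Basis. norm v * norm (N y b))"
      by (intro sum_mono) (auto intro: mult_right_mono Basis_le_norm)
    finally show ?thesis by (simp add: \<epsilon>_def sum_distrib_left)
  qed
  have contN: "isCont (\<lambda>y. N y v) x" for v using dN differentiable_imp_continuous_within by blast
  have "isCont \<epsilon> x" unfolding \<epsilon>_def by (intro continuous_intros contN)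
  then have \<epsilon>0: "(\<epsilon> \<longlongrightarrow> 0) (at x)" by (simp add: isCont_def \<epsilon>_def Nx)
  have "isCont k x" using dk differentiable_imp_continuous_within by blast
  then have k0: "(k \<longlongrightarrow> u x) (at x)" using u[of x] by (simp add: isCont_def Nx)
  have evU: "\<forall>\<^sub>F y in at x. y \<in> U" using eventually_at_in_open'[OF open_U x] .
  have ev1: "\<forall>\<^sub>F y in at x. \<epsilon> y < 1 / 2" using order_tendstoD(2)[OF \<epsilon>0, of "1 / 2"] by simp
  have "((\<lambda>y. norm (k y)) \<longlongrightarrow> norm (u x)) (at x)" by (intro tendsto_norm k0)
  then have ev2: "\<forall>\<^sub>F y in at x. norm (k y) < norm (u x) + 1"
    by (rule order_tendstoD(2)) simp
  have "\<forall>\<^sub>F y in at x. norm (N y (u y)) \<le> \<epsilon> y * (2 * (norm (u x) + 1))"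
    using evU ev1 ev2
  proof eventually_elim
    case (elim y)
    have e0: "0 \<le> \<epsilon> y" by (simp add: \<epsilon>_def sum_nonneg)
    have "norm (u y) \<le> norm (k y) + norm (N y (u y))"
      using norm_triangle_ineq4[of "k y" "N y (u y)"] u[of y] by simp
    also have "norm (N y (u y)) \<le> norm (u y) * \<epsilon> y" using \<epsilon> elim by blast
    also have "\<dots> \<le> norm (u y) * (1 / 2)" using elim by (intro mult_left_mono) auto
    finally have "norm (u y) \<le> 2 * (norm (u x) + 1)" using elim by simp
    then have "norm (u y) * \<epsilon> y \<le> 2 * (norm (u x) + 1) * \<epsilon> y" using e0 by (rule mult_right_mono)
    then show ?case using \<epsilon>[of y "u y"] elim by (simp add: mult.commute)
  qed
  moreover have "((\<lambda>y. \<epsilon> y * (2 * (norm (u x) + 1))) \<longlongrightarrow> 0) (at x)"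
    using tendsto_mult_left_zero[OF \<epsilon>0] by blast
  ultimately have "((\<lambda>y. N y (u y)) \<longlongrightarrow> 0) (at x)" by (rule Lim_null_comparison)
  then have "((\<lambda>y. k y - N y (u y)) \<longlongrightarrow> u x - 0) (at x)" by (intro tendsto_diff k0)
  then have contu: "isCont u x" by (simp add: isCont_def flip: u)
  define r where "r = (\<lambda>y. \<Sum>b\<in>Basis. ((u y - u x) \<bullet> b) *\<^sub>R N y b)"
  have "(r has_derivative (\<lambda>h. \<Sum>b\<in>(Basis::'e set). 0)) (at x)"
    unfolding r_def
    by (intro has_derivative_sum has_derivative_zero_product dN)
      (auto simp: Nx intro!: continuous_intros contu)
  then have dr: "r differentiable (at x)" using differentiable_def by blast
  have "(\<lambda>y. k y - N y (u x) - r y) differentiable (at x)"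
    by (intro differentiable_diff dk dN dr)
  moreover have "k y - N y (u x) - r y = u y" if "y \<in> U" for y
  proof -
    have "r y = N y (u y - u x)" unfolding r_def by (rule Nexp[OF that, symmetric])
    also have "\<dots> = N y (u y) - N y (u x)" using linN[OF that] linear_diff by blast
    finally have "r y = N y (u y) - N y (u x)" .
    moreover have "k y = u y + N y (u y)" using u[of y] by (metis diff_add_cancel)
    ultimately show ?thesis by simp
  qed
  ultimately show ?thesis
    using differentiable_cong[OF open_U x, of "\<lambda>y. k y - N y (u x) - r y" u] by metis
qed

text \<open>The coordinate expression of \<open>g(G v w, b)\<close> given by Koszul's formula is smooth; raising the index
  preserves differentiability.\<close>
lemma differentiable_G:
  assumes x: "x \<in> U" shows "(\<lambda>y. G y v w) differentiable (at x)"
proof (rule differentiable_raise[OF x])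
  fix b
  have "(\<lambda>y. christoffel_lowered y v w b) differentiable (at x)"
    unfolding christoffel_lowered_def divide_inverse
    by (intro differentiable_add differentiable_diff differentiable_mult differentiable_const
        smooth_on_differentiable[OF smooth_on_D[OF smooth] x])
  then show "(\<lambda>y. g c y (G y v w) b) differentiable (at x)"
    using differentiable_cong[OF open_U x, of "\<lambda>y. g c y (G y v w) b" "\<lambda>y. christoffel_lowered y v w b"]
    by (simp add: koszul[OF _ levi_civita])
qed

section \<open>Curvature\<close>

lemma riemann_antisym: "riemann g c x v w z = - riemann g c x w v z"
  by (simp add: riemann_def)

lemma D_G_sym: "x \<in> U \<Longrightarrow> D (\<lambda>y. G y v w) x z = D (\<lambda>y. G y w v) x z"
  using D_cong[OF open_U, of x "\<lambda>y. G y v w" "\<lambda>y. G y w v"] G_sym by simp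

lemma first_bianchi:
  "x \<in> U \<Longrightarrow> riemann g c x u v w + riemann g c x v w u + riemann g c x w u v = 0"
  by (simp add: riemann_def D_G_sym[of x v u] D_G_sym[of x w v] D_G_sym[of x w u]
      G_sym[of x v u] G_sym[of x w v] G_sym[of x w u])

lemma linear_D_G_left: "x \<in> U \<Longrightarrow> linear (\<lambda>v. D (\<lambda>y. G y v w) x z)"
  by (rule linear_D_arg[OF open_U _ linear_G_left]) (auto intro: differentiable_G)

lemma linear_D_G_right: "x \<in> U \<Longrightarrow> linear (\<lambda>w. D (\<lambda>y. G y v w) x z)"
  by (rule linear_D_arg[OF open_U _ linear_G_right]) (auto intro: differentiable_G)

lemma linear_riemann1: "x \<in> U \<Longrightarrow> linear (\<lambda>v. riemann g c x v w z)"
  unfolding riemann_def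
  by (intro linear_compose_sub linear_compose_add linear_D[OF differentiable_G] linear_D_G_left
      linear_G_left linear_compose[OF linear_G_left linear_G_right, unfolded o_def])

lemma linear_riemann3: "x \<in> U \<Longrightarrow> linear (riemann g c x v w)"
  unfolding riemann_def[abs_def]
  by (intro linear_compose_sub linear_compose_add linear_D_G_right
      linear_compose[OF linear_G_right linear_G_right, unfolded o_def])

text \<open>Differentiating metric compatibility a second time: the left-hand side is symmetric in the two
  directions, so the antisymmetric part of the right-hand side vanishes.\<close>
lemma riemann_skew:
  assumes x: "x \<in> U"
  shows "g c x (riemann g c x u z v) w + g c x v (riemann g c x u z w) = 0"
proof -
  have second: "D (\<lambda>y. D (\<lambda>y. g c y v w) y z) x u =
      g c x (D (\<lambda>y. G y z v) x u + G x u (G x z v)) w + g c x (G x z v) (G x u w)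
      + g c x (G x u v) (G x z w) + g c x v (D (\<lambda>y. G y z w) x u + G x u (G x z w))" for z u
  proof -
    have d1: "(\<lambda>y. g c y (G y z v) w) differentiable (at x)"
      by (rule differentiable_apply[OF open_U x linear_left]) (auto intro: differentiable differentiable_G x)
    have d2: "(\<lambda>y. g c y v (G y z w)) differentiable (at x)"
      by (rule differentiable_apply[OF open_U x linear_right]) (auto intro: differentiable differentiable_G x)
    have 1: "D (\<lambda>y. g c y (G y z v) w) x u = D (\<lambda>y. g c y (G x z v) w) x u + g c x (D (\<lambda>y. G y z v) x u) w"
      by (rule D_apply[OF open_U x linear_left]) (auto intro: differentiable differentiable_G x)
    have 2: "D (\<lambda>y. g c y v (G y z w)) x u = D (\<lambda>y. g c y v (G x z w)) x u + g c x v (D (\<lambda>y. G y z w) x u)"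
      by (rule D_apply[OF open_U x linear_right]) (auto intro: differentiable differentiable_G x)
    have "D (\<lambda>y. D (\<lambda>y. g c y v w) y z) x u = D (\<lambda>y. g c y (G y z v) w + g c y v (G y z w)) x u"
      by (rule fun_cong[OF D_cong[OF open_U x]]) (rule G_metric)
    also have "\<dots> = D (\<lambda>y. g c y (G y z v) w) x u + D (\<lambda>y. g c y v (G y z w)) x u"
      by (rule D_eqI) (intro has_derivative_add has_derivative_D d1 d2)
    finally show ?thesis unfolding 1 2 by (simp add: G_metric[OF x] metric_simps[OF x])
  qed
  have "D (\<lambda>y. D (\<lambda>y. g c y v w) y z) x u = D (\<lambda>y. D (\<lambda>y. g c y v w) y u) x z"
    by (rule second_derivative_symmetric[OF open_U x])
      (auto intro: differentiable smooth_on_differentiable[OF smooth_on_D[OF smooth] x])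
  then show ?thesis unfolding second riemann_def by (simp add: metric_simps[OF x])
qed

text \<open>By the first Bianchi identity the antisymmetric part of the Ricci tensor is a trace of the
  curvature endomorphism, which is skew.\<close>
lemma ricci_sym:
  assumes x: "x \<in> U" shows "ricci g c x v w = ricci g c x w v"
proof -
  have "riemann g c x u v w - riemann g c x u w v = - riemann g c x v w u" for u
    using first_bianchi[OF x, of u v w] unfolding riemann_antisym[of x w u v]
    by (simp add: eq_neg_iff_add_eq_0 diff_add_eq)
  then have "endo_trace (\<lambda>u. riemann g c x u v w - riemann g c x u w v)
      = - endo_trace (riemann g c x v w)"
    by (simp add: endo_trace_minus)
  also have "\<dots> = 0"
    using trace_skew[OF x linear_riemann3[OF x]] riemann_skew[OF x] by simp
  finally show ?thesis by (simp add: ricci_def endo_trace_diff)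
qed

text \<open>The commutator of second covariant derivatives of a field of endomorphisms. The terms that
  are symmetric in \<open>u\<close> and \<open>z\<close>, among them the second derivatives of \<open>A\<close>, cancel.\<close>
lemma ricci_identity:
  assumes x: "x \<in> U" and lin: "\<And>y. y \<in> U \<Longrightarrow> linear (A y)" and sm: "\<And>v. smooth_on U (\<lambda>y. A y v)"
  defines "N \<equiv> nabla_endo g c A"
  shows "(D (\<lambda>y. N y z w) x u + G x u (N x z w) - N x z (G x u w))
       - (D (\<lambda>y. N y u w) x z + G x z (N x u w) - N x u (G x z w))
       = riemann g c x u z (A x w) - A x (riemann g c x u z w)"
proof -
  note dA = smooth_on_differentiable[OF sm]
  have second: "D (\<lambda>y. N y z w) x u =
      D (\<lambda>y. D (\<lambda>y. A y w) y z) x u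
      + (D (\<lambda>y. G y z (A x w)) x u + G x z (D (\<lambda>y. A y w) x u))
      - (D (\<lambda>y. A y (G x z w)) x u + A x (D (\<lambda>y. G y z w) x u))" for u z
  proof -
    have d1: "(\<lambda>y. D (\<lambda>y. A y w) y z) differentiable (at x)"
      by (rule smooth_on_differentiable[OF smooth_on_D[OF sm] x])
    have d2: "((\<lambda>y. G y z (A y w)) has_derivative
        (\<lambda>u. D (\<lambda>y. G y z (A x w)) x u + G x z (D (\<lambda>y. A y w) x u))) (at x)"
      by (rule has_derivative_apply[OF open_U x linear_G_right]) (auto intro: differentiable_G dA x)
    have d3: "((\<lambda>y. A y (G y z w)) has_derivative
        (\<lambda>u. D (\<lambda>y. A y (G x z w)) x u + A x (D (\<lambda>y. G y z w) x u))) (at x)"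
      by (rule has_derivative_apply[OF open_U x lin]) (auto intro: differentiable_G dA x)
    show ?thesis unfolding N_def nabla_endo_def
      by (rule D_eqI) (intro has_derivative_diff has_derivative_add has_derivative_D[OF d1] d2 d3)
  qed
  have s: "D (\<lambda>y. D (\<lambda>y. A y w) y z) x u = D (\<lambda>y. D (\<lambda>y. A y w) y u) x z"
    by (rule second_derivative_symmetric[OF open_U x])
      (auto intro: dA smooth_on_differentiable[OF smooth_on_D[OF sm] x])
  note linA = lin[OF x]
  show ?thesis
    unfolding second s riemann_def
    by (simp add: N_def nabla_endo_def G_simps[OF x] linear_add[OF linA] linear_diff[OF linA])
qed

end

section \<open>Quaternionic connections on a chart\<close>

lemma quaternionic_triple_products:
  assumes "linear I" "linear J" "linear K" "quaternionic_triple I J K"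
  shows "I (I v) = - v" "J (J v) = - v" "K (K v) = - v"
    "I (J v) = K v" "J (K v) = I v" "K (I v) = J v"
    "J (I v) = - K v" "K (J v) = - I v" "I (K v) = - J v"
proof -
  have sq: "I (I v) = - v" "J (J v) = - v" "K (K v) = - v" and ijk: "I (J (K v)) = - v" for v
    using assms(4) unfolding quaternionic_triple_def by auto
  note n = linear_neg[OF assms(1)] linear_neg[OF assms(2)] linear_neg[OF assms(3)]
  have ij: "I (J v) = K v" for v using ijk[of "K v"] by (simp add: sq n)
  have jk: "J (K v) = I v" for v using arg_cong[OF ijk[of v], of I] by (simp add: sq n)
  have ik: "I (K v) = - J v" for v using sq(1)[of "J v"] by (simp add: ij)
  have kj: "K (J v) = - I v" for v using ij[of "J v"] by (simp add: sq n)
  have ji: "J (I v) = - K v" for v using jk[of "J v"] unfolding kj ij n by (metis minus_minus)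
  have ki: "K (I v) = J v" for v using ij[of "I v"] by (simp add: ji ik n)
  show "I (I v) = - v" "J (J v) = - v" "K (K v) = - v"
    "I (J v) = K v" "J (K v) = I v" "K (I v) = J v"
    "J (I v) = - K v" "K (J v) = - I v" "I (K v) = - J v"
    using sq ij jk ki ji kj ik by auto
qed

lemma quaternionic_triple_rotate:
  assumes "linear I" "linear J" "linear K" "quaternionic_triple I J K"
  shows "quaternionic_triple J K I"
  unfolding quaternionic_triple_def using quaternionic_triple_products[OF assms] by simp

lemma smooth_endo_onD:
  assumes "smooth_endo_on U A"
  shows "y \<in> U \<Longrightarrow> linear (A y)" "smooth_on U (\<lambda>y. A y v)"
    "y \<in> U \<Longrightarrow> (\<lambda>y. A y v) differentiable (at y)"
  using assms smooth_on_differentiable unfolding smooth_endo_on_def by blast+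

context chart_metric
begin

text \<open>Replacing partial by covariant derivatives in the Nijenhuis tensor introduces Christoffel symbols
  that cancel by symmetry, and the derivatives of \<open>X\<close> and \<open>Y\<close> cancel because \<open>A\<^sup>2 = - 1\<close>. Integrability can
  therefore be read off from \<open>\<nabla>A\<close>.\<close>
lemma nijenhuis_nabla:
  assumes x: "x \<in> U" and A: "smooth_endo_on U A" and sq: "\<And>v. A x (A x v) = - v"
    and X: "X differentiable (at x)" and Y: "Y differentiable (at x)"
  defines "N \<equiv> nabla_endo g c A x"
  shows "lie_bracket (\<lambda>y. A y (X y)) (\<lambda>y. A y (Y y)) x - A x (lie_bracket (\<lambda>y. A y (X y)) Y x)
      - A x (lie_bracket X (\<lambda>y. A y (Y y)) x) - lie_bracket X Y x
      = N (A x (X x)) (Y x) - N (A x (Y x)) (X x) - A x (N (X x) (Y x)) + A x (N (Y x) (X x))"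
proof -
  note l = smooth_endo_onD(1)[OF A x]
  have d: "D (\<lambda>y. A y (Z y)) x h = D (\<lambda>y. A y (Z x)) x h + A x (D Z x h)"
    if "Z differentiable (at x)" for Z h
    by (rule D_apply[OF open_U x smooth_endo_onD(1)[OF A]]) (auto intro: smooth_endo_onD(3)[OF A x] that)
  show ?thesis
    unfolding lie_bracket_def d[OF X] d[OF Y] N_def nabla_endo_def
    by (simp add: linear_add[OF l] linear_diff[OF l] linear_neg[OF l] sq
        G_sym[OF x, of "A x (X x)" "A x (Y x)"] G_sym[OF x, of "A x (X x)" "Y x"]
        G_sym[OF x, of "X x" "A x (Y x)"] G_sym[OF x, of "X x" "Y x"])
qed

lemma skew_of_orthogonal:
  assumes "x \<in> U" "\<And>v. A (A v) = - v" "\<And>v w. g c x (A v) (A w) = g c x v w"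
  shows "g c x (A v) w = - g c x v (A w)"
  using assms(3)[of "A v" w] by (simp add: assms(2) metric_simps[OF assms(1)])

text \<open>Trace of the first Bianchi identity, twisted by \<open>K\<close>. Moving \<open>K\<close> across the curvature costs
  \<open>[R, K]\<close>, which produces the \<open>g(Ku,z)\<close> term, while \<open>tr(K R(u,z))\<close> is read off from \<open>[R, I]\<close>.\<close>
lemma ricci_twisted:
  fixes I J K :: "'e \<Rightarrow> 'e"
  assumes x: "x \<in> U" and lin: "linear I" "linear J" "linear K" and q: "quaternionic_triple I J K"
    and orth: "\<And>v w. g c x (I v) (I w) = g c x v w" "\<And>v w. g c x (J v) (J w) = g c x v w"
      "\<And>v w. g c x (K v) (K w) = g c x v w"
    and RI: "\<And>u z w. riemann g c x u z (I w) - I (riemann g c x u z w)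
      = (\<Lambda> * g c x (K u) z) *\<^sub>R J w - (\<Lambda> * g c x (J u) z) *\<^sub>R K w"
    and RK: "\<And>u z w. riemann g c x u z (K w) - K (riemann g c x u z w)
      = (\<Lambda> * g c x (J u) z) *\<^sub>R I w - (\<Lambda> * g c x (I u) z) *\<^sub>R J w"
  shows "ricci g c x z (K u) - ricci g c x u (K z) = - (DIM('e) / 2 + 4) * \<Lambda> * g c x (K u) z"
proof -
  note qp = quaternionic_triple_products[OF lin q]
  note skew = skew_of_orthogonal[OF x qp(1) orth(1)] skew_of_orthogonal[OF x qp(2) orth(2)]
    skew_of_orthogonal[OF x qp(3) orth(3)]
  define R where "R = riemann g c x"
  have R1: "linear (\<lambda>v. R v w z)" and R3: "linear (R v w)" for v w z
    unfolding R_def using linear_riemann1[OF x] linear_riemann3[OF x] by auto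
  have anti: "R v w z = - R w v z" for v w z unfolding R_def by (rule riemann_antisym)
  have trI: "endo_trace I = 0" using skew(1) by (intro trace_skew[OF x lin(1)]) simp
  have trKR: "endo_trace (\<lambda>v. K (R u z v)) = - (DIM('e) / 2) * \<Lambda> * g c x (K u) z"
  proof -
    have "endo_trace (\<lambda>v. J (R u z (I v)) - J (I (R u z v)))
        = endo_trace (\<lambda>v. J ((\<Lambda> * g c x (K u) z) *\<^sub>R J v - (\<Lambda> * g c x (J u) z) *\<^sub>R K v))"
      unfolding R_def RI[symmetric] by (simp add: linear_diff[OF lin(2)])
    also have "\<dots> = endo_trace (\<lambda>v. - (\<Lambda> * g c x (K u) z) *\<^sub>R v - (\<Lambda> * g c x (J u) z) *\<^sub>R I v)"
      by (simp add: linear_diff[OF lin(2)] linear_scale[OF lin(2)] qp)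
    also have "\<dots> = - (\<Lambda> * g c x (K u) z) * DIM('e)"
      by (simp add: endo_trace_diff endo_trace_scaleR endo_trace_ident trI endo_trace_minus
          del: scaleR_minus_left)
    finally have "endo_trace (\<lambda>v. J (R u z (I v))) - endo_trace (\<lambda>v. J (I (R u z v)))
        = - (\<Lambda> * g c x (K u) z) * DIM('e)"
      by (simp add: endo_trace_diff)
    moreover have "endo_trace (\<lambda>v. J (R u z (I v))) = endo_trace (\<lambda>v. K (R u z v))"
      using endo_trace_commute[OF linear_compose[OF R3 lin(2), unfolded o_def] lin(1), of u z]
      by (simp add: qp)
    moreover have "endo_trace (\<lambda>v. J (I (R u z v))) = - endo_trace (\<lambda>v. K (R u z v))"
      by (simp add: qp endo_trace_minus)
    ultimately show ?thesis by (simp add: field_simps)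
  qed
  have tr: "endo_trace (\<lambda>v. R (K v) z u) = ricci g c x z (K u) + 2 * \<Lambda> * g c x (K u) z" for u z
  proof -
    have lin2: "linear (\<lambda>v. \<Lambda> * g c x (A v) z)" if "linear A" for A
      by (rule linearI)
        (simp_all add: linear_add[OF that] linear_scale[OF that] metric_simps[OF x] algebra_simps)
    have "endo_trace (\<lambda>v. R (K v) z u) = endo_trace (\<lambda>v. K (R v z u))"
      by (rule endo_trace_commute[OF R1 lin(3)])
    also have "\<dots> = endo_trace (\<lambda>v. R v z (K u)
        - ((\<Lambda> * g c x (J v) z) *\<^sub>R I u - (\<Lambda> * g c x (I v) z) *\<^sub>R J u))"
      unfolding R_def RK[symmetric] by simp
    also have "\<dots> = ricci g c x z (K u) - (\<Lambda> * g c x (J (I u)) z - \<Lambda> * g c x (I (J u)) z)"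
      unfolding endo_trace_diff endo_trace_rank_one[OF lin2[OF lin(1)]] endo_trace_rank_one[OF lin2[OF lin(2)]]
      by (simp add: ricci_def R_def)
    finally show ?thesis by (simp add: qp metric_simps[OF x])
  qed
  have "R u z (K v) = R (K v) z u - R (K v) u z" for v
    using first_bianchi[OF x, of u z "K v"] anti[of z "K v" u] unfolding R_def
    by (simp add: algebra_simps eq_neg_iff_add_eq_0)
  then have "endo_trace (\<lambda>v. R u z (K v)) = endo_trace (\<lambda>v. R (K v) z u) - endo_trace (\<lambda>v. R (K v) u z)"
    by (simp add: endo_trace_diff)
  moreover have "endo_trace (\<lambda>v. R u z (K v)) = endo_trace (\<lambda>v. K (R u z v))"
    by (rule endo_trace_commute[OF R3 lin(3)])
  moreover have "g c x (K z) u = - g c x (K u) z"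
    using skew(3)[of z u] sym[OF x, of z "K u"] by simp
  ultimately show ?thesis unfolding tr trKR by (simp add: algebra_simps)
qed

text \<open>The three twisted traces of the Bianchi identity already determine the symmetric Ricci tensor
  completely, without any further information on the curvature.\<close>
lemma einstein_of_quaternionic_curvature:
  fixes I J K :: "'e \<Rightarrow> 'e"
  assumes x: "x \<in> U" and lin: "linear I" "linear J" "linear K" and q: "quaternionic_triple I J K"
    and orth: "\<And>v w. g c x (I v) (I w) = g c x v w" "\<And>v w. g c x (J v) (J w) = g c x v w"
      "\<And>v w. g c x (K v) (K w) = g c x v w"
    and RI: "\<And>u z w. riemann g c x u z (I w) - I (riemann g c x u z w)
      = (\<Lambda> * g c x (K u) z) *\<^sub>R J w - (\<Lambda> * g c x (J u) z) *\<^sub>R K w"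
    and RJ: "\<And>u z w. riemann g c x u z (J w) - J (riemann g c x u z w)
      = (\<Lambda> * g c x (I u) z) *\<^sub>R K w - (\<Lambda> * g c x (K u) z) *\<^sub>R I w"
    and RK: "\<And>u z w. riemann g c x u z (K w) - K (riemann g c x u z w)
      = (\<Lambda> * g c x (J u) z) *\<^sub>R I w - (\<Lambda> * g c x (I u) z) *\<^sub>R J w"
  shows "ricci g c x u z = - (DIM('e) / 4 + 2) * \<Lambda> * g c x u z"
proof -
  note qp = quaternionic_triple_products[OF lin q]
  note skew = skew_of_orthogonal[OF x qp(1) orth(1)] skew_of_orthogonal[OF x qp(2) orth(2)]
    skew_of_orthogonal[OF x qp(3) orth(3)]
  note q2 = quaternionic_triple_rotate[OF lin q]
  note q3 = quaternionic_triple_rotate[OF lin(2,3,1) q2]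
  note tK = ricci_twisted[OF x lin q orth RI RK]
  note tI = ricci_twisted[OF x lin(2,3,1) q2 orth(2,3,1) RJ RI]
  note tJ = ricci_twisted[OF x lin(3,1,2) q3 orth(3,1,2) RK RJ]
  \<comment> \<open>the tensor that has to vanish; the twisted identities make it invariant under moving \<open>I\<close>, \<open>J\<close>,
    \<open>K\<close> between its arguments, which is incompatible with \<open>IJ = -JI\<close>\<close>
  define s where "s = (\<lambda>u z. ricci g c x u z + (DIM('e) / 4 + 2) * \<Lambda> * g c x u z)"
  have s_sym: "s u z = s z u" for u z
    by (simp add: s_def ricci_sym[OF x, of u z] sym[OF x, of u z])
  have move: "s z (A u) = s u (A z)"
    if "\<And>u z. ricci g c x z (A u) - ricci g c x u (A z) = - (DIM('e) / 2 + 4) * \<Lambda> * g c x (A u) z"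
      "\<And>u z. g c x (A u) z = - g c x u (A z)" for A u z
  proof -
    have "g c x z (A u) = - g c x u (A z)" using that(2)[of u z] sym[OF x, of z "A u"] by simp
    then show ?thesis using that(1)[of z u] that(2)[of u z] by (simp add: s_def algebra_simps)
  qed
  note mI = move[of I, OF tI skew(1)] and mJ = move[of J, OF tJ skew(2)] and mK = move[of K, OF tK skew(3)]
  have K0: "s (K u) z = 0" for u z
  proof -
    have "s (K u) z = s z (I (J u))" using s_sym qp(4) by simp
    also have "\<dots> = s (J u) (I z)" by (rule mI)
    also have "\<dots> = s (I z) (J u)" by (rule s_sym)
    also have "\<dots> = s u (J (I z))" by (rule mJ)
    also have "\<dots> = s u (- K z)" by (simp add: qp)
    also have "\<dots> = - s u (K z)"
    proof -
      have "ricci g c x u (- w) = - ricci g c x u w" for w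
        unfolding ricci_def using linear_neg[OF linear_riemann3[OF x]] by (simp add: endo_trace_minus)
      then show ?thesis by (simp add: s_def metric_simps[OF x])
    qed
    also have "s u (K z) = s (K u) z" using mK s_sym by metis
    finally show ?thesis by simp
  qed
  have "s u z = 0" using K0[of "- K u" z] qp(3) linear_neg[OF lin(3)] by simp
  then show ?thesis by (simp add: s_def algebra_simps)
qed

lemma scalar_curvature_einstein:
  assumes x: "x \<in> U" and "\<And>v w. ricci g c x v w = \<kappa> * g c x v w"
  shows "scalar_curvature g c x = \<kappa> * DIM('e)"
proof -
  have "sharp g c x (ricci g c x v) = \<kappa> *\<^sub>R v" for v
    by (rule sharp_eqI[OF x]) (simp add: assms metric_simps[OF x])
  then show ?thesis
    unfolding scalar_curvature_def by (simp add: endo_trace_scaleR endo_trace_ident)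
qed

end

text \<open>Local almost complex structures whose covariant derivatives are governed by three connection
  forms. The roles of \<open>(I, \<alpha>)\<close>, \<open>(J, \<beta>)\<close>, \<open>(K, \<gamma>)\<close> may be permuted cyclically, so statements are
  proved for one of them.\<close>

locale quaternionic_chart = chart_metric g c U
  for g :: "('a, 'e::euclidean_space) bilin" and c :: "('a, 'e) chart" and U :: "'e set" +
  fixes I J K :: "'e \<Rightarrow> 'e \<Rightarrow> 'e" and \<alpha> \<beta> \<gamma> :: "'e \<Rightarrow> 'e \<Rightarrow> real"
  assumes smooth_endos: "smooth_endo_on U I" "smooth_endo_on U J" "smooth_endo_on U K"
    and triple: "x \<in> U \<Longrightarrow> quaternionic_triple (I x) (J x) (K x)"
    and orthogonal: "x \<in> U \<Longrightarrow> g c x (I x v) (I x w) = g c x v w"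
      "x \<in> U \<Longrightarrow> g c x (J x v) (J x w) = g c x v w"
      "x \<in> U \<Longrightarrow> g c x (K x v) (K x w) = g c x v w"
    and linear_forms: "x \<in> U \<Longrightarrow> linear (\<alpha> x)" "x \<in> U \<Longrightarrow> linear (\<beta> x)" "x \<in> U \<Longrightarrow> linear (\<gamma> x)"
    and differentiable_forms: "x \<in> U \<Longrightarrow> (\<lambda>y. \<alpha> y z) differentiable (at x)"
      "x \<in> U \<Longrightarrow> (\<lambda>y. \<beta> y z) differentiable (at x)"
      "x \<in> U \<Longrightarrow> (\<lambda>y. \<gamma> y z) differentiable (at x)"
    and nabla_I: "x \<in> U \<Longrightarrow> nabla_endo g c I x z w = \<gamma> x z *\<^sub>R J x w - \<beta> x z *\<^sub>R K x w"
    and nabla_J: "x \<in> U \<Longrightarrow> nabla_endo g c J x z w = \<alpha> x z *\<^sub>R K x w - \<gamma> x z *\<^sub>R I x w"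
    and nabla_K: "x \<in> U \<Longrightarrow> nabla_endo g c K x z w = \<beta> x z *\<^sub>R I x w - \<alpha> x z *\<^sub>R J x w"
begin

lemmas linear_I = smooth_endo_onD(1)[OF smooth_endos(1)]
lemmas linear_J = smooth_endo_onD(1)[OF smooth_endos(2)]
lemmas linear_K = smooth_endo_onD(1)[OF smooth_endos(3)]

lemma products:
  assumes "x \<in> U"
  shows "I x (I x v) = - v" "J x (J x v) = - v" "K x (K x v) = - v"
    "I x (J x v) = K x v" "J x (K x v) = I x v" "K x (I x v) = J x v"
    "J x (I x v) = - K x v" "K x (J x v) = - I x v" "I x (K x v) = - J x v"
  using quaternionic_triple_products[OF linear_I[OF assms] linear_J[OF assms] linear_K[OF assms] triple[OF assms]]
  by blast+

lemma rotate: "quaternionic_chart g c U J K I \<beta> \<gamma> \<alpha>"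
  by (intro quaternionic_chart.intro[OF chart_metric_axioms] quaternionic_chart_axioms.intro)
    (assumption | rule smooth_endos orthogonal linear_forms differentiable_forms nabla_I nabla_J nabla_K
      quaternionic_triple_rotate[OF linear_I linear_J linear_K triple])+

text \<open>Substituting the formulas for \<open>\<nabla>I\<close>, \<open>\<nabla>J\<close>, \<open>\<nabla>K\<close> into the Ricci identity leaves the curvature forms
  \<open>d\<gamma> + \<alpha> \<and> \<beta>\<close> and \<open>d\<beta> + \<gamma> \<and> \<alpha>\<close> of the induced connection on the span of \<open>I\<close>, \<open>J\<close>, \<open>K\<close>.\<close>
lemma curvature_commutator:
  assumes x: "x \<in> U"
  shows "riemann g c x u z (I x w) - I x (riemann g c x u z w)
    = (D (\<lambda>y. \<gamma> y z) x u - D (\<lambda>y. \<gamma> y u) x z + \<alpha> x u * \<beta> x z - \<alpha> x z * \<beta> x u) *\<^sub>R J x w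
    - (D (\<lambda>y. \<beta> y z) x u - D (\<lambda>y. \<beta> y u) x z + \<gamma> x u * \<alpha> x z - \<gamma> x z * \<alpha> x u) *\<^sub>R K x w"
proof -
  have T: "D (\<lambda>y. nabla_endo g c I y z w) x u + G x u (nabla_endo g c I x z w) - nabla_endo g c I x z (G x u w)
      = D (\<lambda>y. \<gamma> y z) x u *\<^sub>R J x w - D (\<lambda>y. \<beta> y z) x u *\<^sub>R K x w
        + \<gamma> x z *\<^sub>R nabla_endo g c J x u w - \<beta> x z *\<^sub>R nabla_endo g c K x u w" for u z
  proof -
    have "D (\<lambda>y. nabla_endo g c I y z w) x u = D (\<lambda>y. \<gamma> y z *\<^sub>R J y w - \<beta> y z *\<^sub>R K y w) x u"
      by (rule fun_cong[OF D_cong[OF open_U x]]) (rule nabla_I)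
    also have "\<dots> = (\<gamma> x z *\<^sub>R D (\<lambda>y. J y w) x u + D (\<lambda>y. \<gamma> y z) x u *\<^sub>R J x w)
        - (\<beta> x z *\<^sub>R D (\<lambda>y. K y w) x u + D (\<lambda>y. \<beta> y z) x u *\<^sub>R K x w)"
      by (rule D_eqI) (intro has_derivative_diff has_derivative_scaleR has_derivative_D
          differentiable_forms[OF x] smooth_endo_onD(3)[OF smooth_endos(2) x]
          smooth_endo_onD(3)[OF smooth_endos(3) x])
    finally show ?thesis
      by (simp add: nabla_I[OF x] G_simps[OF x])
        (simp add: nabla_endo_def algebra_simps)
  qed
  note ricci_identity[OF x linear_I smooth_endo_onD(2)[OF smooth_endos(1)], of z w u, unfolded T, symmetric]
  then show ?thesis
    unfolding nabla_J[OF x] nabla_K[OF x] by (simp only: algebra_simps) (simp add: algebra_simps)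
qed

text \<open>The hypotheses on \<open>\<beta>\<close> and \<open>\<gamma>\<close> say that \<open>\<beta> + i\<gamma>\<close> is of type \<open>(1,0)\<close>; then \<open>\<nabla>\<^bsub>IX\<^esub> I = I (\<nabla>\<^bsub>X\<^esub> I)\<close>, and the
  terms of the Nijenhuis tensor cancel in pairs.\<close>
lemma nijenhuis_zero:
  assumes x: "x \<in> U" and type: "\<And>v. \<beta> x (I x v) = - \<gamma> x v" "\<And>v. \<gamma> x (I x v) = \<beta> x v"
    and X: "X differentiable (at x)" and Y: "Y differentiable (at x)"
  shows "lie_bracket (\<lambda>y. I y (X y)) (\<lambda>y. I y (Y y)) x - I x (lie_bracket (\<lambda>y. I y (X y)) Y x)
      - I x (lie_bracket X (\<lambda>y. I y (Y y)) x) - lie_bracket X Y x = 0"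
  unfolding nijenhuis_nabla[OF x smooth_endos(1) products(1)[OF x] X Y] nabla_I[OF x] type
  by (simp add: linear_diff[OF linear_I[OF x]] linear_scale[OF linear_I[OF x]] products[OF x])

lemma lee_form_eq:
  assumes x: "x \<in> U"
  shows "lee_form g (\<lambda>_. I) c x v = (\<gamma> x (K x v) + \<beta> x (J x v)) / 2"
proof -
  have "endo_trace (\<lambda>z. I x (nabla_endo g c I x z v)) = endo_trace (\<lambda>z. \<gamma> x z *\<^sub>R K x v + \<beta> x z *\<^sub>R J x v)"
    by (simp add: nabla_I[OF x] linear_diff[OF linear_I[OF x]] linear_scale[OF linear_I[OF x]] products[OF x])
  also have "\<dots> = \<gamma> x (K x v) + \<beta> x (J x v)"
    by (simp add: endo_trace_add endo_trace_rank_one linear_forms[OF x])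
  finally show ?thesis by (simp add: lee_form_def)
qed

lemma trace_I: assumes x: "x \<in> U" shows "endo_trace (I x) = 0"
  by (rule trace_skew[OF x linear_I[OF x]])
    (simp add: skew_of_orthogonal[OF x products(1)[OF x] orthogonal(1)[OF x]])

text \<open>Composition with \<open>I\<close> sends \<open>J\<close> and \<open>K\<close> to traceless endomorphisms, so a trace isolates the
  coefficient of \<open>I\<close>.\<close>
lemma coefficient_of_I:
  assumes x: "x \<in> U" and A: "\<And>v. A v = a *\<^sub>R I x v + b *\<^sub>R J x v + d *\<^sub>R K x v"
  shows "a = - endo_trace (\<lambda>v. I x (A v)) / DIM('e)"
proof -
  interpret J: quaternionic_chart g c U J K I \<beta> \<gamma> \<alpha> by (rule rotate)
  interpret K: quaternionic_chart g c U K I J \<gamma> \<alpha> \<beta> by (rule J.rotate)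
  note l = linear_I[OF x]
  have "endo_trace (\<lambda>v. I x (A v)) = endo_trace (\<lambda>v. - a *\<^sub>R v + b *\<^sub>R K x v - d *\<^sub>R J x v)"
    by (simp add: A linear_add[OF l] linear_scale[OF l] products[OF x])
  also have "\<dots> = - a * DIM('e)"
    using J.trace_I[OF x] K.trace_I[OF x]
    by (simp add: endo_trace_diff endo_trace_add endo_trace_scaleR endo_trace_ident endo_trace_minus
        del: scaleR_minus_left)
  finally show ?thesis by simp
qed

lemma differentiable_coefficient:
  assumes V: "open V" "V \<subseteq> U" and A: "smooth_endo_on V A" and x: "x \<in> V"
  shows "(\<lambda>y. - endo_trace (\<lambda>v. I y (A y v)) / DIM('e)) differentiable (at x)"
proof -
  have "(\<lambda>y. I y (A y b)) differentiable (at x)" for b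
  proof (rule differentiable_apply[OF open_U, where A = I and X = "\<lambda>y. A y b"])
    show "x \<in> U" using V x by auto
    then show "(\<lambda>y. I y v) differentiable at x" for v by (rule smooth_endo_onD(3)[OF smooth_endos(1)])
    show "(\<lambda>y. A y b) differentiable at x" by (rule smooth_endo_onD(3)[OF A x])
  qed (rule linear_I)
  then show ?thesis
    unfolding endo_trace_def divide_inverse
    by (intro differentiable_mult differentiable_minus differentiable_sum differentiable_const) auto
qed

text \<open>The coefficients of a section of the span are traces, hence differentiable; by the Leibniz rule
  and the formulas for the covariant derivatives of \<open>I\<close>, \<open>J\<close>, \<open>K\<close> the derivative stays in the span.\<close>
lemma nabla_in_span:
  assumes V: "open V" "V \<subseteq> U" and A: "smooth_endo_on V A"
    and span: "\<And>y. y \<in> V \<Longrightarrow> A y \<in> span3 (I y) (J y) (K y)" and x: "x \<in> V"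
  shows "nabla_endo g c A x z \<in> span3 (I x) (J x) (K x)"
proof -
  interpret J: quaternionic_chart g c U J K I \<beta> \<gamma> \<alpha> by (rule rotate)
  interpret K: quaternionic_chart g c U K I J \<gamma> \<alpha> \<beta> by (rule J.rotate)
  define a b d where "a = (\<lambda>y. - endo_trace (\<lambda>v. I y (A y v)) / DIM('e))"
    and "b = (\<lambda>y. - endo_trace (\<lambda>v. J y (A y v)) / DIM('e))"
    and "d = (\<lambda>y. - endo_trace (\<lambda>v. K y (A y v)) / DIM('e))"
  have A_eq: "A y v = a y *\<^sub>R I y v + b y *\<^sub>R J y v + d y *\<^sub>R K y v" if "y \<in> V" for y v
  proof -
    from span[OF that] obtain p q r where
      *: "\<And>v. A y v = p *\<^sub>R I y v + q *\<^sub>R J y v + r *\<^sub>R K y v"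
      unfolding span3_def by auto
    have y: "y \<in> U" using that V by auto
    have "p = a y" unfolding a_def by (rule coefficient_of_I[OF y *])
    moreover have "q = b y" unfolding b_def
      by (rule J.coefficient_of_I[OF y, where b = r and d = p]) (simp add: * add_ac)
    moreover have "r = d y" unfolding d_def
      by (rule K.coefficient_of_I[OF y, where b = p and d = q]) (simp add: * add_ac)
    ultimately show ?thesis using * by simp
  qed
  have xU: "x \<in> U" using x V by auto
  have diff: "a differentiable (at x)" "b differentiable (at x)" "d differentiable (at x)"
    unfolding a_def b_def d_def
    by (rule differentiable_coefficient[OF V A x] J.differentiable_coefficient[OF V A x]
        K.differentiable_coefficient[OF V A x])+
  have "nabla_endo g c A x z w = (D a x z - b x * \<gamma> x z + d x * \<beta> x z) *\<^sub>R I x w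
      + (D b x z + a x * \<gamma> x z - d x * \<alpha> x z) *\<^sub>R J x w
      + (D d x z - a x * \<beta> x z + b x * \<alpha> x z) *\<^sub>R K x w" for w
  proof -
    have "D (\<lambda>y. A y w) x z = D (\<lambda>y. a y *\<^sub>R I y w + b y *\<^sub>R J y w + d y *\<^sub>R K y w) x z"
      by (rule fun_cong[OF D_cong[OF V(1) x]]) (rule A_eq)
    also have "\<dots> = (a x *\<^sub>R D (\<lambda>y. I y w) x z + D a x z *\<^sub>R I x w)
        + (b x *\<^sub>R D (\<lambda>y. J y w) x z + D b x z *\<^sub>R J x w)
        + (d x *\<^sub>R D (\<lambda>y. K y w) x z + D d x z *\<^sub>R K x w)"
      by (rule D_eqI) (intro has_derivative_add has_derivative_scaleR has_derivative_D diff
          smooth_endo_onD(3)[OF smooth_endos(1) xU] smooth_endo_onD(3)[OF smooth_endos(2) xU]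
          smooth_endo_onD(3)[OF smooth_endos(3) xU])
    finally have "nabla_endo g c A x z w = D a x z *\<^sub>R I x w + D b x z *\<^sub>R J x w + D d x z *\<^sub>R K x w
        + a x *\<^sub>R nabla_endo g c I x z w + b x *\<^sub>R nabla_endo g c J x z w + d x *\<^sub>R nabla_endo g c K x z w"
      by (simp add: nabla_endo_def A_eq[OF x] G_simps[OF xU] scaleR_add_right scaleR_diff_right)
    then show ?thesis
      by (simp add: nabla_I[OF xU] nabla_J[OF xU] nabla_K[OF xU] algebra_simps)
  qed
  then show ?thesis unfolding span3_def by blast
qed

text \<open>The curvature forms of the connection \<open>(\<alpha>, \<beta>, \<gamma>)\<close> are the coefficients of the commutators of the
  Riemann tensor with \<open>I\<close>, \<open>J\<close>, \<open>K\<close>. Their proportionality to the Kaehler forms is what the trace argument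
  needs.\<close>
lemma einstein:
  assumes x: "x \<in> U"
    and curv: "\<And>u z. D (\<lambda>y. \<alpha> y z) x u - D (\<lambda>y. \<alpha> y u) x z + \<beta> x u * \<gamma> x z - \<beta> x z * \<gamma> x u = \<Lambda> * g c x (I x u) z"
      "\<And>u z. D (\<lambda>y. \<beta> y z) x u - D (\<lambda>y. \<beta> y u) x z + \<gamma> x u * \<alpha> x z - \<gamma> x z * \<alpha> x u = \<Lambda> * g c x (J x u) z"
      "\<And>u z. D (\<lambda>y. \<gamma> y z) x u - D (\<lambda>y. \<gamma> y u) x z + \<alpha> x u * \<beta> x z - \<alpha> x z * \<beta> x u = \<Lambda> * g c x (K x u) z"
  shows "ricci g c x u z = - (DIM('e) / 4 + 2) * \<Lambda> * g c x u z"
proof -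
  interpret J: quaternionic_chart g c U J K I \<beta> \<gamma> \<alpha> by (rule rotate)
  interpret K: quaternionic_chart g c U K I J \<gamma> \<alpha> \<beta> by (rule J.rotate)
  note com = curvature_commutator[OF x] J.curvature_commutator[OF x] K.curvature_commutator[OF x]
  show ?thesis
    by (rule einstein_of_quaternionic_curvature[OF x linear_I[OF x] linear_J[OF x] linear_K[OF x] triple[OF x]
          orthogonal(1)[OF x] orthogonal(2)[OF x] orthogonal(3)[OF x]])
      (simp_all only: com curv)
qed

end

section \<open>The lifted metric in a chart\<close>

text \<open>The geometry of the lift over one chart of the base, without reference to coordinates of the
  half-space: \<open>\<theta>0, ..., \<theta>3\<close> stand for \<open>dt, I dt, J dt, K dt\<close>, \<open>P\<close> for the differential of the projection, and
  \<open>(\<theta>, P)\<close> is a coframe. The derivatives of \<open>\<theta>1, \<theta>2, \<theta>3\<close> come from the potentials of the Kaehler forms. In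
  this form the data are invariant under cyclic permutation of \<open>I\<close>, \<open>J\<close>, \<open>K\<close>. The base is regarded as a
  quaternionic chart with vanishing connection forms.\<close>
locale lifted_chart =
  base: quaternionic_chart gb cb Ub Ib Jb Kb "\<lambda>_ _. 0" "\<lambda>_ _. 0" "\<lambda>_ _. 0"
  for gb :: "('b, 'e::euclidean_space) bilin" and cb Ub Ib Jb Kb +
  fixes aI aJ aK :: "'e \<Rightarrow> 'e \<Rightarrow> real" and \<nu> :: real
    and g :: "('a, 'm::euclidean_space) bilin" and c :: "('a, 'm) chart" and U :: "'m set"
    and I J K :: "'m \<Rightarrow> 'm \<Rightarrow> 'm"
    and P :: "'m \<Rightarrow> 'e" and t :: "'m \<Rightarrow> real" and \<theta>0 \<theta>1 \<theta>2 \<theta>3 :: "'m \<Rightarrow> 'm \<Rightarrow> real"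
  assumes nu: "\<nu> < 0"
    and linear_a: "X \<in> Ub \<Longrightarrow> linear (aI X)" "X \<in> Ub \<Longrightarrow> linear (aJ X)" "X \<in> Ub \<Longrightarrow> linear (aK X)"
    and differentiable_a: "X \<in> Ub \<Longrightarrow> (\<lambda>Y. aI Y V) differentiable (at X)"
      "X \<in> Ub \<Longrightarrow> (\<lambda>Y. aJ Y V) differentiable (at X)"
      "X \<in> Ub \<Longrightarrow> (\<lambda>Y. aK Y V) differentiable (at X)"
    and kaehler: "X \<in> Ub \<Longrightarrow> D (\<lambda>Y. aI Y W) X V - D (\<lambda>Y. aI Y V) X W = gb cb X (Ib X V) W"
      "X \<in> Ub \<Longrightarrow> D (\<lambda>Y. aJ Y W) X V - D (\<lambda>Y. aJ Y V) X W = gb cb X (Jb X V) W"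
      "X \<in> Ub \<Longrightarrow> D (\<lambda>Y. aK Y W) X V - D (\<lambda>Y. aK Y V) X W = gb cb X (Kb X V) W"
    and open_total: "open U"
    and linear_P: "linear P" and P_in: "x \<in> U \<Longrightarrow> P x \<in> Ub"
    and t_pos: "x \<in> U \<Longrightarrow> 0 < t x" and t_derivative: "x \<in> U \<Longrightarrow> (t has_derivative \<theta>0 x) (at x)"
    and linear_theta: "x \<in> U \<Longrightarrow> linear (\<theta>0 x)" "x \<in> U \<Longrightarrow> linear (\<theta>1 x)"
      "x \<in> U \<Longrightarrow> linear (\<theta>2 x)" "x \<in> U \<Longrightarrow> linear (\<theta>3 x)"
    and theta_derivative: "x \<in> U \<Longrightarrow> ((\<lambda>y. \<theta>0 y h) has_derivative (\<lambda>z. 0)) (at x)"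
      "x \<in> U \<Longrightarrow> ((\<lambda>y. \<theta>1 y h) has_derivative (\<lambda>z. \<nu> * D (\<lambda>Y. aI Y (P h)) (P x) (P z))) (at x)"
      "x \<in> U \<Longrightarrow> ((\<lambda>y. \<theta>2 y h) has_derivative (\<lambda>z. \<nu> * D (\<lambda>Y. aJ Y (P h)) (P x) (P z))) (at x)"
      "x \<in> U \<Longrightarrow> ((\<lambda>y. \<theta>3 y h) has_derivative (\<lambda>z. \<nu> * D (\<lambda>Y. aK Y (P h)) (P x) (P z))) (at x)"
    and frame_exists: "x \<in> U \<Longrightarrow> \<exists>h. \<theta>0 x h = r0 \<and> \<theta>1 x h = r1 \<and> \<theta>2 x h = r2 \<and> \<theta>3 x h = r3 \<and> P h = X"
    and frame_eqI: "x \<in> U \<Longrightarrow> \<theta>0 x h = \<theta>0 x k \<Longrightarrow> \<theta>1 x h = \<theta>1 x k \<Longrightarrow> \<theta>2 x h = \<theta>2 x k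
      \<Longrightarrow> \<theta>3 x h = \<theta>3 x k \<Longrightarrow> P h = P k \<Longrightarrow> h = k"
    and metric: "x \<in> U \<Longrightarrow> g c x h k = - (1 / (\<nu> * (t x)\<^sup>2)) *
        (\<theta>0 x h * \<theta>0 x k + \<theta>1 x h * \<theta>1 x k + \<theta>2 x h * \<theta>2 x k + \<theta>3 x h * \<theta>3 x k)
        + (1 / t x) * gb cb (P x) (P h) (P k)"
    and smooth_total: "smooth_on U (\<lambda>x. g c x h k)"
    and smooth_total_endos: "smooth_endo_on U I" "smooth_endo_on U J" "smooth_endo_on U K"
    and theta_I: "x \<in> U \<Longrightarrow> \<theta>0 x (I x h) = - \<theta>1 x h" "x \<in> U \<Longrightarrow> \<theta>1 x (I x h) = \<theta>0 x h"
      "x \<in> U \<Longrightarrow> \<theta>2 x (I x h) = - \<theta>3 x h" "x \<in> U \<Longrightarrow> \<theta>3 x (I x h) = \<theta>2 x h"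
      "x \<in> U \<Longrightarrow> P (I x h) = Ib (P x) (P h)"
    and theta_J: "x \<in> U \<Longrightarrow> \<theta>0 x (J x h) = - \<theta>2 x h" "x \<in> U \<Longrightarrow> \<theta>2 x (J x h) = \<theta>0 x h"
      "x \<in> U \<Longrightarrow> \<theta>3 x (J x h) = - \<theta>1 x h" "x \<in> U \<Longrightarrow> \<theta>1 x (J x h) = \<theta>3 x h"
      "x \<in> U \<Longrightarrow> P (J x h) = Jb (P x) (P h)"
    and theta_K: "x \<in> U \<Longrightarrow> \<theta>0 x (K x h) = - \<theta>3 x h" "x \<in> U \<Longrightarrow> \<theta>3 x (K x h) = \<theta>0 x h"
      "x \<in> U \<Longrightarrow> \<theta>1 x (K x h) = - \<theta>2 x h" "x \<in> U \<Longrightarrow> \<theta>2 x (K x h) = \<theta>1 x h"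
      "x \<in> U \<Longrightarrow> P (K x h) = Kb (P x) (P h)"
begin

lemma rotate: "lifted_chart gb cb Ub Jb Kb Ib aJ aK aI \<nu> g c U J K I P t \<theta>0 \<theta>2 \<theta>3 \<theta>1"
proof (intro lifted_chart.intro base.rotate lifted_chart_axioms.intro)
  show "\<exists>h. \<theta>0 x h = r0 \<and> \<theta>2 x h = r1 \<and> \<theta>3 x h = r2 \<and> \<theta>1 x h = r3 \<and> P h = X"
    if "x \<in> U" for x r0 r1 r2 r3 X
    using frame_exists[OF that, of r0 r3 r1 r2 X] by blast
qed (rule nu linear_a differentiable_a kaehler open_total linear_P P_in t_pos t_derivative
    linear_theta theta_derivative smooth_total smooth_total_endos theta_I theta_J theta_K
    | assumption | simp add: metric | blast intro: frame_eqI)+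

lemmas P_simps = linear_add[OF linear_P] linear_scale[OF linear_P] linear_diff[OF linear_P]
  linear_neg[OF linear_P] linear_0[OF linear_P]

lemmas theta_simps =
  linear_add[OF linear_theta(1)] linear_add[OF linear_theta(2)] linear_add[OF linear_theta(3)] linear_add[OF linear_theta(4)]
  linear_scale[OF linear_theta(1)] linear_scale[OF linear_theta(2)] linear_scale[OF linear_theta(3)] linear_scale[OF linear_theta(4)]
  linear_diff[OF linear_theta(1)] linear_diff[OF linear_theta(2)] linear_diff[OF linear_theta(3)] linear_diff[OF linear_theta(4)]
  linear_0[OF linear_theta(1)] linear_0[OF linear_theta(2)] linear_0[OF linear_theta(3)] linear_0[OF linear_theta(4)]

lemma chart_metric_total: "chart_metric g c U"
proof
  show "open U" by (rule open_total)
  show "smooth_on U (\<lambda>x. g c x v w)" for v w by (rule smooth_total)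
  fix x v w assume x: "x \<in> U"
  note Px = P_in[OF x]
  show "g c x v w = g c x w v"
    by (simp add: metric[OF x] base.sym[OF Px, of "P v"] mult.commute)
  show "bilinear (g c x)" unfolding bilinear_def
    by (auto intro!: linearI simp: metric[OF x] theta_simps[OF x] P_simps base.metric_simps[OF Px] algebra_simps add_divide_distrib)
  assume v: "v \<noteq> 0"
  define S where "S = \<theta>0 x v * \<theta>0 x v + \<theta>1 x v * \<theta>1 x v + \<theta>2 x v * \<theta>2 x v + \<theta>3 x v * \<theta>3 x v"
  have "S \<ge> 0" unfolding S_def by simp
  have p: "0 < - (1 / (\<nu> * (t x)\<^sup>2))" using nu t_pos[OF x] by (simp add: mult_neg_pos)
  have q: "0 < 1 / t x" using t_pos[OF x] by simp
  show "0 < g c x v v"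
  proof (cases "P v = 0")
    case True
    have "S \<noteq> 0"
    proof
      assume "S = 0"
      then have "\<theta>0 x v = 0" "\<theta>1 x v = 0" "\<theta>2 x v = 0" "\<theta>3 x v = 0"
        unfolding S_def by (simp_all add: add_nonneg_eq_0_iff)
      then have "v = 0" using True by (intro frame_eqI[OF x]) (simp_all add: theta_simps[OF x] P_simps)
      with v show False by simp
    qed
    then have "0 < S" using \<open>S \<ge> 0\<close> by simp
    then show ?thesis using True p
      by (simp only: metric[OF x] S_def[symmetric] base.metric_simps[OF Px] mult_zero_right add_0_right mult_pos_pos)
  next
    case False
    have "0 < (1 / t x) * gb cb (P x) (P v) (P v)" using base.pos[OF Px False] q by (rule mult_pos_pos[rotated])
    moreover have "0 \<le> - (1 / (\<nu> * (t x)\<^sup>2)) * S" using p \<open>S \<ge> 0\<close> by (intro mult_nonneg_nonneg) auto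
    ultimately show ?thesis unfolding metric[OF x] S_def by linarith
  qed
qed

interpretation total: chart_metric g c U by (rule chart_metric_total)

lemma base_skew:
  assumes "X \<in> Ub"
  shows "gb cb X V (Ib X W) = - gb cb X (Ib X V) W" "gb cb X V (Jb X W) = - gb cb X (Jb X V) W"
    "gb cb X V (Kb X W) = - gb cb X (Kb X V) W"
  using base.skew_of_orthogonal[OF assms base.products(1)[OF assms] base.orthogonal(1)[OF assms]]
    base.skew_of_orthogonal[OF assms base.products(2)[OF assms] base.orthogonal(2)[OF assms]]
    base.skew_of_orthogonal[OF assms base.products(3)[OF assms] base.orthogonal(3)[OF assms]]
  by simp_all

lemma base_skew_swap:
  assumes "X \<in> Ub"
  shows "gb cb X (Ib X V) W = - gb cb X (Ib X W) V" "gb cb X (Jb X V) W = - gb cb X (Jb X W) V"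
    "gb cb X (Kb X V) W = - gb cb X (Kb X W) V"
  using base_skew[OF assms, of W V] base.sym[OF assms, of W] by simp_all

text \<open>The action of the quaternion \<open>\<theta>0 + \<theta>1 i + \<theta>2 j + \<theta>3 k\<close> on tangent vectors of the base.\<close>
abbreviation rho :: "'m \<Rightarrow> 'm \<Rightarrow> 'e \<Rightarrow> 'e" where
  "rho x v X \<equiv> \<theta>0 x v *\<^sub>R X + \<theta>1 x v *\<^sub>R Ib (P x) X + \<theta>2 x v *\<^sub>R Jb (P x) X + \<theta>3 x v *\<^sub>R Kb (P x) X"

text \<open>The Christoffel symbols of the lifted metric in components with respect to the coframe, as found
  from Koszul's formula. The derivatives of the potentials account for the coframe not being constant;
  \<open>SOME\<close> selects the unique vector with these components.\<close>
definition christoffel :: "'m \<Rightarrow> 'm \<Rightarrow> 'm \<Rightarrow> 'm" where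
  "christoffel x v w = (SOME h.
     \<theta>0 x h = (\<theta>1 x v * \<theta>1 x w + \<theta>2 x v * \<theta>2 x w + \<theta>3 x v * \<theta>3 x w - \<theta>0 x v * \<theta>0 x w) / t x
       - \<nu> / 2 * gb cb (P x) (P v) (P w) \<and>
     \<theta>1 x h = \<nu> * D (\<lambda>Y. aI Y (P w)) (P x) (P v) - (\<theta>0 x v * \<theta>1 x w + \<theta>1 x v * \<theta>0 x w) / t x
       - \<nu> / 2 * gb cb (P x) (Ib (P x) (P v)) (P w) \<and>
     \<theta>2 x h = \<nu> * D (\<lambda>Y. aJ Y (P w)) (P x) (P v) - (\<theta>0 x v * \<theta>2 x w + \<theta>2 x v * \<theta>0 x w) / t x
       - \<nu> / 2 * gb cb (P x) (Jb (P x) (P v)) (P w) \<and>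
     \<theta>3 x h = \<nu> * D (\<lambda>Y. aK Y (P w)) (P x) (P v) - (\<theta>0 x v * \<theta>3 x w + \<theta>3 x v * \<theta>0 x w) / t x
       - \<nu> / 2 * gb cb (P x) (Kb (P x) (P v)) (P w) \<and>
     P h = levi_civita gb cb (P x) (P v) (P w) - (1 / (2 * t x)) *\<^sub>R (rho x v (P w) + rho x w (P v)))"

lemma christoffel:
  assumes "x \<in> U"
  shows "\<theta>0 x (christoffel x v w) = (\<theta>1 x v * \<theta>1 x w + \<theta>2 x v * \<theta>2 x w + \<theta>3 x v * \<theta>3 x w - \<theta>0 x v * \<theta>0 x w) / t x
       - \<nu> / 2 * gb cb (P x) (P v) (P w)"
    "\<theta>1 x (christoffel x v w) = \<nu> * D (\<lambda>Y. aI Y (P w)) (P x) (P v) - (\<theta>0 x v * \<theta>1 x w + \<theta>1 x v * \<theta>0 x w) / t x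
       - \<nu> / 2 * gb cb (P x) (Ib (P x) (P v)) (P w)"
    "\<theta>2 x (christoffel x v w) = \<nu> * D (\<lambda>Y. aJ Y (P w)) (P x) (P v) - (\<theta>0 x v * \<theta>2 x w + \<theta>2 x v * \<theta>0 x w) / t x
       - \<nu> / 2 * gb cb (P x) (Jb (P x) (P v)) (P w)"
    "\<theta>3 x (christoffel x v w) = \<nu> * D (\<lambda>Y. aK Y (P w)) (P x) (P v) - (\<theta>0 x v * \<theta>3 x w + \<theta>3 x v * \<theta>0 x w) / t x
       - \<nu> / 2 * gb cb (P x) (Kb (P x) (P v)) (P w)"
    "P (christoffel x v w) = levi_civita gb cb (P x) (P v) (P w) - (1 / (2 * t x)) *\<^sub>R (rho x v (P w) + rho x w (P v))"
  using someI_ex[OF frame_exists[OF assms]] unfolding christoffel_def by blast+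

lemma linear_D_a:
  assumes "X \<in> Ub"
  shows "linear (\<lambda>V. D (\<lambda>Y. aI Y V) X W)" "linear (\<lambda>V. D (\<lambda>Y. aJ Y V) X W)" "linear (\<lambda>V. D (\<lambda>Y. aK Y V) X W)"
    "linear (D (\<lambda>Y. aI Y V) X)" "linear (D (\<lambda>Y. aJ Y V) X)" "linear (D (\<lambda>Y. aK Y V) X)"
  by (rule linear_D_arg[OF base.open_U assms linear_a(1) differentiable_a(1)[OF assms]]
      linear_D_arg[OF base.open_U assms linear_a(2) differentiable_a(2)[OF assms]]
      linear_D_arg[OF base.open_U assms linear_a(3) differentiable_a(3)[OF assms]]
      linear_D[OF differentiable_a(1)[OF assms]] linear_D[OF differentiable_a(2)[OF assms]]
      linear_D[OF differentiable_a(3)[OF assms]]; assumption)+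

lemmas base_endo_simps =
  linear_add[OF base.linear_I] linear_add[OF base.linear_J] linear_add[OF base.linear_K]
  linear_scale[OF base.linear_I] linear_scale[OF base.linear_J] linear_scale[OF base.linear_K]
  linear_diff[OF base.linear_I] linear_diff[OF base.linear_J] linear_diff[OF base.linear_K]

text \<open>The derivative of a potential is symmetric up to the Kaehler form, and half of the Kaehler form
  is subtracted; torsion-freeness is the condition that the Kaehler forms are the differentials of the
  potentials.\<close>
lemma christoffel_sym:
  assumes x: "x \<in> U" shows "christoffel x v w = christoffel x w v"
proof -
  note Px = P_in[OF x]
  have twist: "\<nu> * d - e / t x - \<nu> / 2 * s = \<nu> * d' - e' / t x - \<nu> / 2 * s'"
    if "d - d' = s" "s = - s'" "e = e'" for d d' e e' s s' :: real
  proof -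
    have d: "d = d' - s'" using that by simp
    show ?thesis unfolding d that(2,3) by (simp add: algebra_simps)
  qed
  show ?thesis
  proof (rule frame_eqI[OF x]; unfold christoffel[OF x])
    show "levi_civita gb cb (P x) (P v) (P w) - (1 / (2 * t x)) *\<^sub>R (rho x v (P w) + rho x w (P v)) =
      levi_civita gb cb (P x) (P w) (P v) - (1 / (2 * t x)) *\<^sub>R (rho x w (P v) + rho x v (P w))"
      by (simp add: base.G_sym[OF Px, of "P v"] add.commute[of "rho x v (P w)"])
  qed (simp add: base.sym[OF Px, of "P v"] mult.commute,
      rule twist[OF kaehler(1)[OF Px] base_skew_swap(1)[OF Px]], simp add: mult.commute,
      rule twist[OF kaehler(2)[OF Px] base_skew_swap(2)[OF Px]], simp add: mult.commute,
      rule twist[OF kaehler(3)[OF Px] base_skew_swap(3)[OF Px]], simp add: mult.commute)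
qed

lemma linear_christoffel:
  assumes x: "x \<in> U" shows "linear (\<lambda>v. christoffel x v w)"
proof -
  note Px = P_in[OF x]
  show ?thesis
    by (rule linearI; rule frame_eqI[OF x])
      (simp_all add: christoffel[OF x] theta_simps[OF x] P_simps base.metric_simps[OF Px]
        base_endo_simps[OF Px] base.G_simps[OF Px]
        linear_add[OF linear_D_a(4)[OF Px]] linear_add[OF linear_D_a(5)[OF Px]] linear_add[OF linear_D_a(6)[OF Px]]
        linear_scale[OF linear_D_a(4)[OF Px]] linear_scale[OF linear_D_a(5)[OF Px]] linear_scale[OF linear_D_a(6)[OF Px]]
        algebra_simps add_divide_distrib diff_divide_distrib)
qed

lemma D_metric:
  assumes x: "x \<in> U"
  defines "p \<equiv> - (1 / (\<nu> * (t x)\<^sup>2))"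
  shows "D (\<lambda>y. g c y v w) x z =
    - 2 * p * \<theta>0 x z / t x * (\<theta>0 x v * \<theta>0 x w + \<theta>1 x v * \<theta>1 x w + \<theta>2 x v * \<theta>2 x w + \<theta>3 x v * \<theta>3 x w)
    + p * \<nu> * (D (\<lambda>Y. aI Y (P v)) (P x) (P z) * \<theta>1 x w + \<theta>1 x v * D (\<lambda>Y. aI Y (P w)) (P x) (P z)
      + D (\<lambda>Y. aJ Y (P v)) (P x) (P z) * \<theta>2 x w + \<theta>2 x v * D (\<lambda>Y. aJ Y (P w)) (P x) (P z)
      + D (\<lambda>Y. aK Y (P v)) (P x) (P z) * \<theta>3 x w + \<theta>3 x v * D (\<lambda>Y. aK Y (P w)) (P x) (P z))
    - \<theta>0 x z / (t x)\<^sup>2 * gb cb (P x) (P v) (P w)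
    + (gb cb (P x) (levi_civita gb cb (P x) (P z) (P v)) (P w)
       + gb cb (P x) (P v) (levi_civita gb cb (P x) (P z) (P w))) / t x"
proof -
  note Px = P_in[OF x]
  have tx: "t x \<noteq> 0" using t_pos[OF x] by simp
  have dgb: "((\<lambda>y. gb cb (P y) (P v) (P w)) has_derivative
      (\<lambda>z. D (\<lambda>Y. gb cb Y (P v) (P w)) (P x) (P z))) (at x)"
    by (rule has_derivative_compose[where f = P and g = "\<lambda>Y. gb cb Y (P v) (P w)",
          OF linear_imp_has_derivative[OF linear_P] has_derivative_D[OF base.differentiable[OF Px]]])
  have dq: "((\<lambda>y. 1 / t y) has_derivative (\<lambda>z. - \<theta>0 x z / (t x)\<^sup>2)) (at x)"
    using Deriv.has_derivative_inverse[OF tx t_derivative[OF x]]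
    by (simp add: field_simps power2_eq_square)
  have dp: "((\<lambda>y. - (1 / (\<nu> * (t y)\<^sup>2))) has_derivative (\<lambda>z. - 2 * p * \<theta>0 x z / t x)) (at x)"
    using has_derivative_mult_right[OF has_derivative_mult[OF dq dq], of "- (1 / \<nu>)"] nu tx
    by (simp add: p_def field_simps power2_eq_square)
  let ?S = "\<lambda>y. \<theta>0 y v * \<theta>0 y w + \<theta>1 y v * \<theta>1 y w + \<theta>2 y v * \<theta>2 y w + \<theta>3 y v * \<theta>3 y w"
  note d = has_derivative_add[OF
      has_derivative_mult[OF dp has_derivative_add[OF has_derivative_add[OF has_derivative_add[OF
        has_derivative_mult[OF theta_derivative(1)[OF x, of v] theta_derivative(1)[OF x, of w]]
        has_derivative_mult[OF theta_derivative(2)[OF x, of v] theta_derivative(2)[OF x, of w]]]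
        has_derivative_mult[OF theta_derivative(3)[OF x, of v] theta_derivative(3)[OF x, of w]]]
        has_derivative_mult[OF theta_derivative(4)[OF x, of v] theta_derivative(4)[OF x, of w]]]]
      has_derivative_mult[OF dq dgb]]
  have "D (\<lambda>y. g c y v w) x z = D (\<lambda>y. - (1 / (\<nu> * (t y)\<^sup>2)) * ?S y + (1 / t y) * gb cb (P y) (P v) (P w)) x z"
    by (rule fun_cong[OF D_cong[OF open_total x]]) (rule metric)
  also have "\<dots> = - 2 * p * \<theta>0 x z / t x * ?S x
    + p * \<nu> * (D (\<lambda>Y. aI Y (P v)) (P x) (P z) * \<theta>1 x w + \<theta>1 x v * D (\<lambda>Y. aI Y (P w)) (P x) (P z)
      + D (\<lambda>Y. aJ Y (P v)) (P x) (P z) * \<theta>2 x w + \<theta>2 x v * D (\<lambda>Y. aJ Y (P w)) (P x) (P z)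
      + D (\<lambda>Y. aK Y (P v)) (P x) (P z) * \<theta>3 x w + \<theta>3 x v * D (\<lambda>Y. aK Y (P w)) (P x) (P z))
    - \<theta>0 x z / (t x)\<^sup>2 * gb cb (P x) (P v) (P w)
    + D (\<lambda>Y. gb cb Y (P v) (P w)) (P x) (P z) / t x"
    unfolding D_eqI[OF d] p_def[symmetric] by (simp add: algebra_simps)
  finally show ?thesis by (simp only: base.G_metric[OF Px])
qed

lemma christoffel_metric:
  assumes x: "x \<in> U"
  shows "D (\<lambda>y. g c y v w) x z = g c x (christoffel x z v) w + g c x v (christoffel x z w)"
proof -
  note Px = P_in[OF x]
  define p s where "p = - (1 / (\<nu> * (t x)\<^sup>2))" and "s = 1 / t x"
  have tx: "t x \<noteq> 0" using t_pos[OF x] by simp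
  have ps: "p * \<nu> = - s * s" using tx nu by (simp add: p_def s_def power2_eq_square)
  have dv: "a / t x = s * a" "1 / (2 * t x) = s / 2" "a / (t x)\<^sup>2 = s * s * a" for a
    by (simp_all add: s_def power2_eq_square)
  note m = metric[OF x, folded p_def, folded s_def]
  note gb = base.metric_simps[OF Px] base_skew[OF Px] 
    base_skew_swap(1)[OF Px, of "P z" "P v"] base_skew_swap(2)[OF Px, of "P z" "P v"] base_skew_swap(3)[OF Px, of "P z" "P v"]
    base_skew_swap(1)[OF Px, of "P z" "P w"] base_skew_swap(2)[OF Px, of "P z" "P w"] base_skew_swap(3)[OF Px, of "P z" "P w"]
    base_skew_swap(1)[OF Px, of "P w" "P v"] base_skew_swap(2)[OF Px, of "P w" "P v"] base_skew_swap(3)[OF Px, of "P w" "P v"]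
    base.sym[OF Px, of "P z" "P v"] base.sym[OF Px, of "P z" "P w"] base.sym[OF Px, of "P w" "P v"]
  \<comment> \<open>the terms coupling base and fibre; they drop out exactly because the two factors of the metric
    satisfy \<open>p \<nu> + s\<^sup>2 = 0\<close>\<close>
  define E where "E = gb cb (P x) (P v) (P z) * \<theta>0 x w + gb cb (P x) (P w) (P z) * \<theta>0 x v
     - gb cb (P x) (Ib (P x) (P v)) (P z) * \<theta>1 x w - gb cb (P x) (Ib (P x) (P w)) (P z) * \<theta>1 x v
     - gb cb (P x) (Jb (P x) (P v)) (P z) * \<theta>2 x w - gb cb (P x) (Jb (P x) (P w)) (P z) * \<theta>2 x v
     - gb cb (P x) (Kb (P x) (P v)) (P z) * \<theta>3 x w - gb cb (P x) (Kb (P x) (P w)) (P z) * \<theta>3 x v"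
  have "D (\<lambda>y. g c y v w) x z - (g c x (christoffel x z v) w + g c x v (christoffel x z w))
      = (p * \<nu> + s * s) / 2 * E"
    unfolding D_metric[OF x, folded p_def] m christoffel[OF x] dv E_def
    by (simp add: gb algebra_simps add_divide_distrib diff_divide_distrib)
  then show ?thesis using ps by simp
qed

lemma levi_civita_total:
  assumes x: "x \<in> U" shows "levi_civita g c x = christoffel x"
proof (rule total.levi_civita_eqI[OF x], intro conjI allI)
  have "linear (christoffel x v)" for v
  proof -
    have "christoffel x v = (\<lambda>w. christoffel x w v)" by (rule ext) (rule christoffel_sym[OF x])
    then show ?thesis using linear_christoffel[OF x, of v] by simp
  qed
  then show "bilinear (christoffel x)"
    unfolding bilinear_def using linear_christoffel[OF x] by blast
qed (rule christoffel_sym[OF x] christoffel_metric[OF x])+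

lemma D_base_I:
  assumes "X \<in> Ub"
  shows "D (\<lambda>Y. Ib Y W) X Z = Ib X (levi_civita gb cb X Z W) - levi_civita gb cb X Z (Ib X W)"
  using base.nabla_I[OF assms, of Z W] by (simp add: nabla_endo_def algebra_simps)

text \<open>In the coframe \<open>(\<theta>, P)\<close> the endomorphism \<open>I\<close> is a constant matrix on the \<open>\<theta>\<close>-components and the
  parallel \<open>Ib\<close> on the base, so its covariant derivative is algebraic in the Christoffel symbols. On
  the base component it is \<open>- 1/(2t)\<close> times the commutator of \<open>rho x z\<close> with \<open>Ib\<close>.\<close>
lemma nabla_I:
  assumes x: "x \<in> U"
  shows "nabla_endo g c I x z w = (- \<theta>3 x z / t x) *\<^sub>R J x w - (- \<theta>2 x z / t x) *\<^sub>R K x w"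
proof -
  note Px = P_in[OF x]
  have dI: "(\<lambda>y. I y w) differentiable (at x)" by (rule smooth_endo_onD(3)[OF smooth_total_endos(1) x])
  have split: "\<theta> x (D (\<lambda>y. I y w) x z) = D (\<lambda>y. \<theta> y (I y w)) x z - D (\<lambda>y. \<theta> y (I x w)) x z"
    if "\<And>y. y \<in> U \<Longrightarrow> linear (\<theta> y)" "\<And>h. (\<lambda>y. \<theta> y h) differentiable (at x)" for \<theta> :: "'m \<Rightarrow> 'm \<Rightarrow> real"
    using D_apply[OF open_total x that(1) that(2) dI] by simp
  have dtheta: "(\<lambda>y. \<theta>0 y h) differentiable (at x)" "(\<lambda>y. \<theta>1 y h) differentiable (at x)"
    "(\<lambda>y. \<theta>2 y h) differentiable (at x)" "(\<lambda>y. \<theta>3 y h) differentiable (at x)" for h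
    using theta_derivative[OF x] differentiable_def by blast+
  have e: "D (\<lambda>y. \<theta>0 y (I y w)) x z = D (\<lambda>y. - \<theta>1 y w) x z" "D (\<lambda>y. \<theta>1 y (I y w)) x z = D (\<lambda>y. \<theta>0 y w) x z"
    "D (\<lambda>y. \<theta>2 y (I y w)) x z = D (\<lambda>y. - \<theta>3 y w) x z" "D (\<lambda>y. \<theta>3 y (I y w)) x z = D (\<lambda>y. \<theta>2 y w) x z"
    by (rule fun_cong[OF D_cong[OF open_total x]], erule theta_I)+
  note Dth = D_eqI[OF theta_derivative(1)[OF x]] D_eqI[OF theta_derivative(2)[OF x]]
    D_eqI[OF theta_derivative(3)[OF x]] D_eqI[OF theta_derivative(4)[OF x]]
    D_eqI[OF has_derivative_minus[OF theta_derivative(2)[OF x]]]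
    D_eqI[OF has_derivative_minus[OF theta_derivative(4)[OF x]]]
  note th = split[OF linear_theta(1) dtheta(1)] split[OF linear_theta(2) dtheta(2)]
    split[OF linear_theta(3) dtheta(3)] split[OF linear_theta(4) dtheta(4)]
  have PD: "P (D (\<lambda>y. I y w) x z) = D (\<lambda>Y. Ib Y (P w)) (P x) (P z)"
  proof -
    have "P (D (\<lambda>y. I y w) x z) = D (\<lambda>y. P (I y w)) x z"
      using linear_P linear_conv_bounded_linear
      by (intro D_eqI[symmetric] bounded_linear.has_derivative[OF _ has_derivative_D[OF dI]]) blast
    also have "\<dots> = D (\<lambda>y. Ib (P y) (P w)) x z"
      by (rule fun_cong[OF D_cong[OF open_total x]]) (rule theta_I)
    also have "\<dots> = D (\<lambda>Y. Ib Y (P w)) (P x) (P z)"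
      by (intro D_eqI has_derivative_compose[where f = P and g = "\<lambda>Y. Ib Y (P w)",
          OF linear_imp_has_derivative[OF linear_P]
            has_derivative_D[OF smooth_endo_onD(3)[OF base.smooth_endos(1) Px]]])
    finally show ?thesis .
  qed
  note sk = base.metric_simps[OF Px] base_skew[OF Px] base_skew_swap[OF Px, of "P w" "P z"] base.sym[OF Px, of "P w" "P z"]
  show ?thesis
    unfolding nabla_endo_def levi_civita_total[OF x]
  proof (rule frame_eqI[OF x])
    have half: "(a / (t x * 2)) *\<^sub>R B + (a / (t x * 2)) *\<^sub>R B = (a / t x) *\<^sub>R B"
      "(a / (t x * 2)) *\<^sub>R B + ((a / (t x * 2)) *\<^sub>R B + C) = (a / t x) *\<^sub>R B + C" for a and B C :: 'e
      by (simp_all flip: scaleR_add_left add.assoc)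
    show "P (D (\<lambda>y. I y w) x z + christoffel x z (I x w) - I x (christoffel x z w)) =
      P ((- \<theta>3 x z / t x) *\<^sub>R J x w - (- \<theta>2 x z / t x) *\<^sub>R K x w)"
      by (simp add: P_simps PD D_base_I[OF Px] christoffel[OF x] theta_I[OF x] theta_J[OF x] theta_K[OF x]
          base_endo_simps[OF Px] base.products[OF Px] scaleR_add_right algebra_simps half)
  qed (simp_all add: theta_simps[OF x] th e Dth christoffel[OF x] theta_I[OF x] theta_J[OF x] theta_K[OF x]
      sk base.products[OF Px] algebra_simps add_divide_distrib diff_divide_distrib)
qed

lemma orthogonal_I: "x \<in> U \<Longrightarrow> g c x (I x v) (I x w) = g c x v w"
  using base.orthogonal(1)[OF P_in] by (simp add: metric theta_I algebra_simps)

lemma triple_total: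
  assumes x: "x \<in> U" shows "quaternionic_triple (I x) (J x) (K x)"
proof -
  note Px = P_in[OF x]
  have n: "\<theta>0 x (- v) = - \<theta>0 x v" "\<theta>1 x (- v) = - \<theta>1 x v" "\<theta>2 x (- v) = - \<theta>2 x v" "\<theta>3 x (- v) = - \<theta>3 x v" for v
    using linear_theta[OF x] linear_neg by blast+
  show ?thesis
    unfolding quaternionic_triple_def
    by (intro allI conjI; rule frame_eqI[OF x]) (simp_all add: theta_I[OF x] theta_J[OF x] theta_K[OF x]
        base.products[OF Px] n P_simps)
qed

lemma quaternionic_chart_total:
  "quaternionic_chart g c U I J K (\<lambda>x h. - \<theta>1 x h / t x) (\<lambda>x h. - \<theta>2 x h / t x) (\<lambda>x h. - \<theta>3 x h / t x)"
proof -
  interpret J: lifted_chart gb cb Ub Jb Kb Ib aJ aK aI \<nu> g c U J K I P t \<theta>0 \<theta>2 \<theta>3 \<theta>1 by (rule rotate)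
  interpret K: lifted_chart gb cb Ub Kb Ib Jb aK aI aJ \<nu> g c U K I J P t \<theta>0 \<theta>3 \<theta>1 \<theta>2 by (rule J.rotate)
  have lin: "linear (\<lambda>h. - \<theta> h / t x)" if "linear \<theta>" for \<theta> :: "'m \<Rightarrow> real" and x
    by (rule linearI) (simp_all add: linear_add[OF that] linear_scale[OF that] diff_divide_distrib)
  have diff: "(\<lambda>y. - \<theta> y / t y) differentiable (at x)"
    if "(\<theta> has_derivative \<theta>') (at x)" "x \<in> U" for \<theta> \<theta>' x
    using that t_pos[of x] t_derivative[of x] 
    by (intro differentiable_divide differentiable_minus) (auto simp: differentiable_def)
  show ?thesis
    by (intro quaternionic_chart.intro[OF chart_metric_total] quaternionic_chart_axioms.intro)
      (assumption | rule smooth_total_endos triple_total orthogonal_I J.orthogonal_I K.orthogonal_I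
        lin linear_theta nabla_I J.nabla_I K.nabla_I
        diff[OF theta_derivative(2)] diff[OF theta_derivative(3)] diff[OF theta_derivative(4)])+
qed

text \<open>In \<open>d(- I dt / t)\<close> the derivative of \<open>1/t\<close> gives \<open>dt \<and> I dt / t\<^sup>2\<close>, which together with
  \<open>J dt \<and> K dt / t\<^sup>2\<close> is the vertical part of \<open>- \<nu>\<close> times the Kaehler form, while the derivative of \<open>I dt\<close> gives the
  horizontal part.\<close>
lemma curvature_form_I:
  assumes x: "x \<in> U"
  shows "D (\<lambda>y. - \<theta>1 y z / t y) x u - D (\<lambda>y. - \<theta>1 y u / t y) x z
      + (- \<theta>2 x u / t x) * (- \<theta>3 x z / t x) - (- \<theta>2 x z / t x) * (- \<theta>3 x u / t x)
    = - \<nu> * g c x (I x u) z"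
proof -
  note Px = P_in[OF x]
  have tx: "t x \<noteq> 0" using t_pos[OF x] by simp
  have D1: "D (\<lambda>y. - \<theta>1 y z / t y) x u = - \<nu> * D (\<lambda>Y. aI Y (P z)) (P x) (P u) / t x + \<theta>1 x z * \<theta>0 x u / (t x)\<^sup>2" for u z
    unfolding D_eqI[OF has_derivative_divide'[OF has_derivative_minus[OF theta_derivative(2)[OF x]] t_derivative[OF x] tx]]
    using tx by (simp add: field_simps power2_eq_square)
  have rhs: "- \<nu> * g c x (I x u) z = (\<theta>0 x u * \<theta>1 x z - \<theta>1 x u * \<theta>0 x z + \<theta>2 x u * \<theta>3 x z - \<theta>3 x u * \<theta>2 x z) / (t x)\<^sup>2
      - \<nu> / t x * gb cb (P x) (Ib (P x) (P u)) (P z)"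
    using tx nu by (simp add: metric[OF x] theta_I[OF x] field_simps)
  show ?thesis
    unfolding rhs D1 kaehler(1)[OF Px, symmetric]
    using tx by (simp add: field_simps power2_eq_square)
qed

lemma einstein_total:
  assumes x: "x \<in> U"
  shows "ricci g c x u z = (DIM('m) / 4 + 2) * \<nu> * g c x u z"
proof -
  interpret J: lifted_chart gb cb Ub Jb Kb Ib aJ aK aI \<nu> g c U J K I P t \<theta>0 \<theta>2 \<theta>3 \<theta>1 by (rule rotate)
  interpret K: lifted_chart gb cb Ub Kb Ib Jb aK aI aJ \<nu> g c U K I J P t \<theta>0 \<theta>3 \<theta>1 \<theta>2 by (rule J.rotate)
  have "ricci g c x u z = - (DIM('m) / 4 + 2) * (- \<nu>) * g c x u z"
    by (rule quaternionic_chart.einstein[OF quaternionic_chart_total x])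
      (rule curvature_form_I[OF x] J.curvature_form_I[OF x] K.curvature_form_I[OF x])+
  then show ?thesis by (simp add: algebra_simps)
qed

lemma scalar_curvature_total:
  assumes x: "x \<in> U"
  shows "scalar_curvature g c x = (DIM('m) / 4 + 2) * \<nu> * DIM('m)"
  by (rule total.scalar_curvature_einstein[OF x]) (rule einstein_total[OF x])

lemma lee_form_total:
  assumes x: "x \<in> U"
  shows "lee_form g (\<lambda>_. I) c x v = - \<theta>0 x v / t x"
  unfolding quaternionic_chart.lee_form_eq[OF quaternionic_chart_total x]
  by (simp add: theta_J[OF x] theta_K[OF x])

lemma integrable_total:
  assumes x: "x \<in> U" and "X differentiable (at x)" "Y differentiable (at x)"
  shows "lie_bracket (\<lambda>y. I y (X y)) (\<lambda>y. I y (Y y)) x - I x (lie_bracket (\<lambda>y. I y (X y)) Y x)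
      - I x (lie_bracket X (\<lambda>y. I y (Y y)) x) - lie_bracket X Y x = 0"
  by (rule quaternionic_chart.nijenhuis_zero[OF quaternionic_chart_total x _ _ assms(2,3)])
    (simp_all add: theta_I[OF x])

text \<open>The gradient of \<open>- ln t\<close> is \<open>\<nu> t\<close> times the frame vector dual to \<open>dt\<close>.\<close>
lemma norm_sq_total:
  assumes x: "x \<in> U" and phi: "\<And>h. \<phi> c x h = - \<theta>0 x h / t x"
  shows "norm_sq g \<phi> c x = - \<nu>"
proof -
  note Px = P_in[OF x]
  obtain u where u: "\<theta>0 x u = \<nu> * t x" "\<theta>1 x u = 0" "\<theta>2 x u = 0" "\<theta>3 x u = 0" "P u = 0"
    using frame_exists[OF x] by blast
  have "sharp g c x (\<phi> c x) = u"
    using nu t_pos[OF x]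
    by (intro total.sharp_eqI[OF x])
      (simp add: metric[OF x] u phi base.metric_simps[OF Px] field_simps power2_eq_square)
  then show ?thesis using t_pos[OF x] by (simp add: norm_sq_def phi u)
qed

end

section \<open>Charts and their transitions\<close>

lemma chart_inj:
  assumes M: "smooth_manifold M" and c: "c \<in> atlas M"
  shows "inj_on (cmap c) (cdom c)"
proof -
  have "homeomorphic_map (subtopology (mtop M) (cdom c)) (top_of_set (cimg c)) (cmap c)"
    and "cdom c \<subseteq> topspace (mtop M)"
    using M c openin_subset unfolding smooth_manifold_def by blast+
  then show ?thesis
    using homeomorphic_imp_injective_map by (metis topspace_subtopology_subset)
qed

lemma open_cimg: "smooth_manifold M \<Longrightarrow> c \<in> atlas M \<Longrightarrow> open (cimg c)"
  unfolding smooth_manifold_def by blast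

lemma cinv_cmap: "smooth_manifold M \<Longrightarrow> c \<in> atlas M \<Longrightarrow> p \<in> cdom c \<Longrightarrow> cinv c (cmap c p) = p"
  using chart_inj by (metis cinv_def inv_into_f_f)

lemma cmap_cinv: "x \<in> cimg c \<Longrightarrow> cmap c (cinv c x) = x"
  unfolding cimg_def cinv_def by (rule f_inv_into_f)

lemma cinv_in: "x \<in> cimg c \<Longrightarrow> cinv c x \<in> cdom c"
  unfolding cimg_def cinv_def by (rule inv_into_into)

lemma cmap_in: "p \<in> cdom c \<Longrightarrow> cmap c p \<in> cimg c"
  unfolding cimg_def by blast

lemma open_chart_image:
  assumes M: "smooth_manifold M" and c: "c \<in> atlas M" and W: "openin (mtop M) W"
  shows "open (cmap c ` (cdom c \<inter> W))"
proof -
  have h: "homeomorphic_map (subtopology (mtop M) (cdom c)) (top_of_set (cimg c)) (cmap c)"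
    and o: "openin (mtop M) (cdom c)" "open (cimg c)"
    using M c unfolding smooth_manifold_def by blast+
  have "openin (subtopology (mtop M) (cdom c)) (cdom c \<inter> W)"
    using W by (metis Int_commute openin_subtopology_Int)
  then have "openin (top_of_set (cimg c)) (cmap c ` (cdom c \<inter> W))"
    using homeomorphic_map_openness_eq[OF h] by blast
  then show ?thesis using o(2) openin_open_trans by blast
qed

lemma open_transition_domain:
  assumes "smooth_manifold M" "c \<in> atlas M" "c' \<in> atlas M"
  shows "open (cmap c ` (cdom c \<inter> cdom c'))"
proof -
  have "openin (mtop M) (cdom c')" using assms unfolding smooth_manifold_def by blast
  then show ?thesis by (rule open_chart_image[OF assms(1,2)])
qed

lemma smooth_transition:
  assumes "smooth_manifold M" "c \<in> atlas M" "c' \<in> atlas M"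
  shows "smooth_on (cmap c ` (cdom c \<inter> cdom c')) (transition c c')"
  using assms unfolding smooth_manifold_def by blast

lemma transition_cmap:
  "smooth_manifold M \<Longrightarrow> c \<in> atlas M \<Longrightarrow> p \<in> cdom c \<Longrightarrow> transition c c' (cmap c p) = cmap c' p"
  unfolding transition_def by (simp add: cinv_cmap)

lemma transition_differentiable:
  assumes "smooth_manifold M" "c \<in> atlas M" "c' \<in> atlas M" "p \<in> cdom c \<inter> cdom c'"
  shows "transition c c' differentiable (at (cmap c p))"
  using smooth_on_differentiable[OF smooth_transition[OF assms(1-3)]] assms(4) by blast

lemma D_transition_compose:
  assumes M: "smooth_manifold M" and c: "c \<in> atlas M" "c' \<in> atlas M" "c'' \<in> atlas M"
    and p: "p \<in> cdom c" "p \<in> cdom c'" "p \<in> cdom c''"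
  shows "D (transition c' c'') (cmap c' p) (D (transition c c') (cmap c p) v) = D (transition c c'') (cmap c p) v"
proof -
  have op: "openin (mtop M) (cdom c' \<inter> cdom c'')"
    using M c unfolding smooth_manifold_def by blast
  have o: "open (cmap c ` (cdom c \<inter> (cdom c' \<inter> cdom c'')))"
    by (rule open_chart_image[OF M c(1) op])
  have "D (transition c c'') (cmap c p) v = D (\<lambda>y. transition c' c'' (transition c c' y)) (cmap c p) v"
    by (rule fun_cong[OF D_cong[OF o]]) (use p in \<open>auto simp: transition_cmap[OF M c(1)] transition_cmap[OF M c(2)]\<close>)
  also have "\<dots> = D (transition c' c'') (cmap c' p) (D (transition c c') (cmap c p) v)"
  proof (rule D_eqI)
    have 1: "(transition c c' has_derivative D (transition c c') (cmap c p)) (at (cmap c p))"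
      using transition_differentiable[OF M c(1,2)] p has_derivative_D by blast
    have 2: "(transition c' c'' has_derivative D (transition c' c'') (cmap c' p)) (at (transition c c' (cmap c p)))"
      unfolding transition_cmap[OF M c(1) p(1)]
      using transition_differentiable[OF M c(2,3)] p has_derivative_D by blast
    show "((\<lambda>y. transition c' c'' (transition c c' y)) has_derivative
        (\<lambda>v. D (transition c' c'') (cmap c' p) (D (transition c c') (cmap c p) v))) (at (cmap c p))"
      by (rule has_derivative_compose[OF 1 2])
  qed
  finally show ?thesis ..
qed

lemma D_transition_self:
  assumes M: "smooth_manifold M" and c: "c \<in> atlas M" and p: "p \<in> cdom c"
  shows "D (transition c c) (cmap c p) v = v"
proof -
  have "D (transition c c) (cmap c p) v = D (\<lambda>y. y) (cmap c p) v"
    by (rule fun_cong[OF D_cong[OF open_cimg[OF M c]]])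
      (auto simp: transition_def cmap_cinv cmap_in p)
  then show ?thesis by simp
qed

lemma inv_D_transition:
  assumes "smooth_manifold M" "c \<in> atlas M" "c' \<in> atlas M" "p \<in> cdom c \<inter> cdom c'"
  shows "inv (D (transition c c') (cmap c p)) = D (transition c' c) (cmap c' p)"
proof (rule inv_unique_comp)
  have p: "p \<in> cdom c" "p \<in> cdom c'" using assms(4) by auto
  show "D (transition c c') (cmap c p) \<circ> D (transition c' c) (cmap c' p) = id"
    unfolding fun_eq_iff o_apply D_transition_compose[OF assms(1,3,2,3) p(2,1,2)]
    by (simp add: D_transition_self[OF assms(1,3) p(2)])
  show "D (transition c' c) (cmap c' p) \<circ> D (transition c c') (cmap c p) = id"
    unfolding fun_eq_iff o_apply D_transition_compose[OF assms(1,2,3,2) p(1,2,1)]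
    by (simp add: D_transition_self[OF assms(1,2) p(1)])
qed

text \<open>Extension by zero away from the point is possible because covector fields need not be smooth.\<close>
lemma covector_field_through:
  assumes M: "smooth_manifold M" and c: "c \<in> atlas M" and p: "p \<in> cdom c" and l: "linear l"
  obtains \<beta> where "covector_field M \<beta>" "\<beta> c (cmap c p) = l"
proof -
  define \<beta> where "\<beta> = (\<lambda>b x v. if x \<in> cimg b \<and> cinv b x = p then l (D (transition b c) x v) else 0)"
  have lin: "linear (\<beta> b x)" if "b \<in> atlas M" "x \<in> cimg b" for b x
  proof (cases "cinv b x = p")
    case True
    have "p \<in> cdom b" "cmap b p = x" using that cinv_in[OF that(2)] cmap_cinv[OF that(2)] True by auto
    then have "linear (D (transition b c) x)"
      using transition_differentiable[OF M that(1) c, of p] p linear_D by blast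
    from linear_compose[OF this l] show ?thesis using that True by (simp add: \<beta>_def o_def)
  next
    case False
    then show ?thesis by (simp add: \<beta>_def linear_zero)
  qed
  have "covector_field M \<beta>"
    unfolding covector_field_def
  proof (intro conjI ballI allI)
    fix b b' r v assume b: "b \<in> atlas M" "b' \<in> atlas M" and r: "r \<in> cdom b \<inter> cdom b'"
    show "\<beta> b (cmap b r) v = \<beta> b' (cmap b' r) (D (transition b b') (cmap b r) v)"
      using r p by (auto simp: \<beta>_def cmap_in cinv_cmap[OF M b(1)] cinv_cmap[OF M b(2)]
          D_transition_compose[OF M b c])
  qed (rule lin)
  moreover have "\<beta> c (cmap c p) = l"
    by (simp add: fun_eq_iff \<beta>_def cmap_in p cinv_cmap[OF M c] D_transition_self[OF M c])
  ultimately show ?thesis using that by blast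
qed

section \<open>The product with the half-space\<close>

abbreviation half_space :: "quat set" where "half_space \<equiv> {q. fst q > 0}"

definition prod_chart :: "('a, 'e) chart \<Rightarrow> (quat \<times> 'a, quat \<times> 'e) chart" where
  "prod_chart c = (half_space \<times> cdom c, map_prod id (cmap c))"

lemma open_half_space: "open half_space"
  by (intro open_Collect_less continuous_intros)

lemma atlas_half_space_prod: "atlas (half_space_prod M) = prod_chart ` atlas M"
  unfolding half_space_prod_def prod_mfd_def open_submanifold_def prod_chart_def
  by (simp add: image_def del: split_paired_Ex split_paired_All) blast

lemma cdom_prod_chart: "cdom (prod_chart c) = half_space \<times> cdom c"
  and cmap_prod_chart: "cmap (prod_chart c) (q, p) = (q, cmap c p)"
  by (simp_all add: prod_chart_def)

lemma cimg_prod_chart: "cimg (prod_chart c) = half_space \<times> cimg c"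
  unfolding cimg_def prod_chart_def by (simp only: fst_conv snd_conv map_prod_surj_on[OF refl refl] image_id id_apply)

lemma open_prod_chart:
  "smooth_manifold M \<Longrightarrow> c \<in> atlas M \<Longrightarrow> open (half_space \<times> cimg c)"
  by (intro open_Times open_half_space open_cimg)

lemma inj_prod_chart:
  assumes "smooth_manifold M" "c \<in> atlas M"
  shows "inj_on (cmap (prod_chart c)) (cdom (prod_chart c))"
  using chart_inj[OF assms] unfolding prod_chart_def inj_on_def by auto

lemma cinv_prod_chart:
  assumes M: "smooth_manifold M" "c \<in> atlas M" and "q \<in> half_space" "x \<in> cimg c"
  shows "cinv (prod_chart c) (q, x) = (q, cinv c x)"
proof -
  have "(q, x) = cmap (prod_chart c) (q, cinv c x)"
    using assms by (simp add: cmap_prod_chart cmap_cinv)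
  moreover have "(q, cinv c x) \<in> cdom (prod_chart c)"
    using assms by (simp add: cdom_prod_chart cinv_in)
  ultimately show ?thesis
    unfolding cinv_def using inv_into_f_f[OF inj_prod_chart[OF M]] by metis
qed

lemma transition_prod_chart:
  assumes "smooth_manifold M" "c \<in> atlas M" "q \<in> half_space" "x \<in> cimg c"
  shows "transition (prod_chart c) (prod_chart c') (q, x) = (q, transition c c' x)"
  using assms by (simp add: transition_def cinv_prod_chart cmap_prod_chart)

lemma D_transition_prod_chart:
  assumes M: "smooth_manifold M" and c: "c \<in> atlas M" "c' \<in> atlas M" and p: "p \<in> cdom c \<inter> cdom c'"
    and q: "q \<in> half_space"
  shows "D (transition (prod_chart c) (prod_chart c')) (q, cmap c p) h
    = (fst h, D (transition c c') (cmap c p) (snd h))"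
proof -
  have "D (transition (prod_chart c) (prod_chart c')) (q, cmap c p) h
      = D (\<lambda>y. (fst y, transition c c' (snd y))) (q, cmap c p) h"
    by (rule fun_cong[OF D_cong[OF open_prod_chart[OF M c(1)]]])
      (use p q cmap_in[of p c] in \<open>auto simp: transition_prod_chart[OF M c(1)]\<close>)
  also have "\<dots> = (fst h, D (transition c c') (cmap c p) (snd h))"
  proof (rule D_eqI, rule has_derivative_Pair)
    have "(transition c c' has_derivative D (transition c c') (cmap c p)) (at (snd (q, cmap c p)))"
      using transition_differentiable[OF M c p] has_derivative_D by simp
    from has_derivative_compose[OF has_derivative_snd[OF has_derivative_ident] this]
    show "((\<lambda>y. transition c c' (snd y)) has_derivative (\<lambda>h. D (transition c c') (cmap c p) (snd h))) (at (q, cmap c p))" .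
  qed (rule has_derivative_fst[OF has_derivative_ident])
  finally show ?thesis .
qed

lemma second_countable_euclidean: "second_countable (euclidean :: 'e::second_countable_topology topology)"
proof -
  obtain B :: "'e set set" where B: "countable B" "topological_basis B"
    using ex_countable_basis by blast
  then show ?thesis unfolding second_countable_def
    by (intro exI[of _ B]) (auto simp: topological_basis_open elim: topological_basisE[OF B(2)])
qed

lemma second_countable_prod_topology:
  assumes "second_countable X" "second_countable Y"
  shows "second_countable (prod_topology X Y)"
proof -
  obtain A where A: "countable A" "\<And>V. V \<in> A \<Longrightarrow> openin X V"
    "\<And>U x. openin X U \<Longrightarrow> x \<in> U \<Longrightarrow> \<exists>V\<in>A. x \<in> V \<and> V \<subseteq> U"
    using assms(1) unfolding second_countable_def by metis
  obtain B where B: "countable B" "\<And>V. V \<in> B \<Longrightarrow> openin Y V"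
    "\<And>U x. openin Y U \<Longrightarrow> x \<in> U \<Longrightarrow> \<exists>V\<in>B. x \<in> V \<and> V \<subseteq> U"
    using assms(2) unfolding second_countable_def by metis
  show ?thesis unfolding second_countable_def
  proof (intro exI conjI ballI allI impI)
    show "countable ((\<lambda>(V, W). V \<times> W) ` (A \<times> B))" using A(1) B(1) by simp
    show "openin (prod_topology X Y) Z" if "Z \<in> (\<lambda>(V, W). V \<times> W) ` (A \<times> B)" for Z
      using that A(2) B(2) by (auto simp: openin_prod_Times_iff)
    fix Z p assume "openin (prod_topology X Y) Z \<and> p \<in> Z"
    then obtain S T where "openin X S" "openin Y T" "fst p \<in> S" "snd p \<in> T" "S \<times> T \<subseteq> Z"
      unfolding openin_prod_topology_alt by (metis prod.collapse)
    moreover from this obtain V W where "V \<in> A" "fst p \<in> V" "V \<subseteq> S" "W \<in> B" "snd p \<in> W" "W \<subseteq> T"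
      using A(3) B(3) by metis
    ultimately show "\<exists>V\<in>(\<lambda>(V, W). V \<times> W) ` (A \<times> B). p \<in> V \<and> V \<subseteq> Z"
      by (intro bexI[of _ "V \<times> W"]) (auto simp: mem_Times_iff)
  qed
qed

lemma smooth_manifold_half_space_prod:
  assumes M: "smooth_manifold M"
  shows "smooth_manifold (half_space_prod M)"
proof -
  have top: "mtop (half_space_prod M) = prod_topology (top_of_set half_space) (mtop M)"
    by (simp add: half_space_prod_def prod_mfd_def open_submanifold_def)
  have hs: "openin (top_of_set half_space) half_space" by simp
  have chart: "openin (mtop M) (cdom c) \<and> homeomorphic_map (subtopology (mtop M) (cdom c)) (top_of_set (cimg c)) (cmap c)"
    if "c \<in> atlas M" for c
    using M that unfolding smooth_manifold_def by blast
  have homeo: "homeomorphic_map (subtopology (mtop (half_space_prod M)) (cdom (prod_chart c)))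
      (top_of_set (cimg (prod_chart c))) (cmap (prod_chart c))" if c: "c \<in> atlas M" for c
  proof -
    obtain f where f: "homeomorphic_maps (subtopology (mtop M) (cdom c)) (top_of_set (cimg c)) (cmap c) f"
      using chart[OF c] homeomorphic_map_maps by blast
    have "homeomorphic_maps (top_of_set half_space) (top_of_set half_space) (\<lambda>q. q) (\<lambda>q. q)"
      by (simp add: homeomorphic_maps_def)
    with f have "homeomorphic_maps (prod_topology (top_of_set half_space) (subtopology (mtop M) (cdom c)))
        (prod_topology (top_of_set half_space) (top_of_set (cimg c))) (\<lambda>(q, p). (q, cmap c p)) (\<lambda>(q, p). (q, f p))"
      by (subst homeomorphic_maps_prod) simp
    then have "homeomorphic_map (prod_topology (top_of_set half_space) (subtopology (mtop M) (cdom c)))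
        (prod_topology (top_of_set half_space) (top_of_set (cimg c))) (\<lambda>(q, p). (q, cmap c p))"
      using homeomorphic_maps_imp_map by blast
    moreover have "prod_topology (top_of_set half_space) (subtopology (mtop M) (cdom c))
        = subtopology (mtop (half_space_prod M)) (cdom (prod_chart c))"
      by (simp add: top cdom_prod_chart subtopology_Times subtopology_subtopology)
    moreover have "prod_topology (top_of_set half_space) (top_of_set (cimg c)) = top_of_set (cimg (prod_chart c))"
      by (simp add: cimg_prod_chart)
    moreover have "(\<lambda>(q, p). (q, cmap c p)) = cmap (prod_chart c)"
      by (auto simp: prod_chart_def)
    ultimately show ?thesis by simp
  qed
  have trans: "smooth_on (cmap (prod_chart c) ` (cdom (prod_chart c) \<inter> cdom (prod_chart c')))
      (transition (prod_chart c) (prod_chart c'))" if c: "c \<in> atlas M" "c' \<in> atlas M" for c c'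
  proof -
    let ?V = "cmap c ` (cdom c \<inter> cdom c')"
    have dom: "cmap (prod_chart c) ` (cdom (prod_chart c) \<inter> cdom (prod_chart c')) = half_space \<times> ?V"
    proof -
      have "cdom (prod_chart c) \<inter> cdom (prod_chart c') = half_space \<times> (cdom c \<inter> cdom c')"
        by (auto simp: cdom_prod_chart)
      then show ?thesis
        by (simp only: prod_chart_def snd_conv map_prod_surj_on[OF refl refl] image_id id_apply)
    qed
    have o: "open (half_space \<times> ?V)"
      by (intro open_Times open_half_space open_transition_domain[OF M c])
    have "smooth_on (half_space \<times> ?V) (\<lambda>y. (fst y, 0) + (0, transition c c' (snd y)))"
    proof (rule smooth_on_add[OF o])
      show "smooth_on (half_space \<times> ?V) (\<lambda>y. (fst y, 0))"
        by (intro smooth_on_linear[OF o] bounded_linear_Pair bounded_linear_fst bounded_linear_zero)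
      have "smooth_on (half_space \<times> ?V) (\<lambda>y. transition c c' (snd y))"
        by (rule smooth_on_compose_linear[OF o bounded_linear_snd _ smooth_transition[OF M c]]) auto
      then show "smooth_on (half_space \<times> ?V) (\<lambda>y. (0, transition c c' (snd y)))"
        using smooth_on_bounded_linear[OF o bounded_linear_Pair[OF bounded_linear_zero bounded_linear_ident]] by blast
    qed
    then show ?thesis unfolding dom
      by (subst smooth_on_cong[OF o]) (auto simp: transition_prod_chart[OF M c(1)] cmap_in)
  qed
  have charts: "openin (mtop (half_space_prod M)) (cdom (prod_chart c)) \<and> open (cimg (prod_chart c)) \<and>
      homeomorphic_map (subtopology (mtop (half_space_prod M)) (cdom (prod_chart c)))
        (top_of_set (cimg (prod_chart c))) (cmap (prod_chart c))" if "c \<in> atlas M" for c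
    using homeo[OF that] chart[OF that] hs open_prod_chart[OF M that]
    by (simp add: top cdom_prod_chart cimg_prod_chart openin_prod_Times_iff)
  have hausdorff: "Hausdorff_space (mtop (half_space_prod M))"
    unfolding top Hausdorff_space_prod_topology
    using M Hausdorff_space_subtopology Hausdorff_space_euclidean
    unfolding smooth_manifold_def by blast
  have countable: "second_countable (mtop (half_space_prod M))"
    unfolding top using M second_countable_subtopology second_countable_euclidean
    unfolding smooth_manifold_def by (intro second_countable_prod_topology) blast+
  have "(\<Union>c\<in>atlas M. cdom c) = topspace (mtop M)" using M unfolding smooth_manifold_def by blast
  then have "(\<Union>c\<in>prod_chart ` atlas M. cdom c) = topspace (mtop (half_space_prod M))"
    by (auto simp: top cdom_prod_chart)
  with hausdorff countable show ?thesis
    unfolding smooth_manifold_def atlas_half_space_prod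
    by (intro conjI ballI; (elim imageE)?) (simp_all only: charts trans)
qed

section \<open>Forms and structures on the product\<close>

lemma differential_half_space_function:
  assumes M: "smooth_manifold M" "c \<in> atlas M" and x: "q \<in> half_space" "y \<in> cimg c"
    and f: "\<And>q m. f (q, m) = \<phi> q" and d: "(\<phi> has_derivative \<phi>') (at q)"
  shows "differential f (prod_chart c) (q, y) h = \<phi>' (fst h)"
proof -
  have "D (f \<circ> cinv (prod_chart c)) (q, y) h = D (\<lambda>z. \<phi> (fst z)) (q, y) h"
    by (rule fun_cong[OF D_cong[OF open_prod_chart[OF M]]])
      (use x in \<open>auto simp: cinv_prod_chart[OF M] f\<close>)
  also have "\<dots> = \<phi>' (fst h)"
    by (rule D_eqI, rule has_derivative_compose[OF has_derivative_fst[OF has_derivative_ident]]) (simp add: d)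
  finally show ?thesis by (simp add: differential_def)
qed

lemma differential_coordinates:
  assumes "smooth_manifold M" "c \<in> atlas M" "q \<in> half_space" "y \<in> cimg c"
  shows "differential t_coord (prod_chart c) (q, y) h = fst (fst h)"
    "differential u_coord (prod_chart c) (q, y) h = fst (snd (fst h))"
    "differential v_coord (prod_chart c) (q, y) h = fst (snd (snd (fst h)))"
    "differential w_coord (prod_chart c) (q, y) h = snd (snd (snd (fst h)))"
proof -
  note d = differential_half_space_function[OF assms]
  show "differential t_coord (prod_chart c) (q, y) h = fst (fst h)"
    by (rule d[where \<phi> = fst and \<phi>' = fst])
      (auto simp: t_coord_def intro: bounded_linear_imp_has_derivative bounded_linear_fst)
  show "differential u_coord (prod_chart c) (q, y) h = fst (snd (fst h))"
    by (rule d[where \<phi> = "\<lambda>q. fst (snd q)" and \<phi>' = "\<lambda>q. fst (snd q)"])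
      (auto simp: u_coord_def intro!: derivative_eq_intros)
  show "differential v_coord (prod_chart c) (q, y) h = fst (snd (snd (fst h)))"
    by (rule d[where \<phi> = "\<lambda>q. fst (snd (snd q))" and \<phi>' = "\<lambda>q. fst (snd (snd q))"])
      (auto simp: v_coord_def intro!: derivative_eq_intros)
  show "differential w_coord (prod_chart c) (q, y) h = snd (snd (snd (fst h)))"
    by (rule d[where \<phi> = "\<lambda>q. snd (snd (snd q))" and \<phi>' = "\<lambda>q. snd (snd (snd q))"])
      (auto simp: w_coord_def intro!: derivative_eq_intros)
qed

lemma differential_ln_t:
  assumes "smooth_manifold M" "c \<in> atlas M" "q \<in> half_space" "y \<in> cimg c"
  shows "differential (\<lambda>p. ln (t_coord p)) (prod_chart c) (q, y) h = fst (fst h) / fst q"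
  by (rule differential_half_space_function[OF assms, where \<phi> = "\<lambda>q. ln (fst q)" and \<phi>' = "\<lambda>h. fst h / fst q"])
    (use assms(3) in \<open>auto simp: t_coord_def divide_inverse intro!: derivative_eq_intros\<close>)

lemma t_coord_cinv:
  assumes "smooth_manifold M" "c \<in> atlas M" "q \<in> half_space" "y \<in> cimg c"
  shows "t_coord (cinv (prod_chart c) (q, y)) = fst q"
  using assms by (auto simp: cinv_prod_chart t_coord_def split: prod.split)

lemma chart_at:
  assumes "c \<in> atlas M" "p \<in> cdom c"
  shows "chart_at M p \<in> atlas M" "p \<in> cdom (chart_at M p)"
proof -
  have "\<exists>c. c \<in> atlas M \<and> p \<in> cdom c" using assms by blast
  then show "chart_at M p \<in> atlas M" "p \<in> cdom (chart_at M p)"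
    unfolding chart_at_def using someI_ex[of "\<lambda>c. c \<in> atlas M \<and> p \<in> cdom c"] by auto
qed

lemma D_projection:
  assumes M: "smooth_manifold M" "c \<in> atlas M" "c' \<in> atlas M" and q: "q \<in> half_space"
    and p: "p \<in> cdom c" "p \<in> cdom c'"
  shows "D (cmap c' \<circ> snd \<circ> cinv (prod_chart c)) (q, cmap c p) h = D (transition c c') (cmap c p) (snd h)"
proof -
  have "D (cmap c' \<circ> snd \<circ> cinv (prod_chart c)) (q, cmap c p) h
      = D (\<lambda>z. transition c c' (snd z)) (q, cmap c p) h"
    by (rule fun_cong[OF D_cong[OF open_prod_chart[OF M(1,2)]]])
      (use q cmap_in[OF p(1)] in \<open>auto simp: cinv_prod_chart[OF M(1,2)] transition_def\<close>)
  also have "\<dots> = D (transition c c') (cmap c p) (snd h)"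
    by (rule D_eqI, rule has_derivative_compose[OF has_derivative_snd[OF has_derivative_ident]])
      (use transition_differentiable[OF M, of p] p has_derivative_D in simp)
  finally show ?thesis .
qed

lemma pullback1_projection:
  assumes M: "smooth_manifold M" "c \<in> atlas M" and x: "q \<in> half_space" "y \<in> cimg c"
    and \<beta>: "covector_field M \<beta>"
  shows "pullback1 M snd \<beta> (prod_chart c) (q, y) h = \<beta> c y (snd h)"
proof -
  define p where "p = cinv c y"
  have p: "p \<in> cdom c" "y = cmap c p" using x cinv_in cmap_cinv unfolding p_def by metis+
  note ca = chart_at[OF M(2) p(1)]
  have "pullback1 M snd \<beta> (prod_chart c) (q, y) h
      = \<beta> (chart_at M p) (cmap (chart_at M p) p) (D (transition c (chart_at M p)) (cmap c p) (snd h))"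
    using x by (simp add: pullback1_def cinv_prod_chart[OF M] Let_def
        D_projection[OF M ca(1) x(1) p(1) ca(2), folded p(2)] flip: p_def p(2))
  also have "\<dots> = \<beta> c (cmap c p) (snd h)"
    using \<beta> M(2) ca p(1) unfolding covector_field_def by (metis IntI)
  finally show ?thesis using p(2) by simp
qed

lemma pullback2_projection:
  assumes M: "smooth_manifold M" "c \<in> atlas M" and x: "q \<in> half_space" "y \<in> cimg c"
    and B: "bilinear_form M B"
  shows "pullback2 M snd B (prod_chart c) (q, y) h k = B c y (snd h) (snd k)"
proof -
  define p where "p = cinv c y"
  have p: "p \<in> cdom c" "y = cmap c p" using x cinv_in cmap_cinv unfolding p_def by metis+
  note ca = chart_at[OF M(2) p(1)]
  have "pullback2 M snd B (prod_chart c) (q, y) h k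
      = B (chart_at M p) (cmap (chart_at M p) p) (D (transition c (chart_at M p)) (cmap c p) (snd h))
          (D (transition c (chart_at M p)) (cmap c p) (snd k))"
    using x by (simp add: pullback2_def cinv_prod_chart[OF M] Let_def
        D_projection[OF M ca(1) x(1) p(1) ca(2), folded p(2)] flip: p_def p(2))
  also have "\<dots> = B c (cmap c p) (snd h) (snd k)"
    using B M(2) ca p(1) unfolding bilinear_form_def by (metis IntI)
  finally show ?thesis using p(2) by simp
qed

lemma field_eq_half_space_prod:
  "field_eq (half_space_prod M) S T \<longleftrightarrow>
    (\<forall>c\<in>atlas M. \<forall>q\<in>half_space. \<forall>y\<in>cimg c. \<forall>h. S (prod_chart c) (q, y) h = T (prod_chart c) (q, y) h)"
  unfolding field_eq_def atlas_half_space_prod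
  by (simp only: ball_simps cimg_prod_chart fun_eq_iff) (simp add: ball_simps del: split_paired_All, blast?)

lemma covector_field_act:
  assumes \<beta>: "covector_field M \<beta>" and A: "endo_field M A"
  shows "covector_field M (act A \<beta>)"
  unfolding covector_field_def
proof (intro conjI ballI allI)
  show "linear (act A \<beta> c x)" if "c \<in> atlas M" "x \<in> cimg c" for c x
  proof -
    have "linear (A c x)" "linear (\<beta> c x)" using A \<beta> that unfolding endo_field_def covector_field_def by auto
    then show ?thesis unfolding act_def[abs_def]
      using linear_compose[of "A c x" "\<beta> c x"] linear_compose_neg by (auto simp: o_def)
  qed
  show "act A \<beta> c (cmap c p) v = act A \<beta> c' (cmap c' p) (D (transition c c') (cmap c p) v)"
    if "c \<in> atlas M" "c' \<in> atlas M" "p \<in> cdom c \<inter> cdom c'" for c c' p v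
    using A \<beta> that unfolding endo_field_def covector_field_def act_def by metis
qed

text \<open>Testing on pulled-back covectors determines the projection of an endomorphism, since every
  covector at a point is a value of some covector field.\<close>
lemma act_pullback_iff:
  fixes A' :: "('a, 'e::euclidean_space) endo"
  assumes M: "smooth_manifold M" and A': "endo_field M A'"
  shows "(\<forall>\<beta>. covector_field M \<beta> \<longrightarrow>
      field_eq (half_space_prod M) (act A (pullback1 M snd \<beta>)) (pullback1 M snd (act A' \<beta>)))
    \<longleftrightarrow> (\<forall>c\<in>atlas M. \<forall>q\<in>half_space. \<forall>y\<in>cimg c. \<forall>h. snd (A (prod_chart c) (q, y) h) = A' c y (snd h))"
proof (intro iffI allI impI ballI)
  fix c q y h
  assume L: "\<forall>\<beta>. covector_field M \<beta> \<longrightarrow>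
      field_eq (half_space_prod M) (act A (pullback1 M snd \<beta>)) (pullback1 M snd (act A' \<beta>))"
    and c: "c \<in> atlas M" and q: "q \<in> half_space" and y: "y \<in> cimg c"
  show "snd (A (prod_chart c) (q, y) h) = A' c y (snd h)"
  proof (rule euclidean_eqI)
    fix b :: 'e
    have "linear (\<lambda>v. v \<bullet> b)" by (rule linearI) (simp_all add: inner_add_left)
    then obtain \<beta> where \<beta>: "covector_field M \<beta>" "\<beta> c (cmap c (cinv c y)) = (\<lambda>v. v \<bullet> b)"
      using covector_field_through[OF M c cinv_in[OF y]] by metis
    have "act A (pullback1 M snd \<beta>) (prod_chart c) (q, y) h = pullback1 M snd (act A' \<beta>) (prod_chart c) (q, y) h"
      using L \<beta>(1) c q y unfolding field_eq_half_space_prod by blast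
    then show "snd (A (prod_chart c) (q, y) h) \<bullet> b = A' c y (snd h) \<bullet> b"
      using \<beta>(2) unfolding cmap_cinv[OF y]
      by (simp add: pullback1_projection[OF M c q y covector_field_act[OF \<beta>(1) A']])
        (simp add: act_def pullback1_projection[OF M c q y \<beta>(1)])
  qed
next
  fix \<beta>
  assume R: "\<forall>c\<in>atlas M. \<forall>q\<in>half_space. \<forall>y\<in>cimg c. \<forall>h. snd (A (prod_chart c) (q, y) h) = A' c y (snd h)"
    and \<beta>: "covector_field M \<beta>"
  show "field_eq (half_space_prod M) (act A (pullback1 M snd \<beta>)) (pullback1 M snd (act A' \<beta>))"
    unfolding field_eq_half_space_prod
  proof (intro ballI allI)
    fix c q y h assume c: "c \<in> atlas M" and q: "q \<in> half_space" and y: "y \<in> cimg c"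
    then have "snd (A (prod_chart c) (q, y) h) = A' c y (snd h)" using R by blast
    then show "act A (pullback1 M snd \<beta>) (prod_chart c) (q, y) h = pullback1 M snd (act A' \<beta>) (prod_chart c) (q, y) h"
      by (simp add: pullback1_projection[OF M c q y covector_field_act[OF \<beta> A']])
        (simp add: act_def pullback1_projection[OF M c q y \<beta>])
  qed
qed

text \<open>The formulas for 1-forms, evaluated in a product chart, prescribe \<open>dt\<close> and the projection of the
  images under \<open>I\<close>, \<open>J\<close>, \<open>K\<close>. The remaining components are then forced by the quaternion relations.\<close>
lemma lifted_structure_iff:
  assumes M: "smooth_manifold M" and end_fields: "endo_field M I'" "endo_field M J'" "endo_field M K'"
    and \<alpha>: "covector_field M \<alpha>I" "covector_field M \<alpha>J" "covector_field M \<alpha>K"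
  shows "lifted_structure \<nu> M I' J' K' \<alpha>I \<alpha>J \<alpha>K I J K \<longleftrightarrow>
    almost_hypercomplex (half_space_prod M) I J K \<and>
    (\<forall>c\<in>atlas M. \<forall>q\<in>half_space. \<forall>y\<in>cimg c. \<forall>h.
      fst (fst (I (prod_chart c) (q, y) h)) = fst (snd (fst h)) - \<nu> * \<alpha>I c y (snd h) \<and>
      fst (fst (J (prod_chart c) (q, y) h)) = fst (snd (snd (fst h))) - \<nu> * \<alpha>J c y (snd h) \<and>
      fst (fst (K (prod_chart c) (q, y) h)) = snd (snd (snd (fst h))) - \<nu> * \<alpha>K c y (snd h) \<and>
      snd (I (prod_chart c) (q, y) h) = I' c y (snd h) \<and>
      snd (J (prod_chart c) (q, y) h) = J' c y (snd h) \<and>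
      snd (K (prod_chart c) (q, y) h) = K' c y (snd h))"
proof -
  have ev: "field_eq (half_space_prod M) (act A (differential t_coord)) (\<lambda>c x h. - \<omega> c x h + \<nu> * pullback1 M snd \<alpha> c x h)
      \<longleftrightarrow> (\<forall>c\<in>atlas M. \<forall>q\<in>half_space. \<forall>y\<in>cimg c. \<forall>h.
        fst (fst (A (prod_chart c) (q, y) h)) = l h - \<nu> * \<alpha> c y (snd h))"
    if "covector_field M \<alpha>" "\<forall>c\<in>atlas M. \<forall>q\<in>half_space. \<forall>y\<in>cimg c. \<forall>h. \<omega> (prod_chart c) (q, y) h = l h"
    for A \<omega> \<alpha> l
    unfolding field_eq_half_space_prod
    by (intro ball_cong refl all_cong1)
      (auto simp: act_def differential_coordinates(1)[OF M] pullback1_projection[OF M _ _ _ that(1)] that(2))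
  have coords: "\<forall>c\<in>atlas M. \<forall>q\<in>half_space. \<forall>y\<in>cimg c. \<forall>h. differential u_coord (prod_chart c) (q, y) h = fst (snd (fst h))"
    "\<forall>c\<in>atlas M. \<forall>q\<in>half_space. \<forall>y\<in>cimg c. \<forall>h. differential v_coord (prod_chart c) (q, y) h = fst (snd (snd (fst h)))"
    "\<forall>c\<in>atlas M. \<forall>q\<in>half_space. \<forall>y\<in>cimg c. \<forall>h. differential w_coord (prod_chart c) (q, y) h = snd (snd (snd (fst h)))"
    by (intro ballI allI, erule (2) differential_coordinates[OF M])+
  note e = ev[OF \<alpha>(1) coords(1)] ev[OF \<alpha>(2) coords(2)] ev[OF \<alpha>(3) coords(3)]
  note pb = act_pullback_iff[OF M end_fields(1), of I] act_pullback_iff[OF M end_fields(2), of J]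
    act_pullback_iff[OF M end_fields(3), of K]
  have split: "(\<forall>\<beta>. P \<beta> \<longrightarrow> A \<beta> \<and> B \<beta> \<and> C \<beta>)
      \<longleftrightarrow> (\<forall>\<beta>. P \<beta> \<longrightarrow> A \<beta>) \<and> (\<forall>\<beta>. P \<beta> \<longrightarrow> B \<beta>) \<and> (\<forall>\<beta>. P \<beta> \<longrightarrow> C \<beta>)"
    for P A B C :: "('a, 'b) form1 \<Rightarrow> bool" by blast
  show ?thesis
    unfolding lifted_structure_def Let_def split pb e
    by (simp only: ball_conj_distrib all_conj_distrib)
qed

section \<open>Existence of the lifted structure\<close>

lemma smooth_on_Pair:
  fixes f :: "'m::euclidean_space \<Rightarrow> 'e::euclidean_space" and g :: "'m \<Rightarrow> 'f::euclidean_space"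
  assumes S: "open S" and "smooth_on S f" "smooth_on S g"
  shows "smooth_on S (\<lambda>x. (f x, g x))"
proof -
  have "smooth_on S (\<lambda>x. (f x, 0::'f))"
    by (rule smooth_on_bounded_linear[OF S bounded_linear_Pair[OF bounded_linear_ident bounded_linear_zero] assms(2)])
  moreover have "smooth_on S (\<lambda>x. (0::'e, g x))"
    by (rule smooth_on_bounded_linear[OF S bounded_linear_Pair[OF bounded_linear_zero bounded_linear_ident] assms(3)])
  ultimately have "smooth_on S (\<lambda>x. (f x, 0) + (0, g x))" by (rule smooth_on_add[OF S])
  then show ?thesis by simp
qed

text \<open>The coframe \<open>(dt, I dt, J dt, K dt)\<close> together with the projection to the base, as a linear map
  of the tangent space. It is an involution, so it also converts frame components back into
  coordinates.\<close>
definition quat_frame :: "real \<Rightarrow> ('e \<Rightarrow> real) \<Rightarrow> ('e \<Rightarrow> real) \<Rightarrow> ('e \<Rightarrow> real) \<Rightarrow> quat \<times> 'e \<Rightarrow> quat \<times> 'e" where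
  "quat_frame \<nu> a1 a2 a3 h =
    ((fst (fst h), - fst (snd (fst h)) + \<nu> * a1 (snd h), - fst (snd (snd (fst h))) + \<nu> * a2 (snd h),
      - snd (snd (snd (fst h))) + \<nu> * a3 (snd h)), snd h)"

lemma quat_frame_involution: "quat_frame \<nu> a1 a2 a3 (quat_frame \<nu> a1 a2 a3 h) = h"
  by (simp add: quat_frame_def prod_eq_iff)

lemma linear_quat_frame:
  assumes "linear a1" "linear a2" "linear a3"
  shows "linear (quat_frame \<nu> a1 a2 a3)"
  by (rule linearI)
    (simp_all add: quat_frame_def linear_add[OF assms(1)] linear_add[OF assms(2)] linear_add[OF assms(3)]
      linear_scale[OF assms(1)] linear_scale[OF assms(2)] linear_scale[OF assms(3)] algebra_simps)

text \<open>Left multiplication by the quaternion units, transported to the values of the coframe.\<close>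
definition quat_i :: "quat \<Rightarrow> quat" where "quat_i = (\<lambda>(r0, r1, r2, r3). (- r1, r0, - r3, r2))"
definition quat_j :: "quat \<Rightarrow> quat" where "quat_j = (\<lambda>(r0, r1, r2, r3). (- r2, r3, r0, - r1))"
definition quat_k :: "quat \<Rightarrow> quat" where "quat_k = (\<lambda>(r0, r1, r2, r3). (- r3, - r2, r1, r0))"

lemma linear_quat_units: "linear quat_i" "linear quat_j" "linear quat_k"
  by (rule linearI; simp add: quat_i_def quat_j_def quat_k_def split: prod.splits)+

lemma quaternionic_triple_quat_units: "quaternionic_triple quat_i quat_j quat_k"
  by (simp add: quaternionic_triple_def quat_i_def quat_j_def quat_k_def split: prod.splits)

text \<open>Recovers a chart from its product with the half-space. This makes it possible to define fields on
  the product, whose only argument is a product chart, from fields on the base; the quaternion \<open>0\<close> is an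
  arbitrary value for a coordinate that does not matter.\<close>
definition base_chart :: "(quat \<times> 'a, quat \<times> 'e) chart \<Rightarrow> ('a, 'e) chart" where
  "base_chart C = (snd ` cdom C, \<lambda>m. snd (cmap C (0, m)))"

lemma base_chart_prod_chart: "base_chart (prod_chart c) = c"
proof -
  have "(1, 0, 0, 0) \<in> half_space" by simp
  then have "half_space \<noteq> {}" by blast
  then have "snd ` (half_space \<times> cdom c) = cdom c" by (simp only: snd_image_times if_False)
  then show ?thesis
    unfolding base_chart_def prod_chart_def fst_conv snd_conv by (simp only: map_prod_simp snd_conv prod.collapse)
qed

text \<open>The endomorphism that acts as \<open>L\<close> on the values of the coframe and as \<open>A\<close> on the base.\<close>
definition frame_endo :: "real \<Rightarrow> ('a, 'e) form1 \<Rightarrow> ('a, 'e) form1 \<Rightarrow> ('a, 'e) form1 \<Rightarrow> (quat \<Rightarrow> quat)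
    \<Rightarrow> ('a, 'e) endo \<Rightarrow> (quat \<times> 'a, quat \<times> 'e) endo" where
  "frame_endo \<nu> \<alpha>I \<alpha>J \<alpha>K L A C x h =
    (let b = base_chart C; F = quat_frame \<nu> (\<alpha>I b (snd x)) (\<alpha>J b (snd x)) (\<alpha>K b (snd x))
     in F (map_prod L (A b (snd x)) (F h)))"

lemma endo_field_frame_endo:
  fixes M :: "('a, 'e::euclidean_space) mfd"
  assumes M: "smooth_manifold M" and \<alpha>: "one_form M \<alpha>I" "one_form M \<alpha>J" "one_form M \<alpha>K"
    and L: "linear L" and A: "endo_field M A"
  shows "endo_field (half_space_prod M) (frame_endo \<nu> \<alpha>I \<alpha>J \<alpha>K L A)"
proof -
  define F where "F = (\<lambda>c y. quat_frame \<nu> (\<alpha>I c y) (\<alpha>J c y) (\<alpha>K c y))"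
  define N where "N = (\<lambda>c y. map_prod L (A c y))"
  have eq: "frame_endo \<nu> \<alpha>I \<alpha>J \<alpha>K L A (prod_chart c) x = (\<lambda>h. F c (snd x) (N c (snd x) (F c (snd x) h)))" for c x
    by (rule ext) (simp add: frame_endo_def base_chart_prod_chart F_def N_def Let_def)
  have lin\<alpha>: "linear (\<alpha>I c y)" "linear (\<alpha>J c y)" "linear (\<alpha>K c y)" if "c \<in> atlas M" "y \<in> cimg c" for c y
    using \<alpha> that unfolding one_form_def covector_field_def by blast+
  have linA: "linear (A c y)" if "c \<in> atlas M" "y \<in> cimg c" for c y
    using A that unfolding endo_field_def by blast
  have linF: "linear (F c y)" if "c \<in> atlas M" "y \<in> cimg c" for c y
    unfolding F_def by (rule linear_quat_frame) (rule lin\<alpha>[OF that])+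
  have linN: "linear (N c y)" if "c \<in> atlas M" "y \<in> cimg c" for c y
    unfolding N_def
    by (rule linearI) (simp_all add: prod_eq_iff[where 'a = quat] linear_add[OF L] linear_scale[OF L]
        linear_add[OF linA[OF that]] linear_scale[OF linA[OF that]])
  show ?thesis
    unfolding endo_field_def
  proof (intro conjI ballI allI)
    fix C x assume "C \<in> atlas (half_space_prod M)" "x \<in> cimg C"
    then obtain c where c: "c \<in> atlas M" "C = prod_chart c" "snd x \<in> cimg c"
      by (auto simp: atlas_half_space_prod cimg_prod_chart)
    show "linear (frame_endo \<nu> \<alpha>I \<alpha>J \<alpha>K L A C x)"
      unfolding c(2) eq
      using linear_compose[OF linear_compose[OF linF[OF c(1,3)] linN[OF c(1,3)]] linF[OF c(1,3)]]
      by (simp add: o_def)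
  next
    fix C C' P v
    assume "C \<in> atlas (half_space_prod M)" "C' \<in> atlas (half_space_prod M)" and P: "P \<in> cdom C \<inter> cdom C'"
    then obtain c c' where c: "c \<in> atlas M" "C = prod_chart c" "c' \<in> atlas M" "C' = prod_chart c'"
      by (auto simp: atlas_half_space_prod)
    obtain q p where qp: "P = (q, p)" "q \<in> half_space" "p \<in> cdom c \<inter> cdom c'"
      using P by (auto simp: c cdom_prod_chart)
    define T where "T = D (transition c c') (cmap c p)"
    have inv\<alpha>: "\<alpha> c' (cmap c' p) (T v) = \<alpha> c (cmap c p) v" if "one_form M \<alpha>" for \<alpha> v
      using that c qp(3) unfolding one_form_def covector_field_def T_def by metis
    have invA: "A c' (cmap c' p) (T v) = T (A c (cmap c p) v)" for v
      using A c qp(3) unfolding endo_field_def T_def by metis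
    have FT: "F c' (cmap c' p) (fst h, T (snd h)) = (fst (F c (cmap c p) h), T (snd (F c (cmap c p) h)))" for h
      by (simp add: F_def quat_frame_def inv\<alpha>[OF \<alpha>(1)] inv\<alpha>[OF \<alpha>(2)] inv\<alpha>[OF \<alpha>(3)])
    have NT: "N c' (cmap c' p) (fst h, T (snd h)) = (fst (N c (cmap c p) h), T (snd (N c (cmap c p) h)))" for h
      by (simp add: N_def invA)
    show "D (transition C C') (cmap C P) (frame_endo \<nu> \<alpha>I \<alpha>J \<alpha>K L A C (cmap C P) v) =
        frame_endo \<nu> \<alpha>I \<alpha>J \<alpha>K L A C' (cmap C' P) (D (transition C C') (cmap C P) v)"
      unfolding c(2,4) qp(1) cmap_prod_chart eq snd_conv
        D_transition_prod_chart[OF M c(1,3) qp(3,2), folded T_def] FT NT ..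
  next
    fix C v assume "C \<in> atlas (half_space_prod M)"
    then obtain c where c: "c \<in> atlas M" "C = prod_chart c" by (auto simp: atlas_half_space_prod)
    let ?S = "half_space \<times> cimg c"
    note o = open_prod_chart[OF M c(1)]
    have base: "smooth_on ?S (\<lambda>x. f (snd x))" if "smooth_on (cimg c) f" for f :: "'e \<Rightarrow> 'z::real_normed_vector"
      by (rule smooth_on_compose_linear[OF o bounded_linear_snd _ that]) auto
    have sm\<alpha>: "smooth_on ?S (\<lambda>x. r + \<nu> * \<alpha> c (snd x) X)" if "one_form M \<alpha>" for \<alpha> r X
      using that c unfolding one_form_def
      by (intro smooth_on_add[OF o] smooth_on_mult[OF o] smooth_on_const base[of "\<lambda>y. \<alpha> c y X"]) blast
    have smF: "smooth_on ?S (\<lambda>x. F c (snd x) h)" for h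
      unfolding F_def quat_frame_def
      by (intro smooth_on_Pair[OF o] smooth_on_const sm\<alpha> \<alpha>)
    have smN: "smooth_on ?S (\<lambda>x. N c (snd x) h)" for h
    proof -
      have "smooth_on ?S (\<lambda>x. (L (fst h), A c (snd x) (snd h)))"
        using A c unfolding endo_field_def
        by (intro smooth_on_Pair[OF o] smooth_on_const base[of "\<lambda>y. A c y (snd h)"]) blast
      then show ?thesis by (simp add: N_def map_prod_def case_prod_unfold)
    qed
    have "smooth_on ?S (\<lambda>x. N c (snd x) (F c (snd x) v))"
      by (rule smooth_on_apply[OF o _ smN smF]) (auto intro: linN c)
    then have "smooth_on ?S (\<lambda>x. F c (snd x) (N c (snd x) (F c (snd x) v)))"
      by (rule smooth_on_apply[OF o _ smF, rotated]) (auto intro: linF c)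
    then show "smooth_on (cimg C) (\<lambda>x. frame_endo \<nu> \<alpha>I \<alpha>J \<alpha>K L A C x v)"
      unfolding c(2) eq cimg_prod_chart .
  qed
qed

lemma lifted_structure_exists:
  fixes M :: "('a, 'e::euclidean_space) mfd"
  assumes M: "smooth_manifold M" and hc: "almost_hypercomplex M I' J' K'"
    and \<alpha>: "one_form M \<alpha>I" "one_form M \<alpha>J" "one_form M \<alpha>K"
  shows "\<exists>I J K. lifted_structure \<nu> M I' J' K' \<alpha>I \<alpha>J \<alpha>K I J K"
proof -
  have ends: "endo_field M I'" "endo_field M J'" "endo_field M K'"
    and q: "\<And>c y. c \<in> atlas M \<Longrightarrow> y \<in> cimg c \<Longrightarrow> quaternionic_triple (I' c y) (J' c y) (K' c y)"
    using hc unfolding almost_hypercomplex_def by blast+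
  have cov: "covector_field M \<alpha>I" "covector_field M \<alpha>J" "covector_field M \<alpha>K"
    using \<alpha> unfolding one_form_def by blast+
  let ?E = "frame_endo \<nu> \<alpha>I \<alpha>J \<alpha>K"
  have hc: "almost_hypercomplex (half_space_prod M) (?E quat_i I') (?E quat_j J') (?E quat_k K')"
    unfolding almost_hypercomplex_def
  proof (intro conjI ballI endo_field_frame_endo[OF M \<alpha>] linear_quat_units ends)
    fix C x assume "C \<in> atlas (half_space_prod M)" "x \<in> cimg C"
    then obtain c where c: "c \<in> atlas M" "C = prod_chart c" "snd x \<in> cimg c"
      by (auto simp: atlas_half_space_prod cimg_prod_chart)
    have neg: "quat_frame \<nu> (\<alpha>I c y) (\<alpha>J c y) (\<alpha>K c y) (map_prod uminus uminus (quat_frame \<nu> (\<alpha>I c y) (\<alpha>J c y) (\<alpha>K c y) h)) = - h"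
      if "y \<in> cimg c" for y h
    proof -
      have l: "linear (quat_frame \<nu> (\<alpha>I c y) (\<alpha>J c y) (\<alpha>K c y))"
        using cov c(1) that unfolding covector_field_def by (intro linear_quat_frame) blast+
      have "map_prod uminus uminus k = - k" for k :: "quat \<times> 'e" by (simp add: prod_eq_iff)
      then show ?thesis using linear_neg[OF l] by (simp add: quat_frame_involution)
    qed
    show "quaternionic_triple (?E quat_i I' C x) (?E quat_j J' C x) (?E quat_k K' C x)"
      using q[OF c(1,3)] quaternionic_triple_quat_units neg[OF c(3)]
      unfolding quaternionic_triple_def c(2)
      by (simp add: frame_endo_def base_chart_prod_chart quat_frame_involution map_prod_def case_prod_unfold Let_def
          del: split_paired_All)
  qed
  have comp: "fst (fst (?E quat_i I' (prod_chart c) (q, y) h)) = fst (snd (fst h)) - \<nu> * \<alpha>I c y (snd h)"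
    "fst (fst (?E quat_j J' (prod_chart c) (q, y) h)) = fst (snd (snd (fst h))) - \<nu> * \<alpha>J c y (snd h)"
    "fst (fst (?E quat_k K' (prod_chart c) (q, y) h)) = snd (snd (snd (fst h))) - \<nu> * \<alpha>K c y (snd h)"
    "snd (?E quat_i I' (prod_chart c) (q, y) h) = I' c y (snd h)"
    "snd (?E quat_j J' (prod_chart c) (q, y) h) = J' c y (snd h)"
    "snd (?E quat_k K' (prod_chart c) (q, y) h) = K' c y (snd h)" for c q y h
    by (simp_all add: frame_endo_def base_chart_prod_chart quat_frame_def quat_i_def quat_j_def quat_k_def Let_def)
  have "lifted_structure \<nu> M I' J' K' \<alpha>I \<alpha>J \<alpha>K (?E quat_i I') (?E quat_j J') (?E quat_k K')"
    unfolding lifted_structure_iff[OF M ends cov] comp using hc by simp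
  then show ?thesis by blast
qed

section \<open>The lifted manifold is hyper-Hermitian quaternionic Kaehler\<close>

lemma smooth_endo_on_chart: "endo_field N A \<Longrightarrow> c \<in> atlas N \<Longrightarrow> smooth_endo_on (cimg c) (A c)"
  unfolding endo_field_def smooth_endo_on_def by blast

lemma span3_eq_range: "span3 I J K = range (\<lambda>(a, b, c) v. a *\<^sub>R I v + b *\<^sub>R J v + c *\<^sub>R K v)"
  unfolding span3_def by (simp add: image_def)

lemma conjugate_span3:
  assumes "linear T" "\<And>v. T (S v) = v" and "\<And>v. T (I v) = I' (T v)" "\<And>v. T (J v) = J' (T v)" "\<And>v. T (K v) = K' (T v)"
  shows "(\<lambda>A. T \<circ> A \<circ> S) ` span3 I J K = span3 I' J' K'"
proof -
  have "T \<circ> (\<lambda>v. a *\<^sub>R I v + b *\<^sub>R J v + c *\<^sub>R K v) \<circ> S = (\<lambda>v. a *\<^sub>R I' v + b *\<^sub>R J' v + c *\<^sub>R K' v)" for a b c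
    by (simp add: fun_eq_iff linear_add[OF assms(1)] linear_scale[OF assms(1)] assms(2-))
  then have "(\<lambda>A. T \<circ> A \<circ> S) ` (\<lambda>(a, b, c) v. a *\<^sub>R I v + b *\<^sub>R J v + c *\<^sub>R K v) ` UNIV
      = (\<lambda>(a, b, c) v. a *\<^sub>R I' v + b *\<^sub>R J' v + c *\<^sub>R K' v) ` UNIV"
    unfolding image_image by (intro image_cong) auto
  then show ?thesis by (simp only: span3_eq_range)
qed

locale hyper_kaehler_lift =
  fixes M' :: "('a, 'e::euclidean_space) mfd" and g' :: "('a, 'e) bilin"
    and I' J' K' :: "('a, 'e) endo" and \<alpha>I \<alpha>J \<alpha>K :: "('a, 'e) form1" and \<nu> :: real
    and I J K :: "(quat \<times> 'a, quat \<times> 'e) endo"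
  assumes hk: "hyper_kaehler M' g' I' J' K'"
    and one_forms: "one_form M' \<alpha>I" "one_form M' \<alpha>J" "one_form M' \<alpha>K"
    and potentials: "field_eq M' (kaehler_form g' I') (ext_deriv \<alpha>I)"
      "field_eq M' (kaehler_form g' J') (ext_deriv \<alpha>J)"
      "field_eq M' (kaehler_form g' K') (ext_deriv \<alpha>K)"
    and nu: "\<nu> < 0"
    and lifted: "lifted_structure \<nu> M' I' J' K' \<alpha>I \<alpha>J \<alpha>K I J K"
begin

abbreviation M :: "(quat \<times> 'a, quat \<times> 'e) mfd" where "M \<equiv> half_space_prod M'"
abbreviation g :: "(quat \<times> 'a, quat \<times> 'e) bilin" where "g \<equiv> lifted_metric \<nu> M' g' I J K"

text \<open>The forms \<open>I dt\<close>, \<open>J dt\<close>, \<open>K dt\<close> in the product of the half-space with a chart \<open>c\<close> of the base.\<close>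
abbreviation \<theta>1 where "\<theta>1 c x h \<equiv> - fst (snd (fst h)) + \<nu> * \<alpha>I c (snd x) (snd h)"
abbreviation \<theta>2 where "\<theta>2 c x h \<equiv> - fst (snd (snd (fst h))) + \<nu> * \<alpha>J c (snd x) (snd h)"
abbreviation \<theta>3 where "\<theta>3 c x h \<equiv> - snd (snd (snd (fst h))) + \<nu> * \<alpha>K c (snd x) (snd h)"

lemma base_manifold: "smooth_manifold M'"
  and base_metric: "riemannian_metric M' g'"
  and base_bilinear: "bilinear_form M' g'"
  and base_endos: "endo_field M' I'" "endo_field M' J'" "endo_field M' K'"
  using hk unfolding hyper_kaehler_def riemannian_metric_def almost_hypercomplex_def by blast+

lemma covectors: "covector_field M' \<alpha>I" "covector_field M' \<alpha>J" "covector_field M' \<alpha>K"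
  using one_forms unfolding one_form_def by blast+

lemma almost_hypercomplex_total: "almost_hypercomplex M I J K"
  using lifted unfolding lifted_structure_def Let_def by blast

lemma total_endos: "endo_field M I" "endo_field M J" "endo_field M K"
  using almost_hypercomplex_total unfolding almost_hypercomplex_def by blast+

lemma prod_chart_in_atlas: "c \<in> atlas M' \<Longrightarrow> prod_chart c \<in> atlas M"
  by (simp add: atlas_half_space_prod)

lemma chart_cases:
  assumes "C \<in> atlas M"
  obtains c where "c \<in> atlas M'" "C = prod_chart c"
  using assms by (auto simp: atlas_half_space_prod)

lemma base_chart_metric:
  assumes c: "c \<in> atlas M'" shows "chart_metric g' c (cimg c)"
proof
  show "open (cimg c)" by (rule open_cimg[OF base_manifold c])
qed (use base_metric c in \<open>auto simp: riemannian_metric_def bilinear_form_def\<close>)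

lemma base_quaternionic_chart:
  assumes c: "c \<in> atlas M'"
  shows "quaternionic_chart g' c (cimg c) (I' c) (J' c) (K' c) (\<lambda>_ _. 0) (\<lambda>_ _. 0) (\<lambda>_ _. 0)"
proof -
  have "quaternionic_triple (I' c x) (J' c x) (K' c x)" if "x \<in> cimg c" for x
    using hk c that unfolding hyper_kaehler_def almost_hypercomplex_def by blast
  moreover have "g' c x (A c x v) (A c x w) = g' c x v w" "nabla_endo g' c (A c) x z w = 0"
    if "x \<in> cimg c" "A \<in> {I', J', K'}" for x A v w z
    using hk c that unfolding hyper_kaehler_def orthogonal_endo_def parallel_endo_def by blast+
  ultimately show ?thesis
    by (intro quaternionic_chart.intro[OF base_chart_metric[OF c]] quaternionic_chart_axioms.intro
        smooth_endo_on_chart[OF _ c] base_endos) (auto simp: linear_zero)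
qed

lemma structure_components:
  assumes c: "c \<in> atlas M'" and q: "q \<in> half_space" and y: "y \<in> cimg c"
  shows "fst (fst (I (prod_chart c) (q, y) h)) = fst (snd (fst h)) - \<nu> * \<alpha>I c y (snd h)"
    "fst (fst (J (prod_chart c) (q, y) h)) = fst (snd (snd (fst h))) - \<nu> * \<alpha>J c y (snd h)"
    "fst (fst (K (prod_chart c) (q, y) h)) = snd (snd (snd (fst h))) - \<nu> * \<alpha>K c y (snd h)"
    "snd (I (prod_chart c) (q, y) h) = I' c y (snd h)"
    "snd (J (prod_chart c) (q, y) h) = J' c y (snd h)"
    "snd (K (prod_chart c) (q, y) h) = K' c y (snd h)"
  using conjunct2[OF lifted[unfolded lifted_structure_iff[OF base_manifold base_endos covectors]],
      rule_format, OF c q y, of h]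
  by blast+

lemma metric_eq:
  assumes c: "c \<in> atlas M'" and x: "x \<in> half_space \<times> cimg c"
  shows "g (prod_chart c) x h k = - (1 / (\<nu> * (fst (fst x))\<^sup>2)) *
      (fst (fst h) * fst (fst k)
       + fst (fst (I (prod_chart c) x h)) * fst (fst (I (prod_chart c) x k))
       + fst (fst (J (prod_chart c) x h)) * fst (fst (J (prod_chart c) x k))
       + fst (fst (K (prod_chart c) x h)) * fst (fst (K (prod_chart c) x k)))
    + (1 / fst (fst x)) * g' c (snd x) (snd h) (snd k)"
proof -
  obtain q y where qy: "x = (q, y)" "q \<in> half_space" "y \<in> cimg c" using x by auto
  show ?thesis
    unfolding qy(1) lifted_metric_def Let_def L_op_def tensor_def
      t_coord_cinv[OF base_manifold c qy(2,3)] differential_coordinates(1)[OF base_manifold c qy(2,3)]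
      pullback2_projection[OF base_manifold c qy(2,3) base_bilinear]
    by (simp add: add.assoc)
qed

lemma lifted_chart:
  assumes c: "c \<in> atlas M'"
  shows "lifted_chart g' c (cimg c) (I' c) (J' c) (K' c) (\<alpha>I c) (\<alpha>J c) (\<alpha>K c) \<nu>
    g (prod_chart c) (half_space \<times> cimg c) (I (prod_chart c)) (J (prod_chart c)) (K (prod_chart c))
    snd (\<lambda>x. fst (fst x)) (\<lambda>x h. fst (fst h))
    (\<theta>1 c) (\<theta>2 c) (\<theta>3 c)"
proof -
  let ?C = "prod_chart c" and ?U = "half_space \<times> cimg c"
  note o = open_prod_chart[OF base_manifold c]
  have lin\<alpha>: "linear (\<alpha>I c y)" "linear (\<alpha>J c y)" "linear (\<alpha>K c y)" if "y \<in> cimg c" for y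
    using covectors c that unfolding covector_field_def by blast+
  have sm\<alpha>: "smooth_on (cimg c) (\<lambda>y. \<alpha>I c y v)" "smooth_on (cimg c) (\<lambda>y. \<alpha>J c y v)" "smooth_on (cimg c) (\<lambda>y. \<alpha>K c y v)" for v
    using one_forms c unfolding one_form_def by blast+
  have pot: "D (\<lambda>Y. \<alpha> c Y W) X V - D (\<lambda>Y. \<alpha> c Y V) X W = g' c X (A c X V) W"
    if "field_eq M' (kaehler_form g' A) (ext_deriv \<alpha>)" "X \<in> cimg c" for A \<alpha> X V W
    using that c unfolding field_eq_def kaehler_form_def ext_deriv_def by (simp add: fun_eq_iff)
  have endos: "smooth_endo_on ?U (I ?C)" "smooth_endo_on ?U (J ?C)" "smooth_endo_on ?U (K ?C)"
    using smooth_endo_on_chart[OF _ prod_chart_in_atlas[OF c]] total_endos by (simp_all add: cimg_prod_chart)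
  have triple: "quaternionic_triple (I ?C x) (J ?C x) (K ?C x)" if "x \<in> ?U" for x
    using almost_hypercomplex_total prod_chart_in_atlas[OF c] that
    unfolding almost_hypercomplex_def cimg_prod_chart[symmetric] by blast
  have products: "I ?C x (I ?C x h) = - h" "J ?C x (J ?C x h) = - h" "K ?C x (K ?C x h) = - h"
    "I ?C x (J ?C x h) = K ?C x h" "J ?C x (K ?C x h) = I ?C x h" "K ?C x (I ?C x h) = J ?C x h"
    "J ?C x (I ?C x h) = - K ?C x h" "K ?C x (J ?C x h) = - I ?C x h" "I ?C x (K ?C x h) = - J ?C x h"
    if "x \<in> ?U" for x h
    using quaternionic_triple_products[OF smooth_endo_onD(1)[OF endos(1) that] smooth_endo_onD(1)[OF endos(2) that]
        smooth_endo_onD(1)[OF endos(3) that] triple[OF that]] by blast+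
  have comp: "fst (fst (I ?C x h)) = fst (snd (fst h)) - \<nu> * \<alpha>I c (snd x) (snd h)"
    "fst (fst (J ?C x h)) = fst (snd (snd (fst h))) - \<nu> * \<alpha>J c (snd x) (snd h)"
    "fst (fst (K ?C x h)) = snd (snd (snd (fst h))) - \<nu> * \<alpha>K c (snd x) (snd h)"
    "snd (I ?C x h) = I' c (snd x) (snd h)" "snd (J ?C x h) = J' c (snd x) (snd h)"
    "snd (K ?C x h) = K' c (snd x) (snd h)" if "x \<in> ?U" for x h
    using structure_components[OF c, of "fst x" "snd x" h] that by (simp_all add: mem_Times_iff)
  \<comment> \<open>the coframe is \<open>(dt, - dt \<circ> I, - dt \<circ> J, - dt \<circ> K)\<close>, which reduces its behaviour under \<open>I\<close>, \<open>J\<close>,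
    \<open>K\<close> to the quaternion relations\<close>
  have coframe: "\<theta>1 c x h = - fst (fst (I ?C x h))"
    "\<theta>2 c x h = - fst (fst (J ?C x h))"
    "\<theta>3 c x h = - fst (fst (K ?C x h))" if "x \<in> ?U" for x h
    by (simp_all add: comp[OF that])
  have theta_d: "((\<lambda>y. r + \<nu> * \<alpha> (snd y) (snd h)) has_derivative
      (\<lambda>z. \<nu> * D (\<lambda>Y. \<alpha> Y (snd h)) (snd x) (snd z))) (at x)"
    if "x \<in> ?U" "\<And>v. smooth_on (cimg c) (\<lambda>y. \<alpha> y v)" for \<alpha> :: "'e \<Rightarrow> 'e \<Rightarrow> real" and r x h
  proof -
    have "((\<lambda>y. \<alpha> y (snd h)) has_derivative D (\<lambda>Y. \<alpha> Y (snd h)) (snd x)) (at (snd x))"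
      using that by (intro has_derivative_D smooth_on_differentiable[OF that(2)]) auto
    from has_derivative_add[OF has_derivative_const has_derivative_mult_right[OF
          has_derivative_compose[OF has_derivative_snd[OF has_derivative_ident] this]]]
    show ?thesis by simp
  qed
  show ?thesis
  proof (intro lifted_chart.intro[OF base_quaternionic_chart[OF c]] lifted_chart_axioms.intro)
    fix x assume x: "x \<in> ?U"
    then have y: "snd x \<in> cimg c" and q: "fst x \<in> half_space" by auto
    show "linear (\<theta>1 c x)" "linear (\<theta>2 c x)" "linear (\<theta>3 c x)"
      by (rule linearI; simp add: linear_add[OF lin\<alpha>(1)[OF y]] linear_scale[OF lin\<alpha>(1)[OF y]]
          linear_add[OF lin\<alpha>(2)[OF y]] linear_scale[OF lin\<alpha>(2)[OF y]]
          linear_add[OF lin\<alpha>(3)[OF y]] linear_scale[OF lin\<alpha>(3)[OF y]] algebra_simps)+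
    show "linear (\<lambda>h::quat \<times> 'e. fst (fst h))" by (rule linearI) simp_all
    show "0 < fst (fst x)" using q by simp
    show "((\<lambda>x. fst (fst x)) has_derivative (\<lambda>h. fst (fst h))) (at x)"
      by (auto intro!: derivative_eq_intros)
    show "snd x \<in> cimg c" by (rule y)
    show "\<exists>h. fst (fst h) = r0 \<and> \<theta>1 c x h = r1 \<and> \<theta>2 c x h = r2 \<and> \<theta>3 c x h = r3 \<and> snd h = X" for r0 r1 r2 r3 and X :: 'e
      by (rule exI[of _ "((r0, \<nu> * \<alpha>I c (snd x) X - r1, \<nu> * \<alpha>J c (snd x) X - r2, \<nu> * \<alpha>K c (snd x) X - r3), X)"]) simp
    show "h = k" if "fst (fst h) = fst (fst k)"
      "\<theta>1 c x h = \<theta>1 c x k"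
      "\<theta>2 c x h = \<theta>2 c x k"
      "\<theta>3 c x h = \<theta>3 c x k"
      "snd h = snd k" for h k :: "quat \<times> 'e"
      using that by (auto simp: prod_eq_iff)
    show "g ?C x h k = - (1 / (\<nu> * (fst (fst x))\<^sup>2)) *
        (fst (fst h) * fst (fst k) + \<theta>1 c x h * \<theta>1 c x k + \<theta>2 c x h * \<theta>2 c x k + \<theta>3 c x h * \<theta>3 c x k)
        + (1 / fst (fst x)) * g' c (snd x) (snd h) (snd k)" for h k
      unfolding coframe[OF x] metric_eq[OF c x] by simp
    show "fst (fst (I ?C x h)) = - \<theta>1 c x h"
      "\<theta>1 c x (I ?C x h) = fst (fst h)"
      "\<theta>2 c x (I ?C x h) = - \<theta>3 c x h"
      "\<theta>3 c x (I ?C x h) = \<theta>2 c x h" for h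
      unfolding coframe[OF x] products[OF x] by simp_all
    show "snd (I ?C x h) = I' c (snd x) (snd h)" for h by (rule comp[OF x])
    show "fst (fst (J ?C x h)) = - \<theta>2 c x h"
      "\<theta>2 c x (J ?C x h) = fst (fst h)"
      "\<theta>3 c x (J ?C x h) = - \<theta>1 c x h"
      "\<theta>1 c x (J ?C x h) = \<theta>3 c x h" for h
      unfolding coframe[OF x] products[OF x] by simp_all
    show "snd (J ?C x h) = J' c (snd x) (snd h)" for h by (rule comp[OF x])
    show "fst (fst (K ?C x h)) = - \<theta>3 c x h"
      "\<theta>3 c x (K ?C x h) = fst (fst h)"
      "\<theta>1 c x (K ?C x h) = - \<theta>2 c x h"
      "\<theta>2 c x (K ?C x h) = \<theta>1 c x h" for h
      unfolding coframe[OF x] products[OF x] by simp_all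
    show "snd (K ?C x h) = K' c (snd x) (snd h)" for h by (rule comp[OF x])
    show "((\<lambda>y. \<theta>1 c y h) has_derivative
        (\<lambda>z. \<nu> * D (\<lambda>Y. \<alpha>I c Y (snd h)) (snd x) (snd z))) (at x)"
      "((\<lambda>y. \<theta>2 c y h) has_derivative
        (\<lambda>z. \<nu> * D (\<lambda>Y. \<alpha>J c Y (snd h)) (snd x) (snd z))) (at x)"
      "((\<lambda>y. \<theta>3 c y h) has_derivative
        (\<lambda>z. \<nu> * D (\<lambda>Y. \<alpha>K c Y (snd h)) (snd x) (snd z))) (at x)" for h
      by (rule theta_d[OF x sm\<alpha>(1)] theta_d[OF x sm\<alpha>(2)] theta_d[OF x sm\<alpha>(3)])+
  next
    show "smooth_on ?U (\<lambda>x. g ?C x h k)" for h k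
    proof -
      have inv: "smooth_on ?U (\<lambda>x. inverse (fst (fst x)))"
        by (intro smooth_on_inverse[OF o] smooth_on_linear[OF o]
            bounded_linear_compose[OF bounded_linear_fst bounded_linear_fst]) auto
      have e: "smooth_on ?U (\<lambda>x. fst (fst (A x v)))" if "smooth_endo_on ?U A" for A :: "quat \<times> 'e \<Rightarrow> quat \<times> 'e \<Rightarrow> quat \<times> 'e" and v
        by (rule smooth_on_bounded_linear[OF o bounded_linear_compose[OF bounded_linear_fst bounded_linear_fst]])
          (rule smooth_endo_onD(2)[OF that])
      have gb: "smooth_on ?U (\<lambda>x. g' c (snd x) (snd h) (snd k))"
        by (rule smooth_on_compose_linear[OF o bounded_linear_snd _ chart_metric.smooth[OF base_chart_metric[OF c]]]) auto
      have "smooth_on ?U (\<lambda>x. (- (1 / \<nu>) * (inverse (fst (fst x)) * inverse (fst (fst x)))) *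
          (fst (fst h) * fst (fst k)
           + fst (fst (I ?C x h)) * fst (fst (I ?C x k))
           + fst (fst (J ?C x h)) * fst (fst (J ?C x k))
           + fst (fst (K ?C x h)) * fst (fst (K ?C x k)))
        + inverse (fst (fst x)) * g' c (snd x) (snd h) (snd k))"
        by (intro smooth_on_add[OF o] smooth_on_mult[OF o] smooth_on_const inv gb e endos)
      then show ?thesis
        by (subst smooth_on_cong[OF o metric_eq[OF c]]) (simp_all add: power2_eq_square divide_inverse)
    qed
  qed (use nu o in \<open>auto simp: lin\<alpha> smooth_on_differentiable[OF sm\<alpha>(1)] smooth_on_differentiable[OF sm\<alpha>(2)]
      smooth_on_differentiable[OF sm\<alpha>(3)] pot[OF potentials(1)] pot[OF potentials(2)] pot[OF potentials(3)]
      endos linear_snd\<close>)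
qed

lemma total_transition:
  assumes "C \<in> atlas M" "C' \<in> atlas M" "P \<in> cdom C \<inter> cdom C'" "A \<in> {I, J, K}"
  shows "D (transition C C') (cmap C P) (A C (cmap C P) v) = A C' (cmap C' P) (D (transition C C') (cmap C P) v)"
proof -
  have "endo_field M A" using assms(4) total_endos by auto
  then show ?thesis using assms(1-3) unfolding endo_field_def by blast
qed

lemma riemannian_metric_total: "riemannian_metric M g"
  unfolding riemannian_metric_def bilinear_form_def
proof (intro conjI ballI allI impI)
  fix C C' P h k assume "C \<in> atlas M" "C' \<in> atlas M" and P: "P \<in> cdom C \<inter> cdom C'"
  then obtain c c' where c: "c \<in> atlas M'" "C = prod_chart c" "c' \<in> atlas M'" "C' = prod_chart c'"
    by (metis chart_cases)
  obtain q p where qp: "P = (q, p)" "q \<in> half_space" "p \<in> cdom c \<inter> cdom c'"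
    using P by (auto simp: c cdom_prod_chart)
  define T where "T = D (transition c c') (cmap c p)"
  have T: "D (transition C C') (cmap C P) h = (fst h, T (snd h))" for h
    unfolding c(2,4) qp(1) cmap_prod_chart T_def
    by (rule D_transition_prod_chart[OF base_manifold c(1,3) qp(3,2)])
  have base: "g' c' (cmap c' p) (T X) (T Y) = g' c (cmap c p) X Y" for X Y
    using base_bilinear c(1,3) qp(3) unfolding bilinear_form_def T_def by metis
  have A: "A C' (q, cmap c' p) (fst h, T (snd h)) = (fst (A C (q, cmap c p) h), T (snd (A C (q, cmap c p) h)))"
    if "A \<in> {I, J, K}" for A h
    using total_transition[OF _ _ P that, of h] T c prod_chart_in_atlas by (simp add: qp(1) cmap_prod_chart)
  have "(q, cmap c p) \<in> half_space \<times> cimg c" "(q, cmap c' p) \<in> half_space \<times> cimg c'"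
    using qp cmap_in[of p c] cmap_in[of p c'] by simp_all
  then show "g C (cmap C P) h k = g C' (cmap C' P) (D (transition C C') (cmap C P) h) (D (transition C C') (cmap C P) k)"
    unfolding T unfolding c(2,4) qp(1) cmap_prod_chart
    by (simp add: metric_eq[OF c(1)] metric_eq[OF c(3)] A[unfolded c(2,4)] base)
next
  fix C x assume C: "C \<in> atlas M" and x: "x \<in> cimg C"
  obtain c where c: "c \<in> atlas M'" "C = prod_chart c" by (rule chart_cases[OF C])
  interpret chart_metric g C "cimg C"
    using lifted_chart.chart_metric_total[OF lifted_chart[OF c(1)]] unfolding c(2) cimg_prod_chart .
  show "bilinear (g C x)" by (rule bilin[OF x])
  show "g C x v w = g C x w v" for v w by (rule sym[OF x])
  show "0 < g C x v v" if "v \<noteq> 0" for v by (rule pos[OF x that])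
next
  fix C v w assume C: "C \<in> atlas M"
  obtain c where c: "c \<in> atlas M'" "C = prod_chart c" by (rule chart_cases[OF C])
  interpret chart_metric g C "cimg C"
    using lifted_chart.chart_metric_total[OF lifted_chart[OF c(1)]] unfolding c(2) cimg_prod_chart .
  show "smooth_on (cimg C) (\<lambda>x. g C x v w)" by (rule smooth)
qed

lemma quaternionic_chart_of_total:
  assumes "C \<in> atlas M" obtains \<alpha> \<beta> \<gamma> where "quaternionic_chart g C (cimg C) (I C) (J C) (K C) \<alpha> \<beta> \<gamma>"
proof -
  obtain c where c: "c \<in> atlas M'" "C = prod_chart c" by (rule chart_cases[OF assms])
  show ?thesis
    using that lifted_chart.quaternionic_chart_total[OF lifted_chart[OF c(1)]]
    unfolding c(2) cimg_prod_chart by blast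
qed

lemma quaternionic_subbundle_total: "quaternionic_subbundle M g (\<lambda>C x. span3 (I C x) (J C x) (K C x))"
  unfolding quaternionic_subbundle_def Let_def
proof (intro conjI ballI)
  note M = smooth_manifold_half_space_prod[OF base_manifold]
  fix C C' P assume C: "C \<in> atlas M" "C' \<in> atlas M" and P: "P \<in> cdom C \<inter> cdom C'"
  have "linear (D (transition C C') (cmap C P))"
    by (rule linear_D[OF transition_differentiable[OF M C P]])
  moreover have "D (transition C C') (cmap C P) (inv (D (transition C C') (cmap C P)) v) = v" for v
    unfolding inv_D_transition[OF M C P]
    using D_transition_compose[OF M C(2,1,2), of P] D_transition_self[OF M C(2), of P] P by simp
  ultimately show "span3 (I C' (cmap C' P)) (J C' (cmap C' P)) (K C' (cmap C' P)) =
    (\<lambda>A. D (transition C C') (cmap C P) \<circ> A \<circ> inv (D (transition C C') (cmap C P))) `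
      span3 (I C (cmap C P)) (J C (cmap C P)) (K C (cmap C P))"
    by (rule conjugate_span3[symmetric]) (simp_all add: total_transition[OF C P])
next
  fix C x assume C: "C \<in> atlas M" and x: "x \<in> cimg C"
  obtain \<alpha> \<beta> \<gamma> where q: "quaternionic_chart g C (cimg C) (I C) (J C) (K C) \<alpha> \<beta> \<gamma>"
    by (rule quaternionic_chart_of_total[OF C])
  interpret quaternionic_chart g C "cimg C" "I C" "J C" "K C" \<alpha> \<beta> \<gamma> by (rule q)
  show "\<exists>V Ia Ja Ka. open V \<and> x \<in> V \<and> V \<subseteq> cimg C \<and> smooth_endo_on V Ia \<and> smooth_endo_on V Ja \<and> smooth_endo_on V Ka \<and>
      (\<forall>y\<in>V. quaternionic_triple (Ia y) (Ja y) (Ka y) \<and>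
        (\<forall>A\<in>{Ia, Ja, Ka}. \<forall>v w. g C y (A y v) (A y w) = g C y v w) \<and>
        span3 (I C y) (J C y) (K C y) = span3 (Ia y) (Ja y) (Ka y))"
    using open_U x smooth_endos triple orthogonal
    by (intro exI[of _ "cimg C"] exI[of _ "I C"] exI[of _ "J C"] exI[of _ "K C"]) auto
qed

lemma parallel_subbundle_total: "parallel_subbundle M g (\<lambda>C x. span3 (I C x) (J C x) (K C x))"
  unfolding parallel_subbundle_def
proof (intro ballI allI impI; elim conjE)
  fix C V A x z assume C: "C \<in> atlas M" and V: "open V" "V \<subseteq> cimg C" and A: "smooth_endo_on V A"
    and s: "\<forall>y\<in>V. A y \<in> span3 (I C y) (J C y) (K C y)" and x: "x \<in> V"
  obtain \<alpha> \<beta> \<gamma> where "quaternionic_chart g C (cimg C) (I C) (J C) (K C) \<alpha> \<beta> \<gamma>"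
    by (rule quaternionic_chart_of_total[OF C])
  from quaternionic_chart.nabla_in_span[OF this V A _ x] s
  show "nabla_endo g C A x z \<in> span3 (I C x) (J C x) (K C x)" by blast
qed

lemma hypercomplex_total: "hypercomplex M I J K"
proof -
  have "integrable M A" if A: "A \<in> {I, J, K}" for A
    unfolding integrable_def Let_def
  proof (intro ballI allI impI; elim conjE)
    fix C V and X Y :: "quat \<times> 'e \<Rightarrow> quat \<times> 'e" and x assume C: "C \<in> atlas M" and V: "open V" "V \<subseteq> cimg C" and XY: "smooth_on V X" "smooth_on V Y"
      and x: "x \<in> V"
    obtain c where c: "c \<in> atlas M'" "C = prod_chart c" by (rule chart_cases[OF C])
    note l = lifted_chart[OF c(1), folded c(2)]
    note l' = lifted_chart.rotate[OF l]
    note l'' = lifted_chart.rotate[OF l']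
    have xU: "x \<in> half_space \<times> cimg c" using x V c(2) cimg_prod_chart by blast
    note d = smooth_on_differentiable[OF XY(1) x] smooth_on_differentiable[OF XY(2) x]
    show "lie_bracket (\<lambda>y. A C y (X y)) (\<lambda>y. A C y (Y y)) x - A C x (lie_bracket (\<lambda>y. A C y (X y)) Y x)
        - A C x (lie_bracket X (\<lambda>y. A C y (Y y)) x) - lie_bracket X Y x = 0"
      using A
    proof (elim insertE emptyE)
      show ?thesis if "A = I" unfolding that by (rule lifted_chart.integrable_total[OF l xU d])
      show ?thesis if "A = J" unfolding that by (rule lifted_chart.integrable_total[OF l' xU d])
      show ?thesis if "A = K" unfolding that by (rule lifted_chart.integrable_total[OF l'' xU d])
    qed
  qed
  then show ?thesis using almost_hypercomplex_total unfolding hypercomplex_def by blast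
qed

lemma scalar_curvature_of_total:
  assumes "DIM('e) = 4 * (n - 1)" "n > 1" "C \<in> atlas M" "x \<in> cimg C"
  shows "scalar_curvature g C x = 4 * real n * (real n + 2) * \<nu>"
proof -
  obtain c where c: "c \<in> atlas M'" "C = prod_chart c" by (rule chart_cases[OF assms(3)])
  have "DIM(quat \<times> 'e) = 4 * n" using assms by simp
  then show ?thesis
    using lifted_chart.scalar_curvature_total[OF lifted_chart[OF c(1)], of x] assms(4)
    unfolding c(2) cimg_prod_chart by simp
qed

lemma hHqK_total:
  assumes n: "n > 1" and dim: "DIM('e) = 4 * (n - 1)"
  shows "hHqK n M g I J K"
  unfolding hHqK_def
proof (intro conjI ballI)
  have "DIM(quat \<times> 'e) = 4 * n" using assms by simp
  then have "quaternionic_kaehler n M g (\<lambda>C x. span3 (I C x) (J C x) (K C x))"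
    unfolding quaternionic_kaehler_def
    using n smooth_manifold_half_space_prod[OF base_manifold] riemannian_metric_total
      quaternionic_subbundle_total parallel_subbundle_total by blast
  then show "\<exists>S. quaternionic_kaehler n M g S \<and>
      (\<forall>C\<in>atlas M. \<forall>x\<in>cimg C. S C x = span3 (I C x) (J C x) (K C x))" by blast
  show "scalar_curvature g C x \<noteq> 0" if "C \<in> atlas M" "x \<in> cimg C" for C x
    using scalar_curvature_of_total[OF dim n that] n nu by simp
qed (rule hypercomplex_total)

lemma has_reduced_scalar_curvature_total:
  assumes "n > 1" "DIM('e) = 4 * (n - 1)"
  shows "has_reduced_scalar_curvature n M g \<nu>"
  unfolding has_reduced_scalar_curvature_def
  using scalar_curvature_of_total[OF assms(2,1)] assms(1) by simp

lemma lee_form_components: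
  assumes C: "C \<in> atlas M" and x: "x \<in> cimg C"
  defines "\<phi> \<equiv> (\<lambda>c x h. - differential (\<lambda>p. ln (t_coord p)) c x h)"
  shows "\<phi> C x h = - fst (fst h) / fst (fst x)" "A \<in> {I, J, K} \<Longrightarrow> lee_form g A C x h = \<phi> C x h"
    "norm_sq g \<phi> C x = - \<nu>"
proof -
  obtain c where c: "c \<in> atlas M'" "C = prod_chart c" by (rule chart_cases[OF C])
  have xU: "x \<in> half_space \<times> cimg c" using x c(2) cimg_prod_chart by blast
  then obtain q y where qy: "x = (q, y)" "q \<in> half_space" "y \<in> cimg c" by auto
  note l = lifted_chart[OF c(1), folded c(2)]
  note l' = lifted_chart.rotate[OF l]
  note l'' = lifted_chart.rotate[OF l']
  show phi: "\<phi> C x h = - fst (fst h) / fst (fst x)" for h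
    unfolding \<phi>_def c(2) qy(1) differential_ln_t[OF base_manifold c(1) qy(2,3)] by simp
  have const: "lee_form g A C x h = lee_form g (\<lambda>_. A C) C x h" for A
    by (simp add: lee_form_def)
  show "lee_form g A C x h = \<phi> C x h" if "A \<in> {I, J, K}"
    using that
  proof (elim insertE emptyE)
    show ?thesis if "A = I"
      unfolding that phi const[of I] by (rule lifted_chart.lee_form_total[OF l xU])
    show ?thesis if "A = J"
      unfolding that phi const[of J] by (rule lifted_chart.lee_form_total[OF l' xU])
    show ?thesis if "A = K"
      unfolding that phi const[of K] by (rule lifted_chart.lee_form_total[OF l'' xU])
  qed
  show "norm_sq g \<phi> C x = - \<nu>"
    by (rule lifted_chart.norm_sq_total[OF l xU]) (rule phi)
qed

end

theorem theorem5p6: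
  fixes n :: nat and \<nu> :: real
    and M' :: "('a, 'e::euclidean_space) mfd"
    and g' :: "('a, 'e) bilin"
    and I' J' K' :: "('a, 'e) endo"
    and \<alpha>I \<alpha>J \<alpha>K :: "('a, 'e) form1"
  assumes "n > 1"
    and "DIM('e) = 4 * (n - 1)"
    and "hyper_kaehler M' g' I' J' K'"
    and "one_form M' \<alpha>I" and "one_form M' \<alpha>J" and "one_form M' \<alpha>K"
    and "field_eq M' (kaehler_form g' I') (ext_deriv \<alpha>I)"
    and "field_eq M' (kaehler_form g' J') (ext_deriv \<alpha>J)"
    and "field_eq M' (kaehler_form g' K') (ext_deriv \<alpha>K)"
    and "\<nu> < 0"
  shows "(\<exists>I J K. lifted_structure \<nu> M' I' J' K' \<alpha>I \<alpha>J \<alpha>K I J K) \<and>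
    (\<forall>I J K. lifted_structure \<nu> M' I' J' K' \<alpha>I \<alpha>J \<alpha>K I J K \<longrightarrow>
      (let M = half_space_prod M';
           g = lifted_metric \<nu> M' g' I J K;
           \<phi> = (\<lambda>c x h. - differential (\<lambda>p. ln (t_coord p)) c x h)
       in hHqK n M g I J K \<and>
          has_reduced_scalar_curvature n M g \<nu> \<and>
          has_lee_form M g I J K \<phi> \<and>
          (\<forall>c\<in>atlas M. \<forall>x\<in>cimg c. norm_sq g \<phi> c x + \<nu> = 0)))"
proof (intro conjI allI impI)
  show "\<exists>I J K. lifted_structure \<nu> M' I' J' K' \<alpha>I \<alpha>J \<alpha>K I J K"
    using assms(3) unfolding hyper_kaehler_def
    by (intro lifted_structure_exists assms(4-6)) blast+
next
  fix I J K assume "lifted_structure \<nu> M' I' J' K' \<alpha>I \<alpha>J \<alpha>K I J K"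
  then interpret hyper_kaehler_lift M' g' I' J' K' \<alpha>I \<alpha>J \<alpha>K \<nu> I J K
    using assms by unfold_locales
  show "let M = half_space_prod M'; g = lifted_metric \<nu> M' g' I J K;
           \<phi> = (\<lambda>c x h. - differential (\<lambda>p. ln (t_coord p)) c x h)
       in hHqK n M g I J K \<and> has_reduced_scalar_curvature n M g \<nu> \<and> has_lee_form M g I J K \<phi> \<and>
          (\<forall>c\<in>atlas M. \<forall>x\<in>cimg c. norm_sq g \<phi> c x + \<nu> = 0)"
    unfolding Let_def has_lee_form_def field_eq_def
    using hHqK_total[OF assms(1,2)] has_reduced_scalar_curvature_total[OF assms(1,2)] lee_form_components(2,3)
    by (simp add: fun_eq_iff)
qed

end
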